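(* Every correct triangle tiling of the plane is a substitution tiling, i.e. every finite fragment (finite subset of tiles) of it occurs, up to translation, in some supertile.
   Context: Colors are red and green. An arrow is a segment with an orientation and a color. Triangle tiles: congruent isosceles right triangles, each colored red or green, each of whose three sides is an arrow (arbitrary orientation and color). Crossings: the crossing at a vertex $v$ is the set of arrows (tile sides) having $v$ as an endpoint. Type $C_4$: four arrows at right angles: two collinear arrows of the same color passing through $v$ in the same direction (one entering, one leaving; the axis), and two arrows perpendicular to the axis, both entering $v$, of different colors. Type $C_8$: eight arrows at consecutive angles $45^\circ$: an axis as before, two arrows perpendicular to it both entering $v$ and of different colors, and four arrows at $45^\circ$ to the axis leaving $v$, such that for each perpendicular entering arrow, of the two leaving arrows at $45^\circ$ to it, the one on its left (as seen moving along it towards $v$) is red and the one on its right is green. A correct triangle tiling of the plane is a tiling of the plane by triangle tiles such that: (1) tiles meet side to side and shared sides have the same color and orientation; (2) two triangles with a common side have different colors; (3) the crossing at every vertex is of type $C_4$ or $C_8$; (4) at every crossing of type $C_4$, for each of its two perpendicular entering arrows, the triangle immediately to its left (seen moving towards $v$) is red and the one to its right is green. Substitution: a triangle tile is cut by its height (from the right-angle vertex to the midpoint of the hypotenuse) into two triangles similar to it with ratio $\sqrt2$; the height is an arrow oriented from the right-angle vertex to the hypotenuse, colored with the color of the original tile; the new triangle on the left of the height (viewed in the direction of the arrow) is red and the one on the right green; all other sides (including the two halves of the hypotenuse) keep the color and orientation of the corresponding side of the original. The decomposition of a tiling is obtained by applying the substitution to all its tiles and then scaling by $\sqrt2$. A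 supertile of level $n$ is the $n$-fold decomposition of a single triangle tile. *)

theory Defs
  imports "HOL-Analysis.Analysis"
begin

text \<open>The plane is \<^typ>\<open>complex\<close>; multiplication by \<^term>\<open>\<i>\<close> is the counterclockwise quarter turn.\<close>

datatype color = Red | Green

record arrow =
  src :: complex
  tgt :: complex
  arrow_color :: color

abbreviation seg :: "arrow \<Rightarrow> complex set" where
  "seg e \<equiv> closed_segment (src e) (tgt e)"

text \<open>
  The vertices are listed as right angle \<open>apex\<close>, then \<open>end1\<close>, \<open>end2\<close> in counterclockwise order,
  so that every decorated triangle has exactly one representation. The side \<open>leg1\<close> joins \<open>apex\<close>
  and \<open>end1\<close>, \<open>leg2\<close> joins \<open>apex\<close> and \<open>end2\<close>, and \<open>hyp\<close> joins \<open>end1\<close> and \<open>end2\<close>.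
\<close>

record tile =
  apex :: complex
  end1 :: complex
  end2 :: complex
  leg1 :: arrow
  leg2 :: arrow
  hyp :: arrow
  tile_color :: color

definition joins :: "arrow \<Rightarrow> complex \<Rightarrow> complex \<Rightarrow> bool" where
  "joins e x y \<longleftrightarrow> (src e = x \<and> tgt e = y) \<or> (src e = y \<and> tgt e = x)"

text \<open>The parameter \<open>s\<close> is the leg length; it expresses that all tiles are congruent.\<close>

definition triangle_tile :: "real \<Rightarrow> tile \<Rightarrow> bool" where
  "triangle_tile s t \<longleftrightarrow>
     end1 t \<noteq> apex t \<and> cmod (end1 t - apex t) = s \<and>
     end2 t - apex t = \<i> * (end1 t - apex t) \<and>
     joins (leg1 t) (apex t) (end1 t) \<and>
     joins (leg2 t) (apex t) (end2 t) \<and>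
     joins (hyp t) (end1 t) (end2 t)"

definition vertices :: "tile \<Rightarrow> complex set" where
  "vertices t = {apex t, end1 t, end2 t}"

definition sides :: "tile \<Rightarrow> arrow set" where
  "sides t = {leg1 t, leg2 t, hyp t}"

definition triangle :: "tile \<Rightarrow> complex set" where
  "triangle t = convex hull (vertices t)"


definition tiles_plane :: "real \<Rightarrow> tile set \<Rightarrow> bool" where
  "tiles_plane s T \<longleftrightarrow>
     (\<forall>t\<in>T. triangle_tile s t) \<and>
     (\<Union>t\<in>T. triangle t) = UNIV \<and>
     (\<forall>t\<in>T. \<forall>u\<in>T. t \<noteq> u \<longrightarrow> interior (triangle t) \<inter> interior (triangle u) = {})"

definition meet_side_to_side :: "tile \<Rightarrow> tile \<Rightarrow> bool" where
  "meet_side_to_side t u \<longleftrightarrow>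
     triangle t \<inter> triangle u = {} \<or>
     (\<exists>v \<in> vertices t \<inter> vertices u. triangle t \<inter> triangle u = {v}) \<or>
     (\<exists>e\<in>sides t. \<exists>f\<in>sides u. seg e = seg f \<and> triangle t \<inter> triangle u = seg e)"

definition crossing :: "tile set \<Rightarrow> complex \<Rightarrow> arrow set" where
  "crossing T v = {e. (\<exists>t\<in>T. e \<in> sides t) \<and> (src e = v \<or> tgt e = v)}"

text \<open>
  In both predicates \<open>d\<close> is the direction of the ray from \<open>v\<close> on which the arrow lies. Hence an
  arrow with \<open>entering v d\<close> moves in direction \<open>- d\<close>, and its left side is the one towards \<open>- \<i> * d\<close>.
\<close>

definition entering :: "complex \<Rightarrow> complex \<Rightarrow> arrow \<Rightarrow> bool" where
  "entering v d e \<longleftrightarrow> tgt e = v \<and> (\<exists>r>0. src e = v + complex_of_real r * d)"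

definition leaving :: "complex \<Rightarrow> complex \<Rightarrow> arrow \<Rightarrow> bool" where
  "leaving v d e \<longleftrightarrow> src e = v \<and> (\<exists>r>0. tgt e = v + complex_of_real r * d)"

text \<open>The axis \<open>a\<close>, \<open>b\<close> has direction \<open>d\<close>; \<open>p\<close> and \<open>q\<close> are the perpendicular arrows.\<close>

definition axis_with_perpendiculars ::
  "complex \<Rightarrow> complex \<Rightarrow> arrow \<Rightarrow> arrow \<Rightarrow> arrow \<Rightarrow> arrow \<Rightarrow> bool" where
  "axis_with_perpendiculars v d a b p q \<longleftrightarrow>
     d \<noteq> 0 \<and>
     entering v (- d) a \<and> leaving v d b \<and> arrow_color a = arrow_color b \<and>
     entering v (\<i> * d) p \<and> entering v (- \<i> * d) q \<and> arrow_color p \<noteq> arrow_color q"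

definition C4_perpendiculars :: "complex \<Rightarrow> arrow set \<Rightarrow> arrow \<Rightarrow> arrow \<Rightarrow> bool" where
  "C4_perpendiculars v K p q \<longleftrightarrow>
     (\<exists>d a b. axis_with_perpendiculars v d a b p q \<and> K = {a, b, p, q})"

definition type_C4 :: "complex \<Rightarrow> arrow set \<Rightarrow> bool" where
  "type_C4 v K \<longleftrightarrow> (\<exists>p q. C4_perpendiculars v K p q)"

text \<open>
  The arrows \<open>l\<close>, \<open>r\<close> are those to the left and right of \<open>p\<close>; they lie on the rays obtained from
  that of \<open>p\<close> by rotating clockwise and counterclockwise by 45 degrees. Likewise \<open>l'\<close>, \<open>r'\<close> for \<open>q\<close>.
\<close>

definition type_C8 :: "complex \<Rightarrow> arrow set \<Rightarrow> bool" where
  "type_C8 v K \<longleftrightarrow>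
     (\<exists>d a b p q l r l' r'.
        axis_with_perpendiculars v d a b p q \<and>
        leaving v (cis (- pi / 4) * (\<i> * d)) l \<and> arrow_color l = Red \<and>
        leaving v (cis (pi / 4) * (\<i> * d)) r \<and> arrow_color r = Green \<and>
        leaving v (cis (- pi / 4) * (- \<i> * d)) l' \<and> arrow_color l' = Red \<and>
        leaving v (cis (pi / 4) * (- \<i> * d)) r' \<and> arrow_color r' = Green \<and>
        K = {a, b, p, q, l, r, l', r'})"

definition lies_left :: "arrow \<Rightarrow> tile \<Rightarrow> bool" where
  "lies_left e t \<longleftrightarrow>
     e \<in> sides t \<and> (\<forall>z \<in> triangle t. 0 \<le> Im (cnj (tgt e - src e) * (z - src e)))"

definition lies_right :: "arrow \<Rightarrow> tile \<Rightarrow> bool" where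
  "lies_right e t \<longleftrightarrow>
     e \<in> sides t \<and> (\<forall>z \<in> triangle t. Im (cnj (tgt e - src e) * (z - src e)) \<le> 0)"

definition correct_tiling :: "real \<Rightarrow> tile set \<Rightarrow> bool" where
  "correct_tiling s T \<longleftrightarrow>
     tiles_plane s T \<and>
     (\<forall>t\<in>T. \<forall>u\<in>T. t \<noteq> u \<longrightarrow> meet_side_to_side t u) \<and>
     (\<forall>t\<in>T. \<forall>u\<in>T. \<forall>e\<in>sides t. \<forall>f\<in>sides u. seg e = seg f \<longrightarrow> e = f) \<and>
     (\<forall>t\<in>T. \<forall>u\<in>T. t \<noteq> u \<and> sides t \<inter> sides u \<noteq> {} \<longrightarrow> tile_color t \<noteq> tile_color u) \<and>
     (\<forall>t\<in>T. \<forall>v\<in>vertices t. type_C4 v (crossing T v) \<or> type_C8 v (crossing T v)) \<and>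
     (\<forall>v p q. C4_perpendiculars v (crossing T v) p q \<longrightarrow>
        (\<forall>e\<in>{p, q}. \<forall>t\<in>T.
           (lies_left e t \<longrightarrow> tile_color t = Red) \<and>
           (lies_right e t \<longrightarrow> tile_color t = Green)))"


text \<open>The half of the arrow \<open>e\<close> that has the endpoint \<open>x\<close> of \<open>e\<close>.\<close>

definition half_at :: "complex \<Rightarrow> arrow \<Rightarrow> arrow" where
  "half_at x e =
     (if src e = x then e\<lparr>tgt := midpoint (src e) (tgt e)\<rparr>
      else e\<lparr>src := midpoint (src e) (tgt e)\<rparr>)"

definition height :: "tile \<Rightarrow> arrow" where
  "height t = \<lparr>src = apex t, tgt = midpoint (end1 t) (end2 t), arrow_color = tile_color t\<rparr>"

text \<open>Since \<open>apex\<close>, \<open>end1\<close>, \<open>end2\<close> are in counterclockwise order, \<open>end2\<close> is to the left of the height.\<close>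

definition left_part :: "tile \<Rightarrow> tile" where
  "left_part t =
     \<lparr>apex = midpoint (end1 t) (end2 t), end1 = end2 t, end2 = apex t,
      leg1 = half_at (end2 t) (hyp t), leg2 = height t, hyp = leg2 t,
      tile_color = Red\<rparr>"

definition right_part :: "tile \<Rightarrow> tile" where
  "right_part t =
     \<lparr>apex = midpoint (end1 t) (end2 t), end1 = apex t, end2 = end1 t,
      leg1 = height t, leg2 = half_at (end1 t) (hyp t), hyp = leg1 t,
      tile_color = Green\<rparr>"

definition map_arrow :: "(complex \<Rightarrow> complex) \<Rightarrow> arrow \<Rightarrow> arrow" where
  "map_arrow f e = e\<lparr>src := f (src e), tgt := f (tgt e)\<rparr>"

definition map_tile :: "(complex \<Rightarrow> complex) \<Rightarrow> tile \<Rightarrow> tile" where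
  "map_tile f t =
     \<lparr>apex = f (apex t), end1 = f (end1 t), end2 = f (end2 t),
      leg1 = map_arrow f (leg1 t), leg2 = map_arrow f (leg2 t), hyp = map_arrow f (hyp t),
      tile_color = tile_color t\<rparr>"

definition decomposition :: "tile set \<Rightarrow> tile set" where
  "decomposition T = map_tile (\<lambda>z. complex_of_real (sqrt 2) * z) ` (\<Union>t\<in>T. {left_part t, right_part t})"

definition supertile :: "real \<Rightarrow> nat \<Rightarrow> tile set \<Rightarrow> bool" where
  "supertile s n S \<longleftrightarrow> (\<exists>t. triangle_tile s t \<and> S = (decomposition ^^ n) {t})"

definition substitution_tiling :: "real \<Rightarrow> tile set \<Rightarrow> bool" where
  "substitution_tiling s T \<longleftrightarrow>
     (\<forall>F. F \<subseteq> T \<and> finite F \<longrightarrow>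
        (\<exists>n S w. supertile s n S \<and> map_tile (\<lambda>z. z + w) ` F \<subseteq> S))"

end

theory Submission
  imports Defs
begin

text \<open>
  At a crossing of type C4 every tile has its right angle, at a crossing of type C8 an acute angle.
  Condition (4) says that the two tiles sharing a perpendicular leg at a C4 crossing are the red
  and the green part of a larger tile. Since colors alternate, all legs at a C8 crossing are such
  perpendicular legs or none is: in the first case the crossing becomes C4 after composition, in
  the second it stays C8. So the composed tiling satisfies the same local rules, and composition
  can be iterated. It pulls the tiles of a finite fragment together until they all share a C8
  vertex. The arrows at such a vertex are determined by the axis, its color, and the colors of the
  perpendicular arrows, and one decomposition makes the star of the vertex depend on these arrows
  and the tile colors only. All these possibilities occur around the midpoint of a hypotenuse
  inside a supertile.
\<close>

section \<open>Arrows and directions\<close>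

text \<open>Covering and disjoint interiors are used for the given tiling only, to establish
  \<open>coherent_tiles\<close> and connectedness. The locale speaks of vertices, arrows, colors and
  neighbours, so it passes to the composed tiles without a proof that these tile the plane.

  The color of the tiles with \<open>end1\<close> at a C8 vertex decides the fate of the vertex: if
  they are red it stays acute, if they are green it becomes a right angle.

  The tiles of a fragment may never lie in a single composed tile, since they can be on different
  sides of boundaries that persist at all levels. Therefore the aim is a common vertex. It is
  reached by adding one adjacent tile at a time, as parents of adjacent tiles are equal or adjacent.

  Only vertices that stay acute have to be matched with supertiles. At a vertex that becomes a right
  angle, the four composed tiles are the parts of two tiles with a common hypotenuse; one of these
  two is red, and its \<open>end1\<close> is a vertex that stays acute.\<close>

abbreviation opp :: "color \<Rightarrow> color" where
  "opp c \<equiv> (if c = Red then Green else Red)"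

lemma color_neq_iff: "(c \<noteq> c') \<longleftrightarrow> c' = opp c"
  by (cases c; cases c') auto

text \<open>The Boolean is true for an arrow leaving \<open>v\<close>.\<close>

definition ray :: "complex \<Rightarrow> complex \<Rightarrow> bool \<times> color \<Rightarrow> arrow" where
  "ray v w g = \<lparr>src = (if fst g then v else w), tgt = (if fst g then w else v), arrow_color =
    snd g\<rparr>"

lemma ray_sel [simp]:
  "src (ray v w g) = (if fst g then v else w)"
  "tgt (ray v w g) = (if fst g then w else v)"
  "arrow_color (ray v w g) = snd g"
  by (simp_all add: ray_def)

lemma ray_commute: "ray v w (b, c) = ray w v (\<not> b, c)"
  by (simp add: ray_def)

lemma joins_ray: "joins e v w \<longleftrightarrow> (\<exists>g. e = ray v w g)"
proof
  assume "joins e v w"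
  then have "e = ray v w (True, arrow_color e) \<or> e = ray v w (False, arrow_color e)"
    unfolding joins_def ray_def by (auto intro!: arrow.equality)
  then show "\<exists>g. e = ray v w g"
    by blast
qed (auto simp: joins_def)

lemma ray_inject:
  assumes "ray v w g = ray v w' g'" "w \<noteq> v" "w' \<noteq> v"
  shows "w = w'" "g = g'"
  using assms by (auto simp: ray_def prod_eq_iff split: if_splits)

lemma midpoint_complex: "midpoint a b = (a + b) / (2 :: complex)"
  by (simp add: midpoint_def scaleR_conv_of_real)

lemma half_at_ray:
  assumes "v \<noteq> w"
  shows "half_at v (ray v w g) = ray v (midpoint v w) g"
  using assms by (auto simp: half_at_def ray_def midpoint_sym intro!: arrow.equality)

text \<open>Halving keeps orientation and color, so an arrow is recovered from one half. This is how
  the hypotenuse of a composed tile is read off from its parts.\<close>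

lemma half_at_eq_rayD:
  assumes "joins e v w" "v \<noteq> w" "half_at v e = ray v m g" "m \<noteq> v"
  shows "e = ray v w g"
proof -
  obtain g' where g': "e = ray v w g'"
    using assms(1) joins_ray by blast
  have "midpoint v w \<noteq> v"
    using assms(2) by simp
  then show ?thesis
    using half_at_ray[OF assms(2), of g'] assms(3,4) ray_inject(2) g' by metis
qed

section \<open>Eighth turns and the arrows of a C8 crossing\<close>

definition eighth :: complex where
  "eighth = Complex (1 / sqrt 2) (1 / sqrt 2)"

lemma eighth_eq: "complex_of_real (sqrt 2) * eighth = 1 + \<i>"
  by (simp add: eighth_def complex_eq_iff)

lemma eighth_mult_self: "eighth * eighth = \<i>"
  by (simp add: eighth_def complex_eq_iff field_simps)

lemma cmod_eighth [simp]: "cmod eighth = 1"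
  by (simp add: eighth_def cmod_def power_divide)

lemma eighth_nz [simp]: "eighth \<noteq> 0"
  using cmod_eighth by force

lemma sgn_one_plus_i: "sgn (1 + \<i>) = eighth"
  by (simp add: eighth_def complex_eq_iff sgn_eq cmod_def)

lemma sgn_one_minus_i: "sgn (1 - \<i>) = - \<i> * eighth"
  by (simp add: eighth_def complex_eq_iff sgn_eq cmod_def)

lemma eighth_ne [simp]:
  "eighth \<noteq> 1" "eighth \<noteq> -1" "eighth \<noteq> \<i>" "eighth \<noteq> - \<i>"
  "- eighth \<noteq> 1" "- eighth \<noteq> -1" "- eighth \<noteq> \<i>" "- eighth \<noteq> - \<i>"
  "\<i> * eighth \<noteq> 1" "\<i> * eighth \<noteq> -1" "\<i> * eighth \<noteq> \<i>"
    "\<i> * eighth \<noteq> - \<i>"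
  "\<i> * eighth \<noteq> eighth" "\<i> * eighth \<noteq> - eighth"
  "eighth \<noteq> - eighth"  "- eighth \<noteq> eighth"
  by (auto simp: eighth_def complex_eq_iff)

lemma i_ne [simp]: "\<i> \<noteq> - \<i>" "- \<i> \<noteq> \<i>" "\<i> \<noteq> -1" "- \<i> \<noteq> 1"
  "- 1 \<noteq> \<i>" "1 \<noteq> - \<i>"
  by (auto simp: complex_eq_iff)

text \<open>
  The arrows of a C8 crossing, by direction relative to that of the axis: \<open>c\<close> is the color of the
  axis and \<open>p\<close> that of the perpendicular arrow coming from its left. The values off the eight
  directions are irrelevant.
\<close>

definition pattern :: "color \<Rightarrow> color \<Rightarrow> complex \<Rightarrow> bool \<times> color" where
  "pattern c p w =
     (if w = 1 then (True, c) else if w = -1 then (False, c)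
      else if w = \<i> then (False, p) else if w = - \<i> then (False, opp p)
      else if w = eighth \<or> w = - eighth then (True, Red) else (True, Green))"

lemma pattern_simps [simp]:
  "pattern c p 1 = (True, c)"
  "pattern c p (-1) = (False, c)"
  "pattern c p \<i> = (False, p)"
  "pattern c p (- \<i>) = (False, opp p)"
  "pattern c p eighth = (True, Red)"
  "pattern c p (- eighth) = (True, Red)"
  "pattern c p (\<i> * eighth) = (True, Green)"
  "pattern c p (- (\<i> * eighth)) = (True, Green)"
proof -
  have "- (\<i> * eighth) \<noteq> 1" "- (\<i> * eighth) \<noteq> -1" "- (\<i> * eighth) \<noteq> \<i>"
    "- (\<i> * eighth) \<noteq> - \<i>"
    "- (\<i> * eighth) \<noteq> eighth" "- (\<i> * eighth) \<noteq> - eighth"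
    by (auto simp: eighth_def complex_eq_iff)
  then show "pattern c p (- (\<i> * eighth)) = (True, Green)"
    unfolding pattern_def by simp
qed (simp_all add: pattern_def)

definition quarter_turns :: "complex \<Rightarrow> complex set" where
  "quarter_turns w = {w, \<i> * w, - w, - (\<i> * w)}"

lemma quarter_turns_refl [simp]: "w \<in> quarter_turns w"
  by (simp add: quarter_turns_def)

lemma quarter_turns_sym: "x \<in> quarter_turns w \<Longrightarrow> w \<in> quarter_turns x"
  by (auto simp: quarter_turns_def)

lemma quarter_turns_trans: "x \<in> quarter_turns y \<Longrightarrow>
  y \<in> quarter_turns z \<Longrightarrow> x \<in> quarter_turns z"
  by (auto simp: quarter_turns_def)

lemma quarter_turns_i:
  "\<i> * x \<in> quarter_turns w \<longleftrightarrow> x \<in> quarter_turns w"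
  "- x \<in> quarter_turns w \<longleftrightarrow> x \<in> quarter_turns w"
  by (auto simp: quarter_turns_def minus_equation_iff[of x] complex_eq_iff)

lemma quarter_turns_mult: "x \<in> quarter_turns w \<Longrightarrow> a * x \<in> quarter_turns (a * w)"
  by (auto simp: quarter_turns_def)

text \<open>Only the two sides of \<open>t\<close> that meet at \<open>v\<close> are prescribed; the
  side opposite \<open>v\<close> is left open. The condition is vacuous if \<open>v\<close> is not
  an acute vertex of \<open>t\<close>.\<close>

definition star_tile :: "complex \<Rightarrow> complex \<Rightarrow> color \<Rightarrow> color
  \<Rightarrow> tile \<Rightarrow> bool" where
  "star_tile v u c p t \<longleftrightarrow>
     (let g = (\<lambda>x. ray v x (pattern c p (sgn (x - v) / u))) in
       (end1 t = v \<longrightarrow> leg1 t = g (apex t) \<and> hyp t = g (end2 t)) \<and>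
       (end2 t = v \<longrightarrow> leg2 t = g (apex t) \<and> hyp t = g (end1 t)))"

text \<open>
  The axis at \<open>v\<close> has direction \<open>u\<close>, and \<open>w\<close> is the direction of one of the legs; so \<open>w\<close> tells whether the legs
  are the axis and perpendiculars or the diagonals.
\<close>

definition star_at :: "tile set \<Rightarrow> complex \<Rightarrow> complex \<Rightarrow> color
  \<Rightarrow> color \<Rightarrow> complex \<Rightarrow> bool" where
  "star_at T v u c p w \<longleftrightarrow>
     cmod u = 1 \<and> w \<in> {u, eighth * u} \<and>
     (\<forall>t\<in>T. v \<in> {end1 t, end2 t} \<longrightarrow> star_tile v u c p t \<and>
       sgn (apex t - v) \<in> quarter_turns w)"

text \<open>Neighbours are described by equations between vertices, arrows and colors; in this form
  they can be derived for composed tiles from those of the parts. The neighbour across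
  \<open>leg1\<close> is obtained by going round the right angle.\<close>

locale matched_tiles =
  fixes s :: real and T :: "tile set"
  assumes tile: "t \<in> T \<Longrightarrow> triangle_tile s t"
    and unique: "t \<in> T \<Longrightarrow> u \<in> T \<Longrightarrow>
      apex t = apex u \<Longrightarrow> end1 t = end1 u \<Longrightarrow> t = u"
    and leg_neighbour: "t \<in> T \<Longrightarrow> \<exists>u\<in>T. apex u = apex t \<and>
      end1 u = end2 t \<and> leg1 u = leg2 t \<and>
           tile_color u \<noteq> tile_color t"
    and hyp_neighbour: "t \<in> T \<Longrightarrow> \<exists>u\<in>T. end1 u = end2 t \<and>
      end2 u = end1 t \<and> hyp u = hyp t \<and>
           tile_color u \<noteq> tile_color t"

text \<open>
  In \<open>square\<close>, \<open>u\<close> is opposite to the red tile \<open>t\<close> at its right angle. By condition (4) the perpendicular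
  leg of a red tile is \<open>leg2\<close>.
\<close>

locale coherent_tiles = matched_tiles +
  assumes square: "t \<in> T \<Longrightarrow> u \<in> T \<Longrightarrow>
    tile_color t = Red \<Longrightarrow> apex u = apex t \<Longrightarrow>
           end1 u = 2 * apex t - end1 t \<Longrightarrow>
           \<exists>b c p. leg1 t = ray (apex t) (end1 t) (b, c) \<and>
             leg1 u = ray (apex t) (end1 u) (\<not> b, c) \<and>
             leg2 t = ray (apex t) (end2 t) (False, p) \<and> leg2 u = ray (apex t) (end2 u) (False, opp p)"
    and star: "t \<in> T \<Longrightarrow> v \<in> {end1 t, end2 t} \<Longrightarrow>
      \<exists>u c p w. star_at T v u c p w"

section \<open>Relations between the vertices of a tile\<close>

lemma end2_eq: "triangle_tile s t \<Longrightarrow> end2 t = apex t + \<i> * (end1 t - apex t)"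
  unfolding triangle_tile_def by (metis add.commute diff_add_cancel)

lemma apex_eq:
  assumes "triangle_tile s t"
  shows "apex t = ((1 - \<i>) * end1 t + (1 + \<i>) * end2 t) / 2"
  unfolding end2_eq[OF assms] by (simp add: field_simps)

lemma tile_distinct:
  assumes "triangle_tile s t"
  shows "apex t \<noteq> end1 t" "apex t \<noteq> end2 t" "end1 t \<noteq> end2 t"
proof -
  show "apex t \<noteq> end1 t"
    using assms by (auto simp: triangle_tile_def)
  then show "apex t \<noteq> end2 t" "end1 t \<noteq> end2 t"
    unfolding end2_eq[OF assms] by (auto simp: complex_eq_iff)
qed

text \<open>Composition without rescaling: the leg length grows instead.\<close>

definition compose :: "real \<Rightarrow> tile set \<Rightarrow> tile set" where
  "compose s T = {n. triangle_tile (sqrt 2 * s) n \<and> left_part n \<in> T \<and> right_part n \<in> T}"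

section \<open>Neighbours and composition\<close>

lemma left_part_sel [simp]:
  "apex (left_part n) = midpoint (end1 n) (end2 n)" "end1 (left_part n) = end2 n"
  "end2 (left_part n) = apex n" "leg1 (left_part n) = half_at (end2 n) (hyp n)"
  "leg2 (left_part n) = height n" "hyp (left_part n) = leg2 n" "tile_color (left_part n) = Red"
  by (simp_all add: left_part_def)

lemma right_part_sel [simp]:
  "apex (right_part n) = midpoint (end1 n) (end2 n)" "end1 (right_part n) = apex n"
  "end2 (right_part n) = end1 n" "leg1 (right_part n) = height n"
  "leg2 (right_part n) = half_at (end1 n) (hyp n)" "hyp (right_part n) = leg1 n"
  "tile_color (right_part n) = Green"
  by (simp_all add: right_part_def)

lemma height_ray:
  "height n = ray (apex n) (midpoint (end1 n) (end2 n)) (True, tile_color n)"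
  "height n = ray (midpoint (end1 n) (end2 n)) (apex n) (False, tile_color n)"
  by (simp_all add: height_def ray_def)

lemma tile_midpoint:
  assumes "triangle_tile s t"
  shows "midpoint (end1 t) (end2 t) = apex t + (1 + \<i>) / 2 * (end1 t - apex t)"
  unfolding midpoint_complex end2_eq[OF assms] by (simp add: field_simps)

lemma tile_midpoint_end1:
  assumes "triangle_tile s t"
  shows "midpoint (end1 t) (end2 t) - end1 t = (1 - \<i>) / 2 * (apex t - end1 t)"
  unfolding tile_midpoint[OF assms] by (simp add: field_simps)

lemma tile_midpoint_end2:
  assumes "triangle_tile s t"
  shows "midpoint (end1 t) (end2 t) - end2 t = (1 + \<i>) / 2 * (apex t - end2 t)"
  unfolding tile_midpoint[OF assms] unfolding end2_eq[OF assms] by (simp add: field_simps)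

lemma end2_from_end1:
  assumes "triangle_tile s t"
  shows "end2 t - end1 t = (1 - \<i>) * (apex t - end1 t)"
  unfolding end2_eq[OF assms] by (simp add: field_simps)

lemma end1_from_end2:
  assumes "triangle_tile s t"
  shows "end1 t - end2 t = (1 + \<i>) * (apex t - end2 t)"
  unfolding end2_eq[OF assms] by (simp add: field_simps)

lemma tile_midpoint_ne:
  assumes "triangle_tile s t"
  shows "midpoint (end1 t) (end2 t) \<noteq> end1 t" "midpoint (end1 t) (end2 t) \<noteq> end2 t"
    "midpoint (end1 t) (end2 t) \<noteq> apex t"
proof -
  show "midpoint (end1 t) (end2 t) \<noteq> end1 t" "midpoint (end1 t) (end2 t) \<noteq> end2 t"
    using tile_distinct(3)[OF assms] by simp_all
  have "(1 + \<i>) / 2 \<noteq> 0"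
    by (simp add: complex_eq_iff)
  then show "midpoint (end1 t) (end2 t) \<noteq> apex t"
    using tile_distinct(1)[OF assms] unfolding tile_midpoint[OF assms] by simp
qed

lemma cmod_one_plus_i: "cmod (1 + \<i>) = sqrt 2" "cmod (1 - \<i>) = sqrt 2"
  by (simp_all add: cmod_def)

lemma triangle_tile_parts:
  assumes "triangle_tile (sqrt 2 * s) n"
  shows "triangle_tile s (left_part n)" "triangle_tile s (right_part n)"
proof -
  define d where "d = end1 n - apex n"
  have d: "end1 n = apex n + d" "end2 n = apex n + \<i> * d" "d \<noteq> 0" "cmod d = sqrt 2 * s"
    using assms end2_eq[OF assms] by (auto simp: d_def triangle_tile_def)
  have mid: "midpoint (end1 n) (end2 n) = apex n + (1 + \<i>) / 2 * d"
    using tile_midpoint[OF assms] by (simp add: d_def)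
  have e: "end2 n - midpoint (end1 n) (end2 n) = (\<i> - 1) / 2 * d"
    "apex n - midpoint (end1 n) (end2 n) = - ((1 + \<i>) / 2 * d)"
    "end1 n - midpoint (end1 n) (end2 n) = (1 - \<i>) / 2 * d"
    unfolding mid unfolding d(1,2) by (simp_all add: field_simps)
  have norms: "cmod ((\<i> - 1) / 2 * d) = s" "cmod (- ((1 + \<i>) / 2 * d)) = s"
    using d(4) cmod_one_plus_i norm_minus_commute[of "\<i>" 1] by (simp_all add: norm_mult norm_divide)
  have j: "joins (half_at (end2 n) (hyp n)) (midpoint (end1 n) (end2 n)) (end2 n)"
    "joins (half_at (end1 n) (hyp n)) (midpoint (end1 n) (end2 n)) (end1 n)"
    using assms tile_distinct(3)[OF assms]
    by (auto simp: triangle_tile_def joins_def half_at_def midpoint_sym)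
  have k: "joins (height n) (midpoint (end1 n) (end2 n)) (apex n)"
    by (simp add: joins_def height_def)
  have l: "joins (leg1 n) (apex n) (end1 n)" "joins (leg2 n) (end2 n) (apex n)"
    using assms by (auto simp: triangle_tile_def joins_def)
  have rot: "- ((1 + \<i>) / 2 * d) = \<i> * ((\<i> - 1) / 2 * d)"
    "(1 - \<i>) / 2 * d = \<i> * - ((1 + \<i>) / 2 * d)"
    by (simp_all add: field_simps)
  show "triangle_tile s (left_part n)"
    unfolding triangle_tile_def left_part_sel e norms
    using j k l rot(1) tile_midpoint_ne(2)[OF assms] by metis
  show "triangle_tile s (right_part n)"
    unfolding triangle_tile_def right_part_sel e norms
    using j k l rot(2) tile_midpoint_ne(3)[OF assms] by metis
qed

context matched_tiles
begin

text \<open>Two quarter turns about the right angle cross two legs, so the color returns.\<close>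

lemma opposite:
  assumes "t \<in> T"
  shows "\<exists>u\<in>T. \<exists>x\<in>T. apex u = apex t \<and> end1 u = end2 t \<and>
    leg1 u = leg2 t \<and> tile_color u \<noteq> tile_color t \<and>
    apex x = apex t \<and> end1 x = end2 u \<and> end1 x = 2 * apex t - end1 t \<and>
      leg1 x = leg2 u \<and> tile_color x = tile_color t"
proof -
  obtain u where u: "u \<in> T" "apex u = apex t" "end1 u = end2 t" "leg1 u = leg2 t"
    "tile_color u \<noteq> tile_color t"
    using leg_neighbour[OF assms] by blast
  obtain x where x: "x \<in> T" "apex x = apex u" "end1 x = end2 u" "leg1 x = leg2 u"
    "tile_color x \<noteq> tile_color u"
    using leg_neighbour[OF u(1)] by blast
  have "end1 x = 2 * apex t - end1 t"
    unfolding x(3) end2_eq[OF tile[OF u(1)]] u(2,3) end2_eq[OF tile[OF assms]] by (simp add: algebra_simps)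
  moreover have "tile_color x = tile_color t"
    using u(5) x(5) by (cases "tile_color x"; cases "tile_color u"; cases "tile_color t") auto
  ultimately show ?thesis
    using u x by (intro bexI[of _ u] bexI[of _ x]) auto
qed

text \<open>Four quarter turns about the right angle lead back to \<open>t\<close> by
  \<open>unique\<close>; the tile before the last turn is the one across
  \<open>leg1\<close>.\<close>

lemma leg_neighbour':
  assumes "t \<in> T"
  shows "\<exists>u\<in>T. apex u = apex t \<and> end2 u = end1 t \<and> leg2 u = leg1 t \<and>
    tile_color u \<noteq> tile_color t"
proof -
  obtain u x where u: "u \<in> T" "x \<in> T" "apex u = apex t" "end1 u = end2 t" "leg1 u = leg2 t"
    "tile_color u \<noteq> tile_color t"
    "apex x = apex t" "end1 x = 2 * apex t - end1 t" "leg1 x = leg2 u" "tile_color x = tile_color t"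
    using opposite[OF assms] by blast
  obtain y where y: "y \<in> T" "apex y = apex x" "end1 y = end2 x" "leg1 y = leg2 x"
    "tile_color y \<noteq> tile_color x"
    using leg_neighbour[OF u(2)] by blast
  obtain z where z: "z \<in> T" "apex z = apex y" "end1 z = end2 y" "leg1 z = leg2 y"
    "tile_color z \<noteq> tile_color y"
    using leg_neighbour[OF y(1)] by blast
  have e: "end2 y = end1 t"
    unfolding end2_eq[OF tile[OF y(1)]] y(2,3) end2_eq[OF tile[OF u(2)]] u(7,8) by (simp add: algebra_simps)
  then have "z = t"
    using unique[of z t] z y u assms by auto
  then show ?thesis
    using e y z u(7,10) by (intro bexI[of _ y]) auto
qed

text \<open>Crossing the hypotenuse and then a leg is a quarter turn about \<open>end1\<close>; two
  crossings restore the color.\<close>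

lemma rotate_end1:
  assumes "t \<in> T"
  shows "\<exists>x\<in>T. end1 x = end1 t \<and> apex x - end1 t = - \<i> * (apex t - end1 t) \<and>
    tile_color x = tile_color t"
proof -
  obtain u where u: "u \<in> T" "end1 u = end2 t" "end2 u = end1 t" "tile_color u \<noteq> tile_color t"
    using hyp_neighbour[OF assms] by blast
  obtain x where x: "x \<in> T" "apex x = apex u" "end1 x = end2 u" "tile_color x \<noteq> tile_color u"
    using leg_neighbour[OF u(1)] by blast
  have "tile_color x = tile_color t"
    using u(4) x(4) by (cases "tile_color x"; cases "tile_color u"; cases "tile_color t") auto
  moreover have "apex x - end1 t = - \<i> * (apex t - end1 t)"
    unfolding x(2) apex_eq[OF tile[OF u(1)]] apex_eq[OF tile[OF assms]] u(2,3)
    by (simp add: field_simps)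
  ultimately show ?thesis
    using u x by (intro bexI[of _ x]) auto
qed

lemma rotate_end1_quarter_turns:
  assumes "t \<in> T" "w \<in> quarter_turns (apex t - end1 t)"
  shows "\<exists>x\<in>T. end1 x = end1 t \<and> apex x - end1 t = w \<and> tile_color x = tile_color t"
proof -
  obtain x1 where x1: "x1\<in>T" "end1 x1 = end1 t" "apex x1 - end1 t = - \<i> * (apex t - end1 t)"
    "tile_color x1 = tile_color t"
    using rotate_end1[OF assms(1)] by blast
  obtain x2 where x2: "x2\<in>T" "end1 x2 = end1 x1" "apex x2 - end1 x1 = - \<i> * (apex x1 - end1 x1)"
    "tile_color x2 = tile_color x1"
    using rotate_end1[OF x1(1)] by blast
  obtain x3 where x3: "x3\<in>T" "end1 x3 = end1 x2" "apex x3 - end1 x2 = - \<i> * (apex x2 - end1 x2)"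
    "tile_color x3 = tile_color x2"
    using rotate_end1[OF x2(1)] by blast
  have "apex x2 - end1 t = - (apex t - end1 t)" "apex x3 - end1 t = \<i> * (apex t - end1 t)"
    using x3(3) unfolding x2(2) x2(3)[unfolded x1(2)] unfolding x1(2) using x2(3) unfolding x1(2,3)
      by (simp_all add: right_diff_distrib)
  then have "w \<in> {apex t - end1 t, apex x1 - end1 t, apex x2 - end1 t, apex x3 - end1 t}"
    using assms(2) x1(3) unfolding quarter_turns_def by auto
  then show ?thesis
    using assms(1) x1 x2 x3 by auto
qed

end

context coherent_tiles
begin

text \<open>The witness is the larger tile with height \<open>leg2 t\<close>. Its hypotenuse joins
  \<open>leg1 t\<close> to the collinear leg of the opposite tile, which by \<open>square\<close>
  has the same color and continues in the same direction. Its color must be that of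
  \<open>leg2 t\<close>, because the substitution gives the height the color of the tile.\<close>

lemma compose_left:
  assumes t: "t \<in> T" "tile_color t = Red"
  shows "\<exists>n\<in>compose s T. left_part n = t"
proof -
  obtain u x where u: "u \<in> T" "x \<in> T" "apex u = apex t" "end1 u = end2 t" "leg1 u = leg2 t"
    "tile_color u \<noteq> tile_color t"
    "apex x = apex t" "end1 x = end2 u" "end1 x = 2 * apex t - end1 t" "leg1 x = leg2 u"
      "tile_color x = tile_color t"
    using opposite[OF t(1)] by blast
  obtain b c p where sq: "leg1 t = ray (apex t) (end1 t) (b, c)" "leg1 x = ray (apex t) (end1 x) (\<not> b, c)"
             "leg2 t = ray (apex t) (end2 t) (False, p)"
    using square[OF t(1) u(2) t(2) u(7,9)] by blast
  define n where "n = \<lparr>apex = end2 t, end1 = end2 u, end2 = end1 t, leg1 = hyp u, leg2 = hyp t,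
     hyp = ray (end2 u) (end1 t) (b, c), tile_color = p\<rparr>"
  have sel: "apex n = end2 t" "end1 n = end2 u" "end2 n = end1 t" "leg1 n = hyp u" "leg2 n = hyp t"
     "hyp n = ray (end2 u) (end1 t) (b, c)" "tile_color n = p"
    by (simp_all add: n_def)
  have e2: "end2 u = 2 * apex t - end1 t"
    using u by simp
  have mid: "midpoint (end1 n) (end2 n) = apex t"
    unfolding sel e2 midpoint_complex by simp
  have ne: "end2 u \<noteq> end1 t"
    using e2 tile_distinct[OF tile[OF t(1)]] by auto
  have nt: "triangle_tile (sqrt 2 * s) n"
  proof -
    have d: "end2 u - end2 t = - (1 + \<i>) * (end1 t - apex t)"
      "end1 t - end2 t = (1 - \<i>) * (end1 t - apex t)"
      using e2 end2_eq[OF tile[OF t(1)]] by (simp_all add: algebra_simps)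
    have "cmod (- (1 + \<i>) * (end1 t - apex t)) = sqrt 2 * s"
      using tile[OF t(1)] cmod_one_plus_i by (simp add: norm_mult triangle_tile_def
        norm_minus_cancel[of "1+\<i>", simplified])
    moreover have "joins (hyp u) (end2 t) (end2 u)" "joins (hyp t) (end2 t) (end1 t)"
      using tile[OF t(1)] tile[OF u(1)] u(4) by (auto simp: triangle_tile_def joins_def)
    ultimately show ?thesis
      unfolding triangle_tile_def sel d
      using tile_distinct[OF tile[OF u(1)]] u(4) by (auto simp: joins_def algebra_simps)
  qed
  have "half_at (end1 t) (hyp n) = leg1 t"
    unfolding sel ray_commute[of "end2 u"] half_at_ray[OF ne[symmetric]] sq(1)
    using mid by (simp add: midpoint_sym sel ray_commute[of "apex t"])
  moreover have "height n = leg2 t"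
    unfolding height_ray(2) mid unfolding sel sq(3) ..
  moreover have "half_at (end2 u) (hyp n) = leg2 u"
    unfolding sel half_at_ray[OF ne] u(10)[symmetric] sq(2)
    using mid by (simp add: midpoint_sym sel ray_commute[of "apex t"] u)
  moreover have "tile_color u = Green"
    using u(6) t(2) by (cases "tile_color u") auto
  ultimately have "left_part n = t" "right_part n = u"
    using mid t u by (auto intro!: tile.equality simp: sel)
  then show ?thesis
    using nt t u by (intro bexI[of _ n]) (auto simp: compose_def)
qed

lemma compose_right:
  assumes t: "t \<in> T" "tile_color t = Green"
  shows "\<exists>n\<in>compose s T. right_part n = t"
proof -
  obtain u where u: "u \<in> T" "apex u = apex t" "end2 u = end1 t" "leg2 u = leg1 t"
    "tile_color u \<noteq> tile_color t"
    using leg_neighbour'[OF t(1)] by blast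
  then have "tile_color u = Red"
    using t by (cases "tile_color u") auto
  then obtain n where n: "n \<in> compose s T" "left_part n = u"
    using compose_left u by blast
  have "right_part n = t"
    using n u t by (intro unique) (auto simp: compose_def)
  then show ?thesis
    using n by blast
qed

text \<open>
  The legs at \<open>end1 t\<close> are all heights of larger tiles, hence they leave \<open>end1 t\<close>. Only the diagonals
  of a C8 crossing do.
\<close>

lemma green_star:
  assumes "t \<in> T" "tile_color t = Green" "star_at T (end1 t) u c p w"
  shows "w = eighth * u"
proof (rule ccontr)
  assume "w \<noteq> eighth * u"
  then have w: "w = u"
    using assms(3) by (auto simp: star_at_def)
  have u: "cmod u = 1" "sgn (apex t - end1 t) \<in> quarter_turns u"
    using assms(1,3) w by (auto simp: star_at_def)
  define r where "r = complex_of_real (cmod (apex t - end1 t))"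
  have r: "apex t - end1 t = r * sgn (apex t - end1 t)" "r \<noteq> 0"
    using tile_distinct[OF tile[OF assms(1)]] by (auto simp: r_def sgn_eq)
  have "r * u \<in> quarter_turns (apex t - end1 t)"
    using quarter_turns_mult[OF u(2), of r] r(1) quarter_turns_sym by metis
  then have "- (r * u) \<in> quarter_turns (apex t - end1 t)"
    by (simp add: quarter_turns_i)
  \<comment> \<open>Turning \<open>t\<close> puts a leg on the entering half of the axis, in
    direction \<open>- u\<close>. Being \<open>leg1\<close> of a green tile it is also a height,
    which would have to leave the vertex.\<close>
  then obtain x where x: "x \<in> T" "end1 x = end1 t" "apex x - end1 t = - (r * u)" "tile_color x = Green"
    using rotate_end1_quarter_turns[OF assms(1)] assms(2) by metis
  have "sgn r = 1"
    using r(2) by (simp add: r_def sgn_of_real)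
  then have "sgn (apex x - end1 x) = - u"
    using x(2,3) u(1) by (simp add: sgn_mult sgn_minus sgn_eq[of u])
  then have "leg1 x = ray (end1 x) (apex x) (False, c)"
    using assms(3) x(1,2) u(1) by (auto simp: star_at_def star_tile_def Let_def)
  moreover obtain n where "n \<in> compose s T" "right_part n = x"
    using compose_right x by blast
  ultimately have "src (height n) = apex x" "src (height n) = end1 x"
    by (metis right_part_sel(4) ray_sel(1) fst_conv, metis right_part_sel(2) height_ray(1) ray_sel(1) fst_conv)
  then show False
    using tile_distinct[OF tile[OF x(1)]] by simp
qed

end

section \<open>The composed tiling\<close>

lemma star_tileD:
  assumes "star_tile v u c p t"
  shows "end1 t = v \<Longrightarrow> leg1 t = ray v (apex t) (pattern c p (sgn (apex t - v) / u))"
    "end1 t = v \<Longrightarrow> hyp t = ray v (end2 t) (pattern c p (sgn (end2 t - v) / u))"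
    "end2 t = v \<Longrightarrow> leg2 t = ray v (apex t) (pattern c p (sgn (apex t - v) / u))"
    "end2 t = v \<Longrightarrow> hyp t = ray v (end1 t) (pattern c p (sgn (end1 t - v) / u))"
  using assms by (auto simp: star_tile_def Let_def)

lemma sgn_two_complex [simp]: "sgn (2 :: complex) = 1"
  by (simp add: sgn_eq)

context coherent_tiles
begin

lemma composeD:
  assumes "n \<in> compose s T"
  shows "triangle_tile (sqrt 2 * s) n" "left_part n \<in> T" "right_part n \<in> T"
  using assms by (auto simp: compose_def)

text \<open>The diagonals of the old star are the heights of the composed tiles around
  \<open>apex n\<close> and carry their colors. The red diagonals are \<open>eighth\<close> and its
  negative, so the color tells whether \<open>leg1 n\<close> lies on the axis. The legs of
  \<open>n\<close> are hypotenuses of its parts and therefore obey the old pattern.\<close>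

lemma compose_apex_star:
  assumes n: "n \<in> compose s T" and star: "star_at T (apex n) u c p w"
  shows "\<exists>x\<in>quarter_turns 1. sgn (end1 n - apex n) = x * u \<and>
     tile_color n = (if x \<in> {1, -1} then Red else Green) \<and>
     leg1 n = ray (apex n) (end1 n) (pattern c p x) \<and>
     leg2 n = ray (apex n) (end2 n) (pattern c p (\<i> * x))"
proof -
  note nt = composeD(1)[OF n]
  have w: "w = eighth * u"
    using green_star[OF composeD(3)[OF n]] star by simp
  have u: "cmod u = 1" "u \<noteq> 0"
    using star by (auto simp: star_at_def)
  define x where "x = sgn (end1 n - apex n) / u"
  have x: "sgn (end1 n - apex n) = x * u"
    using u by (simp add: x_def)
  have "end2 n - apex n = \<i> * (end1 n - apex n)"
    using nt by (simp add: triangle_tile_def)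
  then have ix: "sgn (end2 n - apex n) / u = \<i> * x"
    using u by (simp add: sgn_mult x sgn_eq[of "\<i>"])
  have "midpoint (end1 n) (end2 n) - apex n = (1 + \<i>) / 2 * (end1 n - apex n)"
    using tile_midpoint[OF nt] by simp
  then have mid: "sgn (midpoint (end1 n) (end2 n) - apex n) = eighth * x * u"
    by (simp only:) (simp add: sgn_mult sgn_divide x sgn_one_plus_i)
  have S: "t \<in> T \<Longrightarrow> apex n \<in> {end1 t, end2 t} \<Longrightarrow>
    star_tile (apex n) u c p t \<and> sgn (apex t - apex n) \<in> quarter_turns w" for t
    using star unfolding star_at_def by blast
  have L: "star_tile (apex n) u c p (left_part n)"
    using S[OF composeD(2)[OF n]] by simp
  have R: "star_tile (apex n) u c p (right_part n)"
    "sgn (midpoint (end1 n) (end2 n) - apex n) \<in> quarter_turns w"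
    using S[OF composeD(3)[OF n]] by simp_all
  have "inverse (eighth * u) * (eighth * x * u) \<in> quarter_turns (inverse (eighth * u) * (eighth * u))"
    using R(2) quarter_turns_mult unfolding mid w by blast
  then have x1: "x \<in> quarter_turns 1"
    using u by (simp add: field_simps)
  have l: "leg1 n = ray (apex n) (end1 n) (pattern c p x)"
    "leg2 n = ray (apex n) (end2 n) (pattern c p (\<i> * x))"
    using star_tileD(2)[OF R(1)] star_tileD(4)[OF L] u by (simp_all add: x ix)
  have "height n = ray (apex n) (midpoint (end1 n) (end2 n)) (pattern c p (eighth * x))"
    using star_tileD(1)[OF R(1)] u by (simp add: mid sgn_divide)
  then have "tile_color n = snd (pattern c p (eighth * x))"
    by (metis height_ray(1) ray_sel(3) snd_conv)
  then have "tile_color n = (if x \<in> {1, -1} then Red else Green)"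
    using x1 unfolding quarter_turns_def by (auto simp: mult.commute[of eighth])
  then show ?thesis
    using x x1 l by blast
qed

text \<open>At an acute vertex of a composed tile the old legs are halves of its hypotenuse and the
  old hypotenuses are its legs. So the pattern is kept and only the leg directions turn by 45
  degrees.\<close>

lemma compose_star_at:
  assumes "star_at T v u c p w"
  shows "\<exists>w'. star_at (compose s T) v u c p w'"
proof -
  have u: "cmod u = 1" "w = u \<or> w = eighth * u"
    using assms by (auto simp: star_at_def)
  define w' where "w' = (if w = u then eighth * u else u)"
  have w': "eighth * w \<in> quarter_turns w'" "w' \<in> {u, eighth * u}"
    using u(2) eighth_mult_self by (auto simp: w'_def quarter_turns_def mult.assoc[symmetric])
  have "star_tile v u c p n \<and> sgn (apex n - v) \<in> quarter_turns w'"
    if n: "n \<in> compose s T" and v: "v \<in> {end1 n, end2 n}" for n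
  proof -
    note nt = composeD(1)[OF n]
    have j: "joins (hyp n) (end1 n) (end2 n)" "joins (hyp n) (end2 n) (end1 n)"
      using nt by (auto simp: triangle_tile_def joins_def)
    note ne = tile_distinct[OF nt] tile_midpoint_ne[OF nt]
    have star: "star_tile v u c p t \<and> sgn (apex t - v) \<in> quarter_turns w" if "t \<in> T"
      "v \<in> {end1 t, end2 t}" for t
      using assms that by (auto simp: star_at_def)
    have mid: "midpoint (end1 n) (end2 n) - end1 n = (end2 n - end1 n) / 2"
       "midpoint (end1 n) (end2 n) - end2 n = (end1 n - end2 n) / 2"
      by (simp_all add: midpoint_complex field_simps)
    have 1: "leg1 n = ray v (apex n) (pattern c p (sgn (apex n - v) / u))"
       "hyp n = ray v (end2 n) (pattern c p (sgn (end2 n - v) / u))"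
       "sgn (apex n - v) \<in> quarter_turns w'" if v: "v = end1 n"
    proof -
      have R: "star_tile v u c p (right_part n)" "sgn (midpoint (end1 n) (end2 n) - v) \<in> quarter_turns w"
        using star[OF composeD(3)[OF n]] v by auto
      show "leg1 n = ray v (apex n) (pattern c p (sgn (apex n - v) / u))"
        using star_tileD(4)[OF R(1)] v by simp
      have "half_at v (hyp n) = ray v (midpoint (end1 n) (end2 n)) (pattern c p (sgn (end2 n - v) / u))"
        using star_tileD(3)[OF R(1)] v by (simp add: mid sgn_divide)
      then show "hyp n = ray v (end2 n) (pattern c p (sgn (end2 n - v) / u))"
        using half_at_eq_rayD j ne v by metis
      have "(1 + \<i>) * (midpoint (end1 n) (end2 n) - v) = apex n - v"
        unfolding v tile_midpoint_end1[OF nt] by (simp add: field_simps)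
      then have "sgn (apex n - v) = eighth * sgn (midpoint (end1 n) (end2 n) - v)"
        by (metis sgn_mult sgn_one_plus_i)
      then show "sgn (apex n - v) \<in> quarter_turns w'"
        using quarter_turns_mult[OF R(2), of eighth] w'(1) quarter_turns_trans by metis
    qed
    have 2: "leg2 n = ray v (apex n) (pattern c p (sgn (apex n - v) / u))"
       "hyp n = ray v (end1 n) (pattern c p (sgn (end1 n - v) / u))"
       "sgn (apex n - v) \<in> quarter_turns w'" if v: "v = end2 n"
    proof -
      have R: "star_tile v u c p (left_part n)" "sgn (midpoint (end1 n) (end2 n) - v) \<in> quarter_turns w"
        using star[OF composeD(2)[OF n]] v by auto
      show "leg2 n = ray v (apex n) (pattern c p (sgn (apex n - v) / u))"
        using star_tileD(2)[OF R(1)] v by simp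
      have "half_at v (hyp n) = ray v (midpoint (end1 n) (end2 n)) (pattern c p (sgn (end1 n - v) / u))"
        using star_tileD(1)[OF R(1)] v by (simp add: mid sgn_divide)
      then show "hyp n = ray v (end1 n) (pattern c p (sgn (end1 n - v) / u))"
        using half_at_eq_rayD j ne v by metis
      have "(1 - \<i>) * (midpoint (end1 n) (end2 n) - v) = apex n - v"
        unfolding v tile_midpoint_end2[OF nt] by (simp add: field_simps)
      then have "sgn (apex n - v) = - \<i> * (eighth * sgn (midpoint (end1 n) (end2 n) - v))"
        by (metis sgn_mult sgn_one_minus_i mult.assoc)
      then show "sgn (apex n - v) \<in> quarter_turns w'"
        using quarter_turns_mult[OF R(2), of eighth] w'(1) quarter_turns_trans quarter_turns_i by simp
    qed
    show ?thesis
      using 1 2 v unfolding star_tile_def Let_def by blast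
  qed
  then show ?thesis
    using u(1) w'(2) unfolding star_at_def by blast
qed

text \<open>The tile across a leg of \<open>n\<close> is found across the hypotenuse of a part of
  \<open>n\<close>; the tile across the hypotenuse of \<open>n\<close> is found opposite a part at
  the midpoint. Colors and arrows at the new right angles come from the old stars through
  \<open>compose_apex_star\<close>.\<close>

lemma compose_coherent: "coherent_tiles (sqrt 2 * s) (compose s T)"
proof unfold_locales
  fix n assume n: "n \<in> compose s T"
  show "triangle_tile (sqrt 2 * s) n"
    using composeD(1)[OF n] .
next
  fix n m assume n: "n \<in> compose s T" and m: "m \<in> compose s T" and eq: "apex n = apex m"
    "end1 n = end1 m"
  note nt = composeD(1)[OF n] note mt = composeD(1)[OF m]
  have e2: "end2 n = end2 m"
    using end2_eq[OF nt] end2_eq[OF mt] eq by simp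
  \<comment> \<open>The parts coincide and determine the composed tile: its legs are their
    hypotenuses, its color is that of the height, and its hypotenuse extends a half.\<close>
  have L: "left_part n = left_part m" and R: "right_part n = right_part m"
    using composeD(2,3)[OF n] composeD(2,3)[OF m] eq e2 by (auto intro!: unique)
  have eqs: "leg1 n = leg1 m" "leg2 n = leg2 m" "height n = height m"
    "half_at (end2 n) (hyp n) = half_at (end2 n) (hyp m)"
    using arg_cong[OF R, of hyp] arg_cong[OF L, of hyp] arg_cong[OF L, of leg2] arg_cong[OF L, of leg1] e2
    by simp_all
  have "joins (hyp n) (end2 n) (end1 n)" "joins (hyp m) (end2 n) (end1 n)"
    using nt mt eq e2 by (auto simp: triangle_tile_def joins_def)
  then obtain g g' where g: "hyp n = ray (end2 n) (end1 n) g" "hyp m = ray (end2 n) (end1 n) g'"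
    unfolding joins_ray by blast
  have "ray (end2 n) (midpoint (end2 n) (end1 n)) g = ray (end2 n) (midpoint (end2 n) (end1 n)) g'"
    using eqs(4) unfolding g half_at_ray[OF tile_distinct(3)[OF nt, symmetric]] .
  then have "g = g'"
    by (rule ray_inject) (use tile_distinct(3)[OF nt] in auto)
  then have "hyp n = hyp m" "leg1 n = leg1 m" "leg2 n = leg2 m" "tile_color n = tile_color m"
    using g eqs by (simp_all add: height_def)
  then show "n = m"
    using eq e2 by (auto intro!: tile.equality)
next
  fix n assume n: "n \<in> compose s T"
  note nt = composeD(1)[OF n]
  obtain g where g: "g \<in> T" "end1 g = apex n" "end2 g = end2 n" "hyp g = leg2 n" "tile_color g \<noteq> Red"
    using hyp_neighbour[OF composeD(2)[OF n]] by auto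
  then have "tile_color g = Green"
    by (cases "tile_color g") auto
  then obtain m where m: "m \<in> compose s T" "right_part m = g"
    using compose_right g(1) by blast
  have eq: "apex m = apex n" "end1 m = end2 n" "leg1 m = leg2 n"
    using g m by auto
  obtain u c p w where star: "star_at T (apex n) u c p w"
    using star[OF g(1)] g(2) by (metis insertI1)
  obtain x where x: "x \<in> quarter_turns 1" "sgn (end1 n - apex n) = x * u"
     "tile_color n = (if x \<in> {1, -1} then Red else Green)"
    using compose_apex_star[OF n star] by blast
  obtain y where y: "y \<in> quarter_turns 1" "sgn (end1 m - apex n) = y * u"
     "tile_color m = (if y \<in> {1, -1} then Red else Green)"
    using compose_apex_star[OF m(1), unfolded eq(1), OF star] by blast
  have "end1 m - apex n = \<i> * (end1 n - apex n)"
    using nt eq by (simp add: triangle_tile_def)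
  then have "y = \<i> * x"
    using x y star by (auto simp: sgn_mult sgn_eq[of "\<i>"] star_at_def)
  \<comment> \<open>A quarter turn exchanges axis and perpendicular directions, hence the two
    colors.\<close>
  then have "tile_color m \<noteq> tile_color n"
    using x y by (auto simp: quarter_turns_def)
  then show "\<exists>m\<in>compose s T. apex m = apex n \<and> end1 m = end2 n \<and>
    leg1 m = leg2 n \<and> tile_color m \<noteq> tile_color n"
    using m eq by blast
next
  fix n assume n: "n \<in> compose s T"
  note nt = composeD(1)[OF n]
  let ?t = "left_part n"
  obtain x where x: "x \<in> T" "apex x = apex ?t" "end1 x = 2 * apex ?t - end1 ?t" "tile_color x = Red"
    using opposite[OF composeD(2)[OF n]] by auto
  then obtain m where m: "m \<in> compose s T" "left_part m = x"
    using compose_left by blast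
  note mt = composeD(1)[OF m(1)]
  obtain b c p where sq: "leg1 ?t = ray (apex ?t) (end1 ?t) (b, c)"
    "leg1 x = ray (apex ?t) (end1 x) (\<not> b, c)"
    "leg2 ?t = ray (apex ?t) (end2 ?t) (False, p)" "leg2 x = ray (apex ?t) (end2 x) (False, opp p)"
    using square[OF composeD(2)[OF n] x(1) _ x(2,3)] by auto
  have e2: "end2 m = end1 n"
    using x m by (auto simp: midpoint_complex field_simps)
  then have e1: "end1 m = end2 n"
    using x(2) m(2) by (auto simp: midpoint_complex field_simps)
  have mid: "midpoint (end1 m) (end2 m) = midpoint (end1 n) (end2 n)"
    by (simp add: e1 e2 midpoint_sym)
  have "half_at (end2 n) (hyp n) = ray (end2 n) (midpoint (end1 n) (end2 n)) (\<not> b, c)"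
    using sq(1) ray_commute by simp
  moreover have "joins (hyp n) (end2 n) (end1 n)" "joins (hyp m) (end2 m) (end1 m)"
    using nt mt by (auto simp: triangle_tile_def joins_def)
  ultimately have hn: "hyp n = ray (end2 n) (end1 n) (\<not> b, c)"
    using half_at_eq_rayD tile_distinct[OF nt] tile_midpoint_ne[OF nt] by metis
  have "half_at (end2 m) (hyp m) = ray (end2 m) (midpoint (end1 m) (end2 m)) (b, c)"
    using sq(2) m(2) ray_commute[of "midpoint (end1 n) (end2 n)"] mid by auto
  then have "hyp m = ray (end2 m) (end1 m) (b, c)"
    using half_at_eq_rayD tile_distinct[OF mt] tile_midpoint_ne[OF mt] \<open>joins (hyp m) (end2 m)
      (end1 m)\<close> by metis
  then have "hyp m = hyp n"
    using hn e1 e2 ray_commute by simp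
  \<comment> \<open>The two heights are the perpendicular arrows at the midpoint, which have
    different colors.\<close>
  moreover have "tile_color n = p" "tile_color m = opp p"
    using sq(3,4) m(2) by (auto simp: height_ray(2) dest: arg_cong[of _ _ arrow_color])
  ultimately show "\<exists>m\<in>compose s T. end1 m = end2 n \<and> end2 m = end1 n \<and>
    hyp m = hyp n \<and> tile_color m \<noteq> tile_color n"
    using m(1) e1 e2 by (intro bexI[of _ m]) auto
next
  fix n m assume n: "n \<in> compose s T" and m: "m \<in> compose s T" "tile_color n = Red" "apex m = apex n"
    "end1 m = 2 * apex n - end1 n"
  obtain u c p w where star: "star_at T (apex n) u c p w"
    using star[OF composeD(3)[OF n]] by fastforce
  have u: "u \<noteq> 0"
    using star by (auto simp: star_at_def)
  obtain x where x: "x \<in> quarter_turns 1" "sgn (end1 n - apex n) = x * u"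
     "tile_color n = (if x \<in> {1, -1} then Red else Green)"
     "leg1 n = ray (apex n) (end1 n) (pattern c p x)"
     "leg2 n = ray (apex n) (end2 n) (pattern c p (\<i> * x))"
    using compose_apex_star[OF n star] by blast
  obtain y where y: "y \<in> quarter_turns 1" "sgn (end1 m - apex n) = y * u"
     "leg1 m = ray (apex n) (end1 m) (pattern c p y)"
     "leg2 m = ray (apex n) (end2 m) (pattern c p (\<i> * y))"
    using compose_apex_star[OF m(1), unfolded m(3), OF star] by blast
  have "end1 m - apex n = - (end1 n - apex n)"
    using m by simp
  then have "y * u = - (x * u)"
    using x(2) y(2) sgn_minus by metis
  then have "y = - x"
    using u by (metis mult_cancel_right mult_minus_left)
  moreover have "x = 1 \<or> x = -1"
    using x(3) m(2) by (auto split: if_splits)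
  ultimately consider "x = 1" "y = -1" | "x = -1" "y = 1"
    by auto
  then show "\<exists>b c p. leg1 n = ray (apex n) (end1 n) (b, c) \<and>
    leg1 m = ray (apex n) (end1 m) (\<not> b, c) \<and>
             leg2 n = ray (apex n) (end2 n) (False, p) \<and> leg2 m = ray (apex n) (end2 m) (False, opp p)"
  proof cases
    case 1
    then show ?thesis
      using x(4,5) y(3,4) by (intro exI[of _ True] exI[of _ c] exI[of _ p]) simp
  next
    case 2
    moreover have "p = opp (opp p)"
      by (cases p) auto
    ultimately show ?thesis
      using x(4,5) y(3,4) by (intro exI[of _ False] exI[of _ c] exI[of _ "opp p"]) auto
  qed
next
  fix n v assume n: "n \<in> compose s T" "v \<in> {end1 n, end2 n}"
  have "\<exists>u c p w. star_at T v u c p w"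
    using star[OF composeD(2)[OF n(1)]] star[OF composeD(3)[OF n(1)]] n(2) by fastforce
  then show "\<exists>u c p w. star_at (compose s T) v u c p w"
    using compose_star_at by meson
qed

end

section \<open>Stars in supertiles\<close>

definition cut :: "tile set \<Rightarrow> tile set" where
  "cut S = (\<Union>t\<in>S. {left_part t, right_part t})"

lemma cut_iff: "x \<in> cut S \<longleftrightarrow> (\<exists>y\<in>S. x = left_part y \<or> x = right_part y)"
  by (auto simp: cut_def)

lemma cut_mono: "S \<subseteq> S' \<Longrightarrow> cut S \<subseteq> cut S'"
  by (auto simp: cut_def)

lemma parts_in_cut: "t \<in> S \<Longrightarrow> left_part t \<in> cut S" "t \<in> S \<Longrightarrow>
  right_part t \<in> cut S"
  by (auto simp: cut_def)

text \<open>Rescaling is postponed: the seed tile is enlarged by \<open>sqrt 2 ^ n\<close> and then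
  cut in place. Since the seed may lie anywhere, no translation has to be mentioned.\<close>

definition legal :: "real \<Rightarrow> tile set \<Rightarrow> bool" where
  "legal s F \<longleftrightarrow> (\<exists>n t. triangle_tile (sqrt 2 ^ n * s) t \<and>
    F \<subseteq> (cut ^^ n) {t})"

lemma legal_mono: "legal s F \<Longrightarrow> G \<subseteq> F \<Longrightarrow> legal s G"
  by (auto simp: legal_def)

lemma legal_cut:
  assumes "legal (sqrt 2 * s) F"
  shows "legal s (cut F)"
proof -
  obtain n t where "triangle_tile (sqrt 2 ^ n * (sqrt 2 * s)) t" "F \<subseteq> (cut ^^ n) {t}"
    using assms by (auto simp: legal_def)
  then have "triangle_tile (sqrt 2 ^ Suc n * s) t" "cut F \<subseteq> (cut ^^ Suc n) {t}"
    using cut_mono by (simp_all add: mult_ac)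
  then show ?thesis
    unfolding legal_def by blast
qed

lemma triangle_tile_cut:
  assumes "triangle_tile (sqrt 2 ^ n * s) t" "x \<in> (cut ^^ n) {t}"
  shows "triangle_tile s x"
  using assms
proof (induction n arbitrary: s x)
  case (Suc n)
  then obtain y where "y \<in> (cut ^^ n) {t}" "x = left_part y \<or> x = right_part y"
    by (auto simp: cut_iff)
  moreover have "triangle_tile (sqrt 2 ^ n * (sqrt 2 * s)) t"
    using Suc.prems(1) by (simp add: mult_ac)
  ultimately show ?case
    using Suc.IH triangle_tile_parts by metis
qed simp

text \<open>The common hypotenuse has midpoint \<open>v\<close> and direction \<open>h\<close>;
  \<open>m\<close> is on its left and \<open>n\<close> on its right, so \<open>p\<close> is the
  color to the left of the arrow.\<close>

definition hyp_pair :: "complex \<Rightarrow> complex \<Rightarrow> color \<Rightarrow> color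
  \<Rightarrow> tile \<Rightarrow> tile \<Rightarrow> bool" where
  "hyp_pair v h c p m n \<longleftrightarrow>
     apex m = v + \<i> * h \<and> end1 m = v - h \<and> end2 m = v + h \<and>
       hyp m = ray (v - h) (v + h) (True, c) \<and>
     tile_color m = p \<and>
     apex n = v - \<i> * h \<and> end1 n = v + h \<and> end2 n = v - h \<and>
       hyp n = ray (v - h) (v + h) (True, c) \<and>
     tile_color n = opp p"

text \<open>The common hypotenuse is the height of a tile of color \<open>c\<close>, decomposed twice.\<close>

lemma legal_hyp_pair_Red:
  assumes "h \<noteq> 0" "sqrt 2 * cmod h = s"
  shows "\<exists>m n. legal s {m, n} \<and> hyp_pair v h c Red m n"
proof -
  \<comment> \<open>The apex and the midpoint of the hypotenuse are placed at the ends
    \<open>v - h\<close> and \<open>v + h\<close> of the desired arrow, which thereby is the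
    height.\<close>
  define t where "t = \<lparr>apex = v - h, end1 = v + h - 2 * \<i> * h, end2 = v + h + 2 * \<i> * h,
    leg1 = ray (v - h) (v + h - 2 * \<i> * h) (True, Red), leg2 = ray (v - h) (v + h + 2 * \<i> * h)
      (True, Red),
    hyp = ray (v + h - 2 * \<i> * h) (v + h + 2 * \<i> * h) (True, Red), tile_color = c\<rparr>"
  have t: "apex t = v - h" "end1 t = v + h - 2 * \<i> * h" "end2 t = v + h + 2 * \<i> * h" "tile_color t = c"
    by (simp_all add: t_def)
  have d: "end1 t - apex t = 2 * (1 - \<i>) * h" "end2 t - apex t = 2 * (1 + \<i>) * h"
    unfolding t by (simp_all add: algebra_simps)
  have "cmod (2 * (1 - \<i>) * h) = 2 * s"
    unfolding norm_mult cmod_one_plus_i(2) assms(2)[symmetric] by simp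
  moreover have "2 * (1 - \<i>) * h \<noteq> 0"
    using assms by simp
  moreover have "2 * (1 + \<i>) * h = \<i> * (2 * (1 - \<i>) * h)"
    by (simp add: algebra_simps)
  moreover have "joins (leg1 t) (apex t) (end1 t)" "joins (leg2 t) (apex t) (end2 t)"
    "joins (hyp t) (end1 t) (end2 t)"
    by (simp_all add: t_def joins_def)
  ultimately have "triangle_tile (2 * s) t"
    unfolding triangle_tile_def d using d by auto
  then have "legal s (cut (cut {t}))"
    by (auto simp: legal_def numeral_2_eq_2 intro!: exI[of _ 2] exI[of _ t])
  then have "legal s {left_part (left_part t), right_part (right_part t)}"
    by (rule legal_mono) (auto simp: cut_def)
  moreover have "hyp_pair v h c Red (left_part (left_part t)) (right_part (right_part t))"
    by (simp add: hyp_pair_def t midpoint_complex height_ray(1) field_simps)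
  ultimately show ?thesis
    by blast
qed

text \<open>
  Halving the hypotenuse of a pair of the first kind gives an axis whose leaving half is, one
  decomposition later, a hypotenuse with the colors on its sides exchanged.
\<close>

lemma legal_hyp_pair_Green:
  assumes "h \<noteq> 0" "sqrt 2 * cmod h = s"
  shows "\<exists>m n. legal s {m, n} \<and> hyp_pair v h c Green m n"
proof -
  obtain m n where mn: "legal (2 * s) {m, n}" "hyp_pair (v - h) (2 * h) c Red m n"
    using legal_hyp_pair_Red[of "2 * h" "2 * s" "v - h" c] assms by (auto simp: norm_mult)
  have "legal s (cut (cut {m, n}))"
    by (intro legal_cut) (use mn in \<open>simp add: mult.assoc[symmetric]\<close>)
  then have "legal s {right_part (left_part m), left_part (right_part n)}"
    by (rule legal_mono) (auto simp: cut_def)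
  moreover have "half_at (v + h) (ray (v - 3 * h) (v + h) (True, c)) = ray (v - h) (v + h) (True, c)"
    using assms(1) half_at_ray[of "v + h" "v - 3 * h" "(False, c)"]
    by (simp add: ray_commute[of "v + h"] midpoint_complex)
  then have "hyp_pair v h c Green (right_part (left_part m)) (left_part (right_part n))"
    using mn(2) by (simp add: hyp_pair_def midpoint_complex field_simps)
  ultimately show ?thesis
    by blast
qed

lemma legal_hyp_pair:
  assumes "h \<noteq> 0" "sqrt 2 * cmod h = s"
  shows "\<exists>m n. legal s {m, n} \<and> hyp_pair v h c p m n"
  using legal_hyp_pair_Red[OF assms] legal_hyp_pair_Green[OF assms] by (cases p) auto

text \<open>Whereas \<open>star_at\<close> constrains the tiles that are present, this demands that
  all eight tiles of the star are present. They come in four pairs with a common leg, one for each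
  quarter turn of the leg vector \<open>e\<close>.\<close>

definition star_in :: "tile set \<Rightarrow> complex \<Rightarrow> complex \<Rightarrow> complex
  \<Rightarrow> color \<Rightarrow> color \<Rightarrow> color \<Rightarrow> bool" where
  "star_in S v e u c p k \<longleftrightarrow>
     (\<forall>x\<in>quarter_turns e.
       (\<exists>m\<in>S. end1 m = v \<and> apex m = v + x \<and> star_tile v u c p m \<and>
         tile_color m = k) \<and>
       (\<exists>m\<in>S. end2 m = v \<and> apex m = v + x \<and> star_tile v u c p m \<and>
         tile_color m = opp k))"

definition legal_star :: "real \<Rightarrow> complex \<Rightarrow> complex \<Rightarrow> complex
  \<Rightarrow> color \<Rightarrow> color \<Rightarrow> color \<Rightarrow> bool" where
  "legal_star s v e u c p k \<longleftrightarrow>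
     (\<exists>S. legal s S \<and> (\<forall>m\<in>S. triangle_tile s m) \<and> star_in S v e u c p k)"

lemma quarter_turns_cong: "w \<in> quarter_turns w' \<Longrightarrow> quarter_turns w = quarter_turns w'"
  using quarter_turns_sym quarter_turns_trans by blast

lemma star_in_cong: "e \<in> quarter_turns e' \<Longrightarrow>
  star_in S v e u c p k \<longleftrightarrow> star_in S v e' u c p k"
  by (simp add: star_in_def quarter_turns_cong)

lemma star_tile_left:
  assumes "triangle_tile s m" "end2 m = v" "star_tile v u c p m"
  shows "star_tile v u c p (left_part m)"
proof -
  have ne: "apex m \<noteq> v" "v \<noteq> end1 m"
    using tile_distinct[OF assms(1)] assms(2) by auto
  have "midpoint (end1 m) v - v = (end1 m - v) / 2"
    by (simp add: midpoint_complex field_simps)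
  then have "sgn (midpoint (end1 m) v - v) = sgn (end1 m - v)"
    by (simp only:) (simp add: sgn_divide)
  then show ?thesis
    using star_tileD(3,4)[OF assms(3)] assms(2) ne
    by (simp add: star_tile_def Let_def half_at_ray[OF ne(2)] midpoint_sym)
qed

lemma star_tile_right:
  assumes "triangle_tile s m" "end1 m = v" "star_tile v u c p m"
  shows "star_tile v u c p (right_part m)"
proof -
  have ne: "apex m \<noteq> v" "v \<noteq> end2 m"
    using tile_distinct[OF assms(1)] assms(2) by auto
  have "midpoint v (end2 m) - v = (end2 m - v) / 2"
    by (simp add: midpoint_complex field_simps)
  then have "sgn (midpoint v (end2 m) - v) = sgn (end2 m - v)"
    by (simp only:) (simp add: sgn_divide)
  then show ?thesis
    using star_tileD(1,2)[OF assms(3)] assms(2) ne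
    by (simp add: star_tile_def Let_def half_at_ray[OF ne(2)])
qed

text \<open>The tiles with \<open>end1\<close> at \<open>v\<close> are now left parts of tiles with
  \<open>end2\<close> at \<open>v\<close>, and those with \<open>end2\<close> at \<open>v\<close>
  are right parts. So the new colors do not depend on \<open>k\<close>. The new legs are halves of
  hypotenuses: a turn by 45 degrees, with length divided by \<open>sqrt 2\<close>, is the factor
  \<open>(1 - i) / 2\<close>.\<close>

lemma legal_star_cut:
  assumes "legal_star (sqrt 2 * s) v e u c p k"
  shows "legal_star s v ((1 - \<i>) / 2 * e) u c p Red"
proof -
  obtain S where S: "legal (sqrt 2 * s) S" "\<And>m. m \<in> S \<Longrightarrow>
    triangle_tile (sqrt 2 * s) m" "star_in S v e u c p k"
    using assms by (auto simp: legal_star_def)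
  have "star_in (cut S) v ((1 - \<i>) / 2 * e) u c p Red"
    unfolding star_in_def
  proof (intro ballI conjI)
    fix x assume x: "x \<in> quarter_turns ((1 - \<i>) / 2 * e)"
    have "(1 - \<i>) * x \<in> quarter_turns (- \<i> * e)"
      using quarter_turns_mult[OF x, of "1 - \<i>"] by (simp add: field_simps)
    then have "(1 - \<i>) * x \<in> quarter_turns e"
      by (rule quarter_turns_trans) (simp add: quarter_turns_def)
    then obtain m where m: "m \<in> S" "end2 m = v" "apex m = v + (1 - \<i>) * x" "star_tile v u c p m"
      using S(3) unfolding star_in_def by blast
    have "midpoint (end1 m) (end2 m) = v + x"
      using tile_midpoint_end2[OF S(2)[OF m(1)]] m(2,3) by (simp add: field_simps)
    then show "\<exists>m\<in>cut S. end1 m = v \<and> apex m = v + x \<and> star_tile v u c p m \<and>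
      tile_color m = Red"
      using m star_tile_left[OF S(2)[OF m(1)] m(2,4)]
      by (intro bexI[of _ "left_part m"]) (auto simp: parts_in_cut)
    have "(1 + \<i>) * x \<in> quarter_turns e"
      using quarter_turns_mult[OF x, of "1 + \<i>"] by (simp add: field_simps)
    then obtain m where m: "m \<in> S" "end1 m = v" "apex m = v + (1 + \<i>) * x" "star_tile v u c p m"
      using S(3) unfolding star_in_def by blast
    have "midpoint (end1 m) (end2 m) = v + x"
      using tile_midpoint_end1[OF S(2)[OF m(1)]] m(2,3) by (simp add: field_simps)
    then show "\<exists>m\<in>cut S. end2 m = v \<and> apex m = v + x \<and> star_tile v u c p m \<and>
      tile_color m = opp Red"
      using m star_tile_right[OF S(2)[OF m(1)] m(2,4)]
      by (intro bexI[of _ "right_part m"]) (auto simp: parts_in_cut)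
  qed
  moreover have "\<forall>m\<in>cut S. triangle_tile s m"
    using S(2) triangle_tile_parts by (auto simp: cut_def)
  ultimately show ?thesis
    using legal_cut[OF S(1)] by (auto simp: legal_star_def)
qed

text \<open>Two decompositions of a pair of tiles with common hypotenuse centered at \<open>v\<close>.\<close>

lemma legal_star_Green:
  assumes "s > 0" "cmod u = 1"
  shows "legal_star s v (s * (eighth * u)) u c p Green"
proof -
  \<comment> \<open>This length gives the pair legs of length \<open>2 * s\<close>, two cuts above
    \<open>s\<close>.\<close>
  define h where "h = complex_of_real (sqrt 2 * s) * u"
  have h: "h \<noteq> 0" "sqrt 2 * cmod h = 2 * s"
    using assms by (auto simp: h_def norm_mult)
  obtain m n where mn: "legal (2 * s) {m, n}" "hyp_pair v h c p m n"
    using legal_hyp_pair[OF h] by blast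
  define S where "S = cut {m, n}"
  have S: "legal (sqrt 2 * s) S"
    unfolding S_def by (intro legal_cut) (use mn in \<open>simp add: mult.assoc[symmetric]\<close>)
  obtain N t where N: "triangle_tile (sqrt 2 ^ N * (sqrt 2 * s)) t" "S \<subseteq> (cut ^^ N) {t}"
    using S by (auto simp: legal_def)
  then have St: "triangle_tile (sqrt 2 * s) x" if "x \<in> S" for x
    using triangle_tile_cut that by blast
  have half: "half_at (v + h) (ray (v - h) (v + h) (True, c)) = ray v (v + h) (True, c)"
    "half_at (v - h) (ray (v - h) (v + h) (True, c)) = ray v (v - h) (False, c)"
    using h half_at_ray[of "v + h" "v - h" "(False, c)"] half_at_ray[of "v - h" "v + h" "(True, c)"]
    by (simp_all add: ray_commute[of "v + h"] ray_commute[of "v - h" v] midpoint_complex)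
  \<comment> \<open>The four parts of the pair form a square around \<open>v\<close>. The halves of
    the hypotenuse are the axis, and the heights of \<open>m\<close> and \<open>n\<close> enter
    \<open>v\<close> with different colors as the perpendicular arrows.\<close>
  have sq: "\<exists>t\<in>S. apex t = v \<and> end1 t = v + x * h \<and> end2 t = v + \<i> * x * h \<and>
      tile_color t = (if x \<in> {1, -1} then Red else Green) \<and>
      leg1 t = ray v (v + x * h) (pattern c p x) \<and>
        leg2 t = ray v (v + \<i> * x * h) (pattern c p (\<i> * x))"
    if x: "x \<in> quarter_turns 1" for x
  proof -
    note [simp] = S_def hyp_pair_def half height_ray(2) midpoint_complex
    consider "x = 1" | "x = \<i>" | "x = -1" | "x = - \<i>"
      using x by (auto simp: quarter_turns_def)
    then show ?thesis
    proof cases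
      case 1
      then show ?thesis
        using mn(2) by (intro bexI[of _ "left_part m"]) (simp_all add: parts_in_cut)
    next
      case 2
      then show ?thesis
        using mn(2) by (intro bexI[of _ "right_part m"]) (simp_all add: parts_in_cut)
    next
      case 3
      then show ?thesis
        using mn(2) by (intro bexI[of _ "left_part n"]) (simp_all add: parts_in_cut)
    next
      case 4
      then show ?thesis
        using mn(2) by (intro bexI[of _ "right_part n"]) (simp_all add: parts_in_cut)
    qed
  qed
  have "star_in (cut S) v (s * (eighth * u)) u c p Green"
    unfolding star_in_def
  proof
    fix y assume y: "y \<in> quarter_turns (s * (eighth * u))"
    define x where "x = y / (s * (eighth * u))"
    have nz: "u \<noteq> 0" "complex_of_real s \<noteq> 0"
      using assms by auto
    have yx: "y = s * (eighth * u) * x"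
      using nz by (simp add: x_def)
    have x: "x \<in> quarter_turns 1"
    proof -
      have "inverse a * a = 1" "inverse a * y = x" if "a = s * (eighth * u)" for a
        using nz that by (simp_all add: x_def field_simps)
      then show ?thesis
        using quarter_turns_mult[OF y, of "inverse (s * (eighth * u))"] by metis
    qed
    obtain t where t: "t \<in> S" "apex t = v" "end1 t = v + x * h" "end2 t = v + \<i> * x * h"
      "tile_color t = (if x \<in> {1, -1} then Red else Green)"
      "leg1 t = ray v (v + x * h) (pattern c p x)" "leg2 t = ray v (v + \<i> * x * h) (pattern c p (\<i> * x))"
      using sq[OF x] by blast
    have "(1 + \<i>) * h = 2 * (s * (eighth * u))"
      unfolding h_def eighth_eq[symmetric] using of_real_mult[of "sqrt 2" "sqrt 2", symmetric,
        where ?'a = complex]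
      by simp
    moreover have "(1 + \<i>) / 2 * (x * h) = x * ((1 + \<i>) * h) / 2"
      by simp
    ultimately have "(1 + \<i>) / 2 * (x * h) = y"
      unfolding yx by (simp only:) simp
    then have "midpoint (end1 t) (end2 t) = v + y"
      unfolding tile_midpoint[OF St[OF t(1)]] unfolding t(2,3) by simp
    moreover have "sgn y / u = eighth * x" "sgn (x * h) / u = x" "sgn (\<i> * x * h) / u = \<i> * x"
    proof -
      have "sgn u = u" "sgn eighth = eighth" "sgn x = x" "sgn (complex_of_real s) = 1" "sgn h = u"
        using assms x by (auto simp: sgn_eq quarter_turns_def h_def norm_mult)
      then show "sgn y / u = eighth * x" "sgn (x * h) / u = x" "sgn (\<i> * x * h) / u = \<i> * x"
        using nz by (auto simp: yx sgn_mult sgn_eq[of "\<i>"])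
    qed
    \<comment> \<open>The second cut draws the heights of the four tiles. They leave
      \<open>v\<close> along the diagonals, and the alternating colors of the tiles are those that
      C8 asks for.\<close>
    moreover have "pattern c p (eighth * x) = (True, tile_color t)"
      using x t(5) by (auto simp: quarter_turns_def mult.commute[of eighth])
    moreover have "v \<noteq> v + y" "x * h \<noteq> 0" "\<i> * x * h \<noteq> 0"
      using nz h x by (auto simp: yx quarter_turns_def)
    ultimately show "(\<exists>m\<in>cut S. end1 m = v \<and> apex m = v + y \<and>
      star_tile v u c p m \<and> tile_color m = Green) \<and>
      (\<exists>m\<in>cut S. end2 m = v \<and> apex m = v + y \<and> star_tile v u c p m \<and>
        tile_color m = opp Green)"
      using t parts_in_cut[OF t(1)]
      by (intro conjI bexI[of _ "right_part t"] bexI[of _ "left_part t"])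
         (auto simp: star_tile_def Let_def height_ray(1))
  qed
  moreover have "\<forall>m\<in>cut S. triangle_tile s m"
    using St triangle_tile_parts by (auto simp: cut_def)
  ultimately show ?thesis
    using legal_cut[OF S] by (auto simp: legal_star_def)
qed

section \<open>Parents of adjacent tiles\<close>

definition adjacent :: "tile \<Rightarrow> tile \<Rightarrow> bool" where
  "adjacent t u \<longleftrightarrow>
     apex u = apex t \<and> (end1 u = end2 t \<or> end2 u = end1 t) \<or> end1 u = end2 t \<and>
       end2 u = end1 t"

lemma end1_eq: "triangle_tile s t \<Longrightarrow> end1 t = apex t - \<i> * (end2 t - apex t)"
  unfolding triangle_tile_def by (simp add: mult.assoc[symmetric])

lemma cmod_leg:
  assumes "triangle_tile s t"
  shows "cmod (apex t - end1 t) = s" "cmod (apex t - end2 t) = s" "s > 0"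
proof -
  show 1: "cmod (apex t - end1 t) = s"
    using assms norm_minus_commute by (metis triangle_tile_def)
  have "apex t - end2 t = \<i> * (apex t - end1 t)"
    using end2_eq[OF assms] by (simp add: algebra_simps)
  then show "cmod (apex t - end2 t) = s"
    using 1 by (simp add: norm_mult)
  show "s > 0"
    using 1 tile_distinct[OF assms] by auto
qed

context coherent_tiles
begin

lemma unique_end2:
  assumes "t \<in> T" "u \<in> T" "apex t = apex u" "end2 t = end2 u"
  shows "t = u"
  using assms end1_eq[OF tile[OF assms(1)]] end1_eq[OF tile[OF assms(2)]] unique by simp

lemma unique_hyp:
  assumes "t \<in> T" "u \<in> T" "end1 t = end1 u" "end2 t = end2 u"
  shows "t = u"
  by (rule unique[OF assms(1,2) _ assms(3)])
    (simp only: apex_eq[OF tile[OF assms(1)]] apex_eq[OF tile[OF assms(2)]] assms(3,4))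

lemma adjacent_color:
  assumes "t \<in> T" "u \<in> T" "adjacent t u"
  shows "tile_color u \<noteq> tile_color t"
proof -
  consider "apex u = apex t" "end1 u = end2 t" | "apex u = apex t" "end2 u = end1 t" | "end1 u = end2 t"
    "end2 u = end1 t"
    using assms(3) by (auto simp: adjacent_def)
  then show ?thesis
  proof cases
    case 1
    then show ?thesis
      using leg_neighbour[OF assms(1)] unique[OF assms(2)] by metis
  next
    case 2
    then show ?thesis
      using leg_neighbour'[OF assms(1)] unique_end2[OF assms(2)] by metis
  next
    case 3
    then show ?thesis
      using hyp_neighbour[OF assms(1)] unique_hyp[OF assms(2)] by metis
  qed
qed

section \<open>Directions and colors around an acute vertex\<close>

lemma leg_direction:
  assumes "star_at T v u c p w" "t \<in> T" "v \<in> {end1 t, end2 t}"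
  shows "apex t - v \<in> quarter_turns (complex_of_real s * w)"
proof -
  have "sgn (apex t - v) \<in> quarter_turns w"
    using assms unfolding star_at_def by blast
  moreover have "complex_of_real s * sgn (apex t - v) = apex t - v"
    using cmod_leg[OF tile[OF assms(2)]] assms(3) by (auto simp: sgn_eq)
  ultimately show ?thesis
    using quarter_turns_mult by metis
qed

lemma legs_aligned:
  assumes "y \<in> T" "t \<in> T" "v \<in> {end1 y, end2 y}" "v \<in> {end1 t, end2 t}"
  shows "apex t - v \<in> quarter_turns (apex y - v)"
proof -
  obtain u c p w where "star_at T v u c p w"
    using star[OF assms(1,3)] by blast
  then show ?thesis
    using leg_direction assms quarter_turns_sym quarter_turns_trans by metis
qed

text \<open>Tiles with \<open>end1\<close> at the same vertex are quarter turns of each other, and a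
  quarter turn crosses two sides.\<close>

lemma star_color_end1:
  assumes "y \<in> T" "t \<in> T" "end1 t = end1 y"
  shows "tile_color t = tile_color y"
proof -
  obtain x where "x \<in> T" "end1 x = end1 y" "apex x - end1 y = apex t - end1 y" "tile_color x = tile_color y"
    using rotate_end1_quarter_turns[OF assms(1) legs_aligned[OF assms(1,2)]] assms(3) by auto
  then show ?thesis
    using unique[of x t] assms by simp
qed

lemma star_color_end2:
  assumes "y \<in> T" "t \<in> T" "end2 t = end1 y"
  shows "tile_color t \<noteq> tile_color y"
proof -
  obtain x where "x \<in> T" "end1 x = end2 t" "tile_color x \<noteq> tile_color t"
    using leg_neighbour[OF assms(2)] by blast
  then show ?thesis
    using star_color_end1[of y x] assms by simp
qed

lemma star_end1_tile:
  assumes "t \<in> T" "v \<in> {end1 t, end2 t}"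
  shows "\<exists>y\<in>T. end1 y = v"
  using assms leg_neighbour[OF assms(1)] by auto

text \<open>By \<open>green_star\<close> a green star has its legs on the diagonals, so three cases
  remain. \<open>G\<close> arises around the midpoint of a hypotenuse, \<open>B\<close> is a cut of
  \<open>G\<close>, and \<open>A\<close> is a cut of \<open>B\<close>; each cut turns the legs by 45
  degrees and leaves a red star.\<close>

lemma legal_star_at:
  assumes y: "y \<in> T" "end1 y = v" and star: "star_at T v u c p w"
  shows "legal_star s v (apex y - v) u c p (tile_color y)"
proof -
  have s: "s > 0"
    using cmod_leg(3)[OF tile[OF y(1)]] .
  have u: "cmod u = 1" "w = u \<or> w = eighth * u"
    using star by (auto simp: star_at_def)
  have dir: "apex y - v \<in> quarter_turns (s * w)"
    using leg_direction[OF star y(1)] y(2) by simp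
  have G: "legal_star r v (r * (eighth * u)) u c p Green" if "r > 0" for r
    using legal_star_Green[OF that u(1)] .
  have B: "legal_star r v (r * u) u c p Red" if "r > 0" for r
  proof -
    have "(1 - \<i>) / 2 * (complex_of_real (sqrt 2 * r) * (eighth * u)) = (1 - \<i>) / 2 *
      ((complex_of_real (sqrt 2) * eighth) * (r * u))"
      by simp
    also have "\<dots> = r * u"
      unfolding eighth_eq by (simp add: field_simps)
    finally have eq: "(1 - \<i>) / 2 * (complex_of_real (sqrt 2 * r) * (eighth * u)) = r * u" .
    have "legal_star r v ((1 - \<i>) / 2 * (complex_of_real (sqrt 2 * r) * (eighth * u))) u c p Red"
      by (rule legal_star_cut[OF G]) (use that in simp)
    then show ?thesis
      unfolding eq .
  qed
  have A: "legal_star r v (- \<i> * (r * (eighth * u))) u c p Red" if "r > 0" for r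
  proof -
    have "(1 - \<i>) / 2 * (complex_of_real (sqrt 2 * r) * u) = - \<i> * (r * (eighth * u))"
    proof -
      have "complex_of_real (sqrt 2) * (1 - \<i>) / 2 = - \<i> * eighth"
        by (simp add: eighth_def complex_eq_iff field_simps)
      then have "(complex_of_real (sqrt 2) * (1 - \<i>) / 2) * (r * u) = - \<i> * eighth * (r * u)"
        by simp
      then show ?thesis
        by (simp add: mult_ac)
    qed
    then show ?thesis
      using legal_star_cut[OF B[of "sqrt 2 * r"]] that by simp
  qed
  have cong: "legal_star s v e u c p k \<Longrightarrow> e \<in> quarter_turns e' \<Longrightarrow>
    legal_star s v e' u c p k" for e e' k
    unfolding legal_star_def using star_in_cong by metis
  show ?thesis
  proof (cases "tile_color y")
    case Green
    then have "w = eighth * u"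
      using green_star[OF y(1)] star y(2) by simp
    then show ?thesis
      using cong[OF G[OF s]] dir quarter_turns_sym Green by simp
  next
    case Red
    from u(2) show ?thesis
    proof
      assume "w = u"
      then show ?thesis
        using cong[OF B[OF s]] dir quarter_turns_sym Red by simp
    next
      assume w: "w = eighth * u"
      have "- \<i> * (s * (eighth * u)) \<in> quarter_turns (apex y - v)"
        using quarter_turns_sym[OF dir] quarter_turns_i w by simp
      then show ?thesis
        using cong[OF A[OF s]] Red by simp
    qed
  qed
qed

text \<open>Agreement is claimed for vertices, color and the two sides at \<open>v\<close> only,
  since the star does not determine the side opposite \<open>v\<close>. This is what the parts at
  \<open>v\<close> depend on after one more cut.\<close>

lemma legal_matching_star:
  assumes t: "t \<in> T" "v \<in> {end1 t, end2 t}"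
  shows "\<exists>S. legal s S \<and> (\<forall>m\<in>T.
    (end1 m = v \<longrightarrow> (\<exists>k\<in>S. apex k = apex m \<and> end1 k = end1 m \<and>
      end2 k = end2 m \<and> tile_color k = tile_color m \<and>
       leg1 k = leg1 m \<and> hyp k = hyp m)) \<and>
    (end2 m = v \<longrightarrow> (\<exists>k\<in>S. apex k = apex m \<and> end1 k = end1 m \<and>
      end2 k = end2 m \<and> tile_color k = tile_color m \<and>
       leg2 k = leg2 m \<and> hyp k = hyp m)))"
proof -
  obtain y where y: "y \<in> T" "end1 y = v"
    using star_end1_tile[OF t] by blast
  obtain u c p w where sa: "star_at T v u c p w"
    using star[OF t] by blast
  obtain S where S: "legal s S" "\<And>m. m \<in> S \<Longrightarrow> triangle_tile s m"
    "star_in S v (apex y - v) u c p (tile_color y)"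
    using legal_star_at[OF y sa] by (auto simp: legal_star_def)
  have tiles: "star_tile v u c p m" if "m \<in> T" "v \<in> {end1 m, end2 m}" for m
    using sa that unfolding star_at_def by blast
  have 1: "\<exists>k\<in>S. apex k = apex m \<and> end1 k = end1 m \<and> end2 k = end2 m \<and>
    tile_color k = tile_color m \<and>
       leg1 k = leg1 m \<and> hyp k = hyp m" if m: "m \<in> T" "end1 m = v" for m
  proof -
    have "apex m - v \<in> quarter_turns (apex y - v)"
      using legs_aligned[OF y(1) m(1)] y m by simp
    then obtain k where k: "k \<in> S" "end1 k = v" "apex k = v + (apex m - v)" "star_tile v u c p k"
      "tile_color k = tile_color y"
      using S(3) unfolding star_in_def by blast
    have e2: "end2 k = end2 m"
      using end2_eq[OF S(2)[OF k(1)]] end2_eq[OF tile[OF m(1)]] k m by simp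
    have "star_tile v u c p m"
      using tiles m by simp
    then show ?thesis
      using k m e2 star_color_end1[OF y(1) m(1)] y(2) star_tileD(1,2)[of v u c p k] star_tileD(1,2)[of
        v u c p m]
      by (intro bexI[of _ k]) auto
  qed
  have 2: "\<exists>k\<in>S. apex k = apex m \<and> end1 k = end1 m \<and> end2 k = end2 m \<and>
    tile_color k = tile_color m \<and>
       leg2 k = leg2 m \<and> hyp k = hyp m" if m: "m \<in> T" "end2 m = v" for m
  proof -
    have "apex m - v \<in> quarter_turns (apex y - v)"
      using legs_aligned[OF y(1) m(1)] y m by simp
    then obtain k where k: "k \<in> S" "end2 k = v" "apex k = v + (apex m - v)" "star_tile v u c p k"
      "tile_color k = opp (tile_color y)"
      using S(3) unfolding star_in_def by blast
    have e1: "end1 k = end1 m"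
      using end1_eq[OF S(2)[OF k(1)]] end1_eq[OF tile[OF m(1)]] k m by simp
    have "star_tile v u c p m" "tile_color m = opp (tile_color y)"
      using tiles m star_color_end2[OF y(1) m(1)] y(2) color_neq_iff by (simp, metis)
    then show ?thesis
      using k m e1 star_tileD(3,4)[of v u c p k] star_tileD(3,4)[of v u c p m]
      by (intro bexI[of _ k]) auto
  qed
  show ?thesis
    using S(1) 1 2 by (intro exI[of _ S]) simp
qed

text \<open>Red tiles with \<open>end1\<close> at \<open>v\<close> are left parts, and the green
  tiles with \<open>end2\<close> at \<open>v\<close> are right parts. Both get \<open>v\<close> from
  an acute vertex of the parent.\<close>

lemma red_star_parents:
  assumes y: "y \<in> T" "end1 y = v" "tile_color y = Red" and t: "t \<in> T" "v \<in> {end1 t, end2 t}"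
  shows "(\<exists>m\<in>compose s T. end2 m = v \<and> t = left_part m) \<or>
    (\<exists>m\<in>compose s T. end1 m = v \<and> t = right_part m)"
proof (cases "end1 t = v")
  case True
  then have "tile_color t = Red"
    using star_color_end1[OF y(1) t(1)] y by simp
  then obtain m where "m \<in> compose s T" "left_part m = t"
    using compose_left t by blast
  then show ?thesis
    using True by auto
next
  case False
  then have e: "end2 t = v"
    using t by simp
  then have "tile_color t \<noteq> Red"
    using star_color_end2[OF y(1) t(1)] y by simp
  then have "tile_color t = Green"
    by (cases "tile_color t") auto
  then obtain m where "m \<in> compose s T" "right_part m = t"
    using compose_right t by blast
  then show ?thesis
    using e by auto
qed

text \<open>The colors are exchanged compared with a red star: right parts have \<open>end1\<close>,
  and left parts \<open>end2\<close>, at the apex of the parent.\<close>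

lemma green_star_parents:
  assumes y: "y \<in> T" "end1 y = v" "tile_color y = Green" and t: "t \<in> T" "v \<in> {end1 t, end2 t}"
  shows "\<exists>m\<in>compose s T. apex m = v \<and> (t = left_part m \<or> t = right_part m)"
proof (cases "end1 t = v")
  case True
  then have "tile_color t = Green"
    using star_color_end1[OF y(1) t(1)] y by simp
  then obtain m where "m \<in> compose s T" "right_part m = t"
    using compose_right t by blast
  then show ?thesis
    using True by auto
next
  case False
  then have e: "end2 t = v"
    using t by simp
  then have "tile_color t \<noteq> Green"
    using star_color_end2[OF y(1) t(1)] y by simp
  then have "tile_color t = Red"
    by (cases "tile_color t") auto
  then obtain m where "m \<in> compose s T" "left_part m = t"
    using compose_left t by blast
  then show ?thesis
    using e by auto
qed

text \<open>The star of the parents is matched up to the sides opposite \<open>v\<close>. A cut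
  removes the difference, because the part of a parent at its acute vertex \<open>v\<close> is built
  from the sides meeting at \<open>v\<close> and the color.\<close>

lemma red_star_legal:
  assumes y: "y \<in> T" "end1 y = v" "tile_color y = Red"
    and F: "F \<subseteq> T" "\<And>t. t \<in> F \<Longrightarrow> v \<in> {end1 t, end2 t}"
  shows "legal s F"
proof -
  interpret C: coherent_tiles "sqrt 2 * s" "compose s T"
    by (rule compose_coherent)
  obtain n where n: "n \<in> compose s T" "left_part n = y"
    using compose_left y by blast
  then have "v \<in> {end1 n, end2 n}"
    using y by auto
  from C.legal_matching_star[OF n(1) this] obtain S where S: "legal (sqrt 2 * s) S"
    "\<And>m. m \<in> compose s T \<Longrightarrow> end1 m = v \<Longrightarrow>
      \<exists>k\<in>S. apex k = apex m \<and> end1 k = end1 m \<and> end2 k = end2 m \<and>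
       tile_color k = tile_color m \<and> leg1 k = leg1 m \<and> hyp k = hyp m"
    "\<And>m. m \<in> compose s T \<Longrightarrow> end2 m = v \<Longrightarrow>
      \<exists>k\<in>S. apex k = apex m \<and> end1 k = end1 m \<and> end2 k = end2 m \<and>
       tile_color k = tile_color m \<and> leg2 k = leg2 m \<and> hyp k = hyp m"
    by blast
  have "t \<in> cut S" if t: "t \<in> F" for t
  proof -
    have "t \<in> T"
      using t F by blast
    from red_star_parents[OF y this F(2)[OF t]] show ?thesis
    proof
      assume "\<exists>m\<in>compose s T. end2 m = v \<and> t = left_part m"
      then obtain m where m: "m \<in> compose s T" "end2 m = v" "t = left_part m"
        by blast
      then obtain k where k: "k \<in> S" "apex k = apex m" "end1 k = end1 m" "end2 k = end2 m"
         "tile_color k = tile_color m" "leg2 k = leg2 m" "hyp k = hyp m"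
        using S(3) by blast
      then have "left_part k = t"
        unfolding m(3) left_part_def height_def by simp
      then show ?thesis
        using parts_in_cut(1)[OF k(1)] by simp
    next
      assume "\<exists>m\<in>compose s T. end1 m = v \<and> t = right_part m"
      then obtain m where m: "m \<in> compose s T" "end1 m = v" "t = right_part m"
        by blast
      then obtain k where k: "k \<in> S" "apex k = apex m" "end1 k = end1 m" "end2 k = end2 m"
         "tile_color k = tile_color m" "leg1 k = leg1 m" "hyp k = hyp m"
        using S(2) by blast
      then have "right_part k = t"
        unfolding m(3) right_part_def height_def by simp
      then show ?thesis
        using parts_in_cut(2)[OF k(1)] by simp
    qed
  qed
  then show ?thesis
    using legal_mono[OF legal_cut[OF S(1)]] by blast
qed

text \<open>One of the two tiles is red, and its \<open>end1\<close> is a common vertex whose star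
  is red.\<close>

lemma hyp_neighbours_legal:
  assumes "n \<in> T" "m \<in> T" "end1 m = end2 n" "end2 m = end1 n"
  shows "legal s {n, m}"
proof -
  have "tile_color m \<noteq> tile_color n"
    using adjacent_color[OF assms(1,2)] assms(3,4) by (simp add: adjacent_def)
  then have "tile_color n = Red \<or> tile_color m = Red"
    by (cases "tile_color n"; cases "tile_color m") auto
  then show ?thesis
  proof
    assume "tile_color n = Red"
    then show ?thesis
      using assms by (intro red_star_legal[of n]) auto
  next
    assume "tile_color m = Red"
    then show ?thesis
      using assms by (intro red_star_legal[of m]) auto
  qed
qed

text \<open>The parts of \<open>N\<close> and \<open>N'\<close> occupy all four quarter turns about
  the midpoint of the common hypotenuse, so \<open>unique\<close> identifies \<open>t\<close> with
  one of them.\<close>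

lemma square_in_hyp_pair:
  assumes "N \<in> compose s T" "N' \<in> compose s T" "end1 N' = end2 N" "end2 N' = end1 N"
    "n \<in> {left_part N, right_part N}" "t \<in> T" "apex t = apex n"
      "end1 t - apex n \<in> quarter_turns (end1 n - apex n)"
  shows "t \<in> cut {N, N'}"
proof -
  note Nt = composeD(1)[OF assms(1)]
  define v where "v = midpoint (end1 N) (end2 N)"
  have v': "v = midpoint (end1 N') (end2 N')"
    using assms(3,4) by (simp add: v_def midpoint_sym)
  have d: "end2 N - v = \<i> * (apex N - v) * - 1" "end1 N - v = \<i> * (apex N - v)"
    using tile_midpoint_end1[OF Nt] tile_midpoint_end2[OF Nt] unfolding v_def midpoint_complex
    by (simp_all add: end2_eq[OF Nt] field_simps)
  have "apex N' = ((1 - \<i>) * end2 N + (1 + \<i>) * end1 N) / 2"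
    using apex_eq[OF composeD(1)[OF assms(2)]] unfolding assms(3,4) .
  then have d': "apex N' - v = - (apex N - v)"
    by (simp only:) (unfold apex_eq[OF Nt] v_def midpoint_complex, simp add: field_simps)
  have n: "apex n = v" "end1 n - v \<in> {end2 N - v, apex N - v}"
    using assms(5) by (auto simp: v_def)
  have "end1 n - v \<in> quarter_turns (apex N - v)"
    using n(2) d by (auto simp: quarter_turns_def)
  then have q: "end1 t - v \<in> quarter_turns (apex N - v)"
    using assms(8) quarter_turns_trans unfolding n(1) by blast
  note parts = composeD(2,3)[OF assms(1)] composeD(2,3)[OF assms(2)]
  have "end1 t - v \<in> {end2 N - v, apex N - v, end2 N' - v, apex N' - v}"
    using q unfolding d d' assms(4) by (auto simp: quarter_turns_def)
  then have "end1 t \<in> {end2 N, apex N, end2 N', apex N'}"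
    by auto
  moreover have "apex t = v"
    using assms(7) n by simp
  ultimately have "t = left_part N \<or> t = right_part N \<or> t = left_part N' \<or> t = right_part N'"
    using unique[OF assms(6) parts(1)] unique[OF assms(6) parts(2)] unique[OF assms(6) parts(3)]
      unique[OF assms(6) parts(4)] v'
    by (auto simp: v_def)
  then show ?thesis
    by (auto simp: cut_def)
qed

text \<open>The legs at a right angle of composed tiles lie on the axis and the perpendiculars of
  the old star there and have equal length.\<close>

lemma compose_apex_aligned:
  assumes "n \<in> compose s T" "m \<in> compose s T" "apex m = apex n"
  shows "end1 m - apex n \<in> quarter_turns (end1 n - apex n)"
proof -
  obtain u c p w where star: "star_at T (apex n) u c p w"
    using star[OF composeD(3)[OF assms(1)], of "apex n"] by auto
  have *: "end1 k - apex n \<in> quarter_turns (sqrt 2 * s * u)" if k: "k \<in> compose s T"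
    "apex k = apex n" for k
  proof -
    obtain x where "x \<in> quarter_turns 1" "sgn (end1 k - apex n) = x * u"
      using compose_apex_star[OF k(1), unfolded k(2), OF star] by blast
    moreover have "cmod (end1 k - apex n) = sqrt 2 * s"
      using composeD(1)[OF k(1)] k(2) by (simp add: triangle_tile_def)
    then have "end1 k - apex n = complex_of_real (sqrt 2 * s) * sgn (end1 k - apex n)"
      by (metis sgn_eq mult.commute nonzero_eq_divide_eq of_real_eq_0_iff norm_eq_zero mult_zero_left)
    ultimately show ?thesis
      using quarter_turns_mult[of x 1 "sqrt 2 * s * u"] by (simp add: mult_ac)
  qed
  show ?thesis
    using *[OF assms(2,3)] *[OF assms(1)] quarter_turns_sym quarter_turns_trans by blast
qed

text \<open>Adjacent tiles have different colors, so one is a left and the other a right part. They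
  meet in the height of one parent, in half of a hypotenuse common to both parents, or in a common
  leg of the parents.\<close>

lemma adjacent_parents:
  assumes y: "y \<in> T" and x: "x \<in> T" "adjacent y x" and n: "n \<in> compose s T"
    "y = left_part n \<or> y = right_part n"
  shows "\<exists>m\<in>compose s T. (x = left_part m \<or> x = right_part m) \<and> (m = n \<or> adjacent n m)"
  using n(2)
proof
  assume yn: "y = left_part n"
  then have "tile_color x \<noteq> Red"
    using adjacent_color[OF y x] by simp
  then have "tile_color x = Green"
    by (cases "tile_color x") auto
  then obtain m where m: "m \<in> compose s T" "right_part m = x"
    using compose_right x by blast
  consider "apex x = apex y" "end1 x = end2 y" | "apex x = apex y" "end2 x = end1 y" | "end1 x = end2 y"
    "end2 x = end1 y"
    using x(2) by (auto simp: adjacent_def)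
  then show ?thesis
  proof cases
    case 1
    then have "x = right_part n"
      using yn unique[OF x(1) composeD(3)[OF n(1)]] by simp
    then show ?thesis
      using n(1) by blast
  next
    case 2
    then have "midpoint (end1 m) (end2 m) = midpoint (end1 n) (end2 n)" "end1 m = end2 n"
      using m yn by auto
    then have "adjacent n m"
      by (simp add: adjacent_def midpoint_complex)
    then show ?thesis
      using m by blast
  next
    case 3
    then have "adjacent n m"
      using m yn by (auto simp: adjacent_def)
    then show ?thesis
      using m by blast
  qed
next
  assume yn: "y = right_part n"
  then have "tile_color x \<noteq> Green"
    using adjacent_color[OF y x] by simp
  then have "tile_color x = Red"
    by (cases "tile_color x") auto
  then obtain m where m: "m \<in> compose s T" "left_part m = x"
    using compose_left x by blast
  consider "apex x = apex y" "end1 x = end2 y" | "apex x = apex y" "end2 x = end1 y" | "end1 x = end2 y"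
    "end2 x = end1 y"
    using x(2) by (auto simp: adjacent_def)
  then show ?thesis
  proof cases
    case 1
    then have "midpoint (end1 m) (end2 m) = midpoint (end1 n) (end2 n)" "end2 m = end1 n"
      using m yn by auto
    then have "adjacent n m"
      by (simp add: adjacent_def midpoint_complex)
    then show ?thesis
      using m by blast
  next
    case 2
    then have "x = left_part n"
      using yn unique_end2[OF x(1) composeD(2)[OF n(1)]] by simp
    then show ?thesis
      using n(1) by blast
  next
    case 3
    then have "adjacent n m"
      using m yn by (auto simp: adjacent_def)
    then show ?thesis
      using m by blast
  qed
qed

end

section \<open>Finite connected fragments\<close>

text \<open>After finitely many compositions the tiles of \<open>F\<close> lie in tiles with a common acute vertex.\<close>

inductive settles :: "real \<Rightarrow> tile set \<Rightarrow> tile set \<Rightarrow> bool" where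
  shared: "F \<subseteq> T \<Longrightarrow> F \<noteq> {} \<Longrightarrow>
    (\<And>t. t \<in> F \<Longrightarrow> v \<in> {end1 t, end2 t}) \<Longrightarrow> settles s T F"
| parents: "settles (sqrt 2 * s) (compose s T) G \<Longrightarrow> F \<subseteq> T \<Longrightarrow>
  F \<subseteq> cut G \<Longrightarrow> settles s T F"

lemma settles_subset: "settles s T F \<Longrightarrow> F \<subseteq> T"
  by (cases rule: settles.cases) auto

context coherent_tiles
begin

text \<open>\<open>N\<close> and \<open>N'\<close> have the same two acute vertices, and a neighbour
  \<open>M\<close> of \<open>N\<close> has at least one of them as an acute vertex, whichever side
  it shares with \<open>N\<close>.\<close>

lemma square_settles:
  assumes n: "n \<in> compose s T" "apex n = v" and m: "m \<in> compose s T" "m = n \<or> adjacent n m"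
  obtains N N' M x where "{N, N', M} \<subseteq> compose (sqrt 2 * s) (compose s T)"
     "end1 N' = end2 N" "end2 N' = end1 N" "\<And>t. t \<in> {N, N', M} \<Longrightarrow>
       x \<in> {end1 t, end2 t}"
     "insert m {k \<in> compose s T. apex k = v} \<subseteq> cut {N, N', M}"
     "{k \<in> compose s T. apex k = v} \<subseteq> cut {N, N'}"
proof -
  interpret C: coherent_tiles "sqrt 2 * s" "compose s T"
    by (rule compose_coherent)
  let ?T = "compose (sqrt 2 * s) (compose s T)"
  interpret C2: coherent_tiles "sqrt 2 * (sqrt 2 * s)" ?T
    by (rule C.compose_coherent)
  have "tile_color n = Red \<or> tile_color n = Green"
    by (cases "tile_color n") auto
  then obtain N where N: "N \<in> ?T" "n = left_part N \<or> n = right_part N"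
    using C.compose_left[OF n(1)] C.compose_right[OF n(1)] by metis
  obtain N' where N': "N' \<in> ?T" "end1 N' = end2 N" "end2 N' = end1 N"
    using C2.hyp_neighbour[OF N(1)] by blast
  obtain M where M: "M \<in> ?T" "m = left_part M \<or> m = right_part M" "M = N \<or> adjacent N M"
  proof (cases "m = n")
    case True
    then show ?thesis
      using that N by blast
  next
    case False
    then show ?thesis
      using that C.adjacent_parents[OF n(1) m(1) _ N] m(2) by blast
  qed
  have sq: "{k \<in> compose s T. apex k = v} \<subseteq> cut {N, N'}"
  proof
    fix k assume k: "k \<in> {k \<in> compose s T. apex k = v}"
    then show "k \<in> cut {N, N'}"
      using C.square_in_hyp_pair[OF N(1) N'(1,2,3), of n k] N(2) n compose_apex_aligned[OF n(1), of k] by simp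
  qed
  have "\<exists>x. \<forall>t\<in>{N, N', M}. x \<in> {end1 t, end2 t}"
  proof -
    have "M = N \<or> end1 M = end2 N \<or> end2 M = end1 N"
      using M(3) by (auto simp: adjacent_def)
    then have "(\<forall>t\<in>{N, N', M}. end1 N \<in> {end1 t, end2 t}) \<or>
      (\<forall>t\<in>{N, N', M}. end2 N \<in> {end1 t, end2 t})"
      using N' by auto
    then show ?thesis
      by blast
  qed
  then obtain x where x: "\<forall>t\<in>{N, N', M}. x \<in> {end1 t, end2 t}"
    by blast
  have ins: "insert m {k \<in> compose s T. apex k = v} \<subseteq> cut {N, N', M}"
    using sq cut_mono[of "{N, N'}" "{N, N', M}"] M(2) parts_in_cut[of M "{N, N', M}"] by auto
  have "{N, N', M} \<subseteq> ?T"
    using N N' M by blast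
  then show ?thesis
    using that[OF _ N'(2,3) bspec[OF x] ins sq] by blast
qed

text \<open>A red star is covered by \<open>red_star_legal\<close>. A green star comes from the
  square of composed tiles around \<open>v\<close>; this lies in a pair with common hypotenuse two
  levels up, and \<open>hyp_neighbours_legal\<close> moves on to a red star.\<close>

lemma shared_legal:
  assumes F: "F \<subseteq> T" "F \<noteq> {}" "\<And>t. t \<in> F \<Longrightarrow> v \<in> {end1 t, end2 t}"
  shows "legal s F"
proof -
  obtain y where y: "y \<in> T" "end1 y = v"
    using F star_end1_tile by blast
  show ?thesis
  proof (cases "tile_color y")
    case Red
    then show ?thesis
      using red_star_legal[OF y _ F(1,3)] by blast
  next
    case Green
    interpret C: coherent_tiles "sqrt 2 * s" "compose s T"
      by (rule compose_coherent)
    interpret C2: coherent_tiles "sqrt 2 * (sqrt 2 * s)" "compose (sqrt 2 * s) (compose s T)"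
      by (rule C.compose_coherent)
    let ?G = "{k \<in> compose s T. apex k = v}"
    obtain n where n: "n \<in> compose s T" "apex n = v"
      using green_star_parents[OF y Green y(1)] y(2) by blast
    obtain N N' M where N: "{N, N', M} \<subseteq> compose (sqrt 2 * s) (compose s T)"
      "end1 N' = end2 N" "end2 N' = end1 N" "?G \<subseteq> cut {N, N'}"
      by (rule square_settles[OF n n(1) disjI1[OF refl]]) (rule that)
    have "N \<in> compose (sqrt 2 * s) (compose s T)" "N' \<in> compose (sqrt 2 * s) (compose s T)"
      using N(1) by simp_all
    then have "legal (sqrt 2 * s) (cut {N, N'})"
      using legal_cut[OF C2.hyp_neighbours_legal] N(2,3) by simp
    then have "legal s (cut ?G)"
      using legal_cut[OF legal_mono[OF _ N(4)]] by simp
    moreover have "F \<subseteq> cut ?G"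
    proof
      fix t assume t: "t \<in> F"
      then show "t \<in> cut ?G"
        using green_star_parents[OF y Green _ F(3)[OF t]] F(1) unfolding cut_iff by blast
    qed
    ultimately show ?thesis
      using legal_mono by blast
  qed
qed

text \<open>A tile \<open>x\<close> without the vertex \<open>v\<close> lies across the side of
  \<open>y\<close> opposite \<open>v\<close>. In a red star this side is the height of the parent,
  so \<open>x\<close> has the same parent. In a green star it is half of the parent's hypotenuse,
  and the parent of \<open>x\<close> joins the others at a common vertex one level higher.\<close>

lemma shared_insert_settles:
  assumes F: "F \<subseteq> T" "\<And>t. t \<in> F \<Longrightarrow>
    v \<in> {end1 t, end2 t}" and y: "y \<in> F" and x: "x \<in> T" "adjacent y x"
  shows "settles s T (insert x F)"
proof (cases "v \<in> {end1 x, end2 x}")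
  case True
  then show ?thesis
    using F x(1) by (intro settles.shared[of _ _ v]) auto
next
  case False
  have yT: "y \<in> T"
    using y F by blast
  obtain z where z: "z \<in> T" "end1 z = v"
    using F(2)[OF y] star_end1_tile[OF yT] by blast
  show ?thesis
  proof (cases "tile_color z")
    case Red
    let ?G = "{k \<in> compose s T. v \<in> {end1 k, end2 k}}"
    have FG: "F \<subseteq> cut ?G"
    proof
      fix t assume t: "t \<in> F"
      then show "t \<in> cut ?G"
        using red_star_parents[OF z Red _ F(2)[OF t]] F(1) unfolding cut_iff by blast
    qed
    have "x \<in> cut ?G"
      using red_star_parents[OF z Red yT F(2)[OF y]]
    proof
      assume "\<exists>m\<in>compose s T. end2 m = v \<and> y = left_part m"
      then obtain m where m: "m \<in> compose s T" "end2 m = v" "y = left_part m"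
        by blast
      then have "apex x = apex (right_part m)" "end1 x = end1 (right_part m)"
        using x(2) False by (auto simp: adjacent_def)
      then have "x = right_part m"
        using unique[OF x(1) composeD(3)[OF m(1)]] by blast
      then show ?thesis
        using m parts_in_cut(2)[of m ?G] by simp
    next
      assume "\<exists>m\<in>compose s T. end1 m = v \<and> y = right_part m"
      then obtain m where m: "m \<in> compose s T" "end1 m = v" "y = right_part m"
        by blast
      then have "apex x = apex (left_part m)" "end2 x = end2 (left_part m)"
        using x(2) False by (auto simp: adjacent_def)
      then have "x = left_part m"
        using unique_end2[OF x(1) composeD(2)[OF m(1)]] by blast
      then show ?thesis
        using m parts_in_cut(1)[of m ?G] by simp
    qed
    then have "?G \<noteq> {}" "insert x F \<subseteq> cut ?G"
      using FG by (auto simp: cut_iff)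
    then show ?thesis
      using F(1) x(1) by (intro settles.parents[OF settles.shared[of ?G _ v]]) auto
  next
    case Green
    let ?G = "{k \<in> compose s T. apex k = v}"
    have FG: "F \<subseteq> cut ?G"
    proof
      fix t assume t: "t \<in> F"
      then show "t \<in> cut ?G"
        using green_star_parents[OF z Green _ F(2)[OF t]] F(1) unfolding cut_iff by blast
    qed
    obtain n where n: "n \<in> compose s T" "apex n = v" "y = left_part n \<or> y = right_part n"
      using green_star_parents[OF z Green yT F(2)[OF y]] by blast
    obtain m where m: "m \<in> compose s T" "x = left_part m \<or> x = right_part m" "m = n \<or> adjacent n m"
      using adjacent_parents[OF yT x n(1,3)] by blast
    obtain N N' M v' where G: "{N, N', M} \<subseteq> compose (sqrt 2 * s) (compose s T)"
      "\<And>t. t \<in> {N, N', M} \<Longrightarrow> v' \<in> {end1 t, end2 t}"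
        "insert m ?G \<subseteq> cut {N, N', M}"
      by (rule square_settles[OF n(1,2) m(1,3)]) (rule that)
    have "settles (sqrt 2 * s) (compose s T) (insert m ?G)"
      by (rule settles.parents[OF settles.shared[OF G(1) _ G(2)] _ G(3)]) (use m(1) in auto)
    moreover have "insert x F \<subseteq> T"
      using F(1) x(1) by simp
    moreover have "insert x F \<subseteq> cut (insert m ?G)"
      using FG m(2) cut_mono[of ?G "insert m ?G"] parts_in_cut[of m "insert m ?G"] by auto
    ultimately show ?thesis
      by (rule settles.parents)
  qed
qed

end

lemma settles_legal:
  assumes "settles s T F" "coherent_tiles s T"
  shows "legal s F"
  using assms
proof (induction rule: settles.induct)
  case (shared F T v s)
  show ?case
    by (rule coherent_tiles.shared_legal[OF shared.prems shared.hyps])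
next
  case (parents s T G F)
  show ?case
    by (rule legal_mono[OF legal_cut[OF parents.IH[OF coherent_tiles.compose_coherent[OF
      parents.prems]]] parents.hyps(3)])
qed

text \<open>In the base case at most two further compositions are spent. In the step, the parent of
  \<open>x\<close> is in \<open>G\<close> or adjacent to a tile of \<open>G\<close>.\<close>

lemma settles_insert:
  assumes "settles s T F" "coherent_tiles s T" "y \<in> F" "x \<in> T" "adjacent y x"
  shows "settles s T (insert x F)"
  using assms
proof (induction arbitrary: x y rule: settles.induct)
  case (shared F T v s)
  show ?case
    by (rule coherent_tiles.shared_insert_settles[OF shared.prems(1) shared.hyps(1,3) shared.prems(2-4)])
next
  case (parents s T G F)
  interpret coherent_tiles s T
    by fact
  obtain n where n: "n \<in> G" "y = left_part n \<or> y = right_part n"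
    using subsetD[OF parents.hyps(3) parents.prems(2)] unfolding cut_iff by blast
  have nT: "n \<in> compose s T"
    using n(1) settles_subset[OF parents.hyps(1)] by blast
  obtain m where m: "m \<in> compose s T" "x = left_part m \<or> x = right_part m" "m = n \<or> adjacent n m"
    using adjacent_parents[OF subsetD[OF parents.hyps(2) parents.prems(2)] parents.prems(3,4) nT n(2)] by blast
  have "settles (sqrt 2 * s) (compose s T) (insert m G)"
    using m(3)
  proof
    assume "m = n"
    then show ?thesis
      using n(1) parents.hyps(1) by (simp add: insert_absorb)
  next
    assume "adjacent n m"
    then show ?thesis
      using parents.IH[OF compose_coherent n(1) m(1)] by blast
  qed
  moreover have "insert x F \<subseteq> T"
    using parents.prems(3) parents.hyps(2) by simp
  moreover have "insert x F \<subseteq> cut (insert m G)"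
    using parents.hyps(3) m(2) cut_mono[of G "insert m G"] parts_in_cut[of m "insert m G"] by auto
  ultimately show ?case
    by (rule settles.parents)
qed

text \<open>Only neighbours can be added to a settling set, so \<open>F\<close> is enlarged by paths
  that join its tiles to \<open>t0\<close>.\<close>

lemma finite_connected_legal:
  assumes T: "coherent_tiles s T" "t0 \<in> T"
    and conn: "\<And>t. t \<in> T \<Longrightarrow> (\<lambda>x y. y \<in> T \<and>
      adjacent x y)\<^sup>*\<^sup>* t0 t"
    and F: "finite F" "F \<subseteq> T"
  shows "legal s F"
proof -
  have "\<exists>G. settles s T G \<and> t0 \<in> G \<and> F \<subseteq> G"
    using F
  proof (induction rule: finite_induct)
    case empty
    have "settles s T {t0}"
      using T(2) by (intro settles.shared[of _ _ "end1 t0"]) auto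
    then show ?case
      by blast
  next
    case (insert f F)
    obtain G where G: "settles s T G" "t0 \<in> G" "F \<subseteq> G"
      using insert.IH insert.prems by auto
    have "(\<lambda>x y. y \<in> T \<and> adjacent x y)\<^sup>*\<^sup>* t0 f"
      using conn insert.prems by simp
    then have "\<exists>G'. settles s T G' \<and> G \<subseteq> G' \<and> f \<in> G'"
    proof (induction rule: rtranclp_induct)
      case base
      then show ?case
        using G by blast
    next
      case (step y z)
      then show ?case
        using settles_insert[OF _ T(1)] by (metis insertI1 subset_insertI2)
    qed
    then show ?case
      using G by blast
  qed
  then show ?thesis
    using settles_legal[OF _ T(1)] legal_mono by blast
qed

section \<open>Scaling: from cuts to supertiles\<close>

lemma map_tile_parts:
  assumes "a \<noteq> 0"
  shows "left_part (map_tile (\<lambda>z. a * z) t) = map_tile (\<lambda>z. a * z) (left_part t)"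
    "right_part (map_tile (\<lambda>z. a * z) t) = map_tile (\<lambda>z. a * z) (right_part t)"
  \<comment> \<open>\<open>half_at\<close> compares endpoints; it commutes with the scaling because
    the scaling is injective.\<close>
  using assms
  by (auto simp: left_part_def right_part_def map_tile_def map_arrow_def height_def half_at_def
      midpoint_complex algebra_simps intro!: tile.equality arrow.equality)

lemma map_tile_mult: "map_tile (\<lambda>z. a * z) (map_tile (\<lambda>z. b * z) t) = map_tile
  (\<lambda>z. a * b * z) t"
  by (simp add: map_tile_def map_arrow_def mult_ac)

lemma map_tile_cut:
  assumes "a \<noteq> 0"
  shows "map_tile (\<lambda>z. a * z) ` cut S = cut (map_tile (\<lambda>z. a * z) ` S)"
  by (auto simp: cut_def map_tile_parts[OF assms] image_iff)

lemma decomposition_cut: "decomposition S = map_tile (\<lambda>z. complex_of_real (sqrt 2) * z) ` cut S"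
  by (simp add: decomposition_def cut_def)

lemma decomposition_pow:
  "(decomposition ^^ n) S = map_tile (\<lambda>z. complex_of_real (sqrt 2 ^ n) * z) ` (cut ^^ n) S"
proof (induction n)
  case 0
  have "map_tile (\<lambda>z. z) t = t" for t :: tile
    by (simp add: map_tile_def map_arrow_def)
  then show ?case
    by simp
next
  case (Suc n)
  have "(decomposition ^^ Suc n) S = map_tile (\<lambda>z. complex_of_real (sqrt 2) * z) `
     cut (map_tile (\<lambda>z. complex_of_real (sqrt 2 ^ n) * z) ` (cut ^^ n) S)"
    by (simp only: funpow.simps comp_apply Suc decomposition_cut)
  also have "\<dots> = map_tile (\<lambda>z. complex_of_real (sqrt 2) * z) `
     map_tile (\<lambda>z. complex_of_real (sqrt 2 ^ n) * z) ` (cut ^^ Suc n) S"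
    by (subst map_tile_cut[symmetric]) auto
  also have "\<dots> = map_tile (\<lambda>z. complex_of_real (sqrt 2 ^ Suc n) * z) ` (cut ^^ Suc n) S"
    by (simp add: image_image map_tile_mult)
  finally show ?case .
qed

text \<open>The seed is shrunk to leg length \<open>s\<close>, and the \<open>n\<close> rescalings
  undo this. So the supertile is the cut of the original seed in its place, and the translation is
  by 0.\<close>

lemma legal_supertile:
  assumes "legal s F"
  shows "\<exists>n S w. supertile s n S \<and> map_tile (\<lambda>z. z + w) ` F \<subseteq> S"
proof -
  obtain n t where t: "triangle_tile (sqrt 2 ^ n * s) t" "F \<subseteq> (cut ^^ n) {t}"
    using assms by (auto simp: legal_def)
  define a where "a = complex_of_real (sqrt 2 ^ n)"
  have a: "a \<noteq> 0" "cmod a = sqrt 2 ^ n"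
    by (simp_all add: a_def norm_power)
  define t0 where "t0 = map_tile (\<lambda>z. inverse a * z) t"
  have "triangle_tile s t0"
  proof -
    have "cmod (inverse a * end1 t - inverse a * apex t) = inverse (cmod a) * cmod (end1 t - apex t)"
      by (simp add: right_diff_distrib[symmetric] norm_mult norm_inverse)
    also have "\<dots> = s"
      using t(1) a by (auto simp: triangle_tile_def)
    finally have "cmod (inverse a * end1 t - inverse a * apex t) = s" .
    moreover have "inverse a * end2 t - inverse a * apex t = \<i> * (inverse a * end1 t - inverse a * apex t)"
      using t(1) by (simp add: right_diff_distrib[symmetric] triangle_tile_def)
    ultimately show ?thesis
      using t(1) a(1) by (auto simp: triangle_tile_def t0_def map_tile_def map_arrow_def joins_def)
  qed
  moreover have "(cut ^^ n) {t} = (decomposition ^^ n) {t0}"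
  proof -
    have "map_tile (\<lambda>z. a * z) ` (cut ^^ k) S = (cut ^^ k) (map_tile (\<lambda>z. a * z) ` S)" for k S
      by (induction k) (simp_all add: map_tile_cut[OF a(1)])
    moreover have "map_tile (\<lambda>z. a * z) t0 = t"
      unfolding t0_def map_tile_mult using a(1) by (simp add: map_tile_def map_arrow_def)
    ultimately show ?thesis
      unfolding decomposition_pow a_def[symmetric] by simp
  qed
  moreover have "map_tile (\<lambda>z. z + 0) x = x" for x :: tile
    by (simp add: map_tile_def map_arrow_def)
  ultimately show ?thesis
    using t(2) unfolding supertile_def
    by (intro exI[of _ n] exI[of _ "(cut ^^ n) {t}"] exI[of _ 0]) auto
qed

section \<open>Geometry of a correct tiling\<close>

text \<open>The coordinate in which the tile becomes the standard triangle with vertices 0, 1 and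
  \<open>i\<close>.\<close>

definition tile_coord :: "tile \<Rightarrow> complex \<Rightarrow> complex" where
  "tile_coord t z = (z - apex t) / (end1 t - apex t)"

lemma tile_coord_inverse:
  assumes "triangle_tile s t"
  shows "z = apex t + tile_coord t z * (end1 t - apex t)"
  using tile_distinct(1)[OF assms] by (simp add: tile_coord_def)

lemma tile_coord_add:
  assumes "triangle_tile s t"
  shows "tile_coord t (apex t + w * (end1 t - apex t)) = w"
  using tile_distinct(1)[OF assms] by (simp add: tile_coord_def)

lemma triangle_iff:
  assumes "triangle_tile s t"
  shows "z \<in> triangle t \<longleftrightarrow>
    0 \<le> Re (tile_coord t z) \<and> 0 \<le> Im (tile_coord t z) \<and>
      Re (tile_coord t z) + Im (tile_coord t z) \<le> 1"
    (is "_ \<longleftrightarrow> ?R")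
proof
  assume "z \<in> triangle t"
  then obtain a b c where abc: "0 \<le> a" "0 \<le> b" "0 \<le> c" "a + b + c = 1"
    and z: "z = a *\<^sub>R apex t + b *\<^sub>R end1 t + c *\<^sub>R end2 t"
    unfolding triangle_def vertices_def convex_hull_3 by blast
  have a: "a = 1 - b - c"
    using abc by simp
  have "z = apex t + Complex b c * (end1 t - apex t)"
    unfolding z a end2_eq[OF assms] Complex_eq by (simp add: scaleR_conv_of_real algebra_simps)
  then have "tile_coord t z = Complex b c"
    using tile_coord_add[OF assms] by simp
  then show ?R
    using abc by simp
next
  assume R: ?R
  define b c where "b = Re (tile_coord t z)" and "c = Im (tile_coord t z)"
  have "tile_coord t z = Complex b c"
    by (simp add: b_def c_def)
  then have "z = apex t + Complex b c * (end1 t - apex t)"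
    using tile_coord_inverse[OF assms, of z] by simp
  also have "\<dots> = (1 - b - c) *\<^sub>R apex t + b *\<^sub>R end1 t + c *\<^sub>R end2 t"
    unfolding end2_eq[OF assms] Complex_eq by (simp add: scaleR_conv_of_real algebra_simps)
  finally show "z \<in> triangle t"
    unfolding triangle_def vertices_def convex_hull_3 using R
    by (intro CollectI exI[of _ "1 - b - c"] exI[of _ b] exI[of _ c]) (auto simp: b_def c_def)
qed

definition strictly_inside :: "complex \<Rightarrow> bool" where
  "strictly_inside w \<longleftrightarrow> 0 < Re w \<and> 0 < Im w \<and> Re w + Im w < 1"

lemma strictly_inside_interior:
  assumes t: "triangle_tile s t" and "strictly_inside (tile_coord t z)"
  shows "z \<in> interior (triangle t)"
proof (rule interiorI)
  let ?S = "{z. strictly_inside (tile_coord t z)}"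
  have "continuous_on UNIV (\<lambda>z. Re (tile_coord t z))"
    "continuous_on UNIV (\<lambda>z. Im (tile_coord t z))"
    unfolding tile_coord_def using tile_distinct(1)[OF t] by (intro continuous_intros; simp)+
  then have "open {z. 0 < Re (tile_coord t z)}" "open {z. 0 < Im (tile_coord t z)}"
    "open {z. Re (tile_coord t z) + Im (tile_coord t z) < 1}"
    by (auto intro!: open_Collect_less continuous_on_add)
  then show "open ?S"
    unfolding strictly_inside_def by (intro open_Collect_conj)
  show "z \<in> ?S"
    using assms by simp
  show "?S \<subseteq> triangle t"
  proof
    fix x assume "x \<in> ?S"
    then show "x \<in> triangle t"
      using triangle_iff[OF t, of x] by (simp add: strictly_inside_def)
  qed
qed

lemma seg_coord:
  assumes t: "triangle_tile s t"
  shows "z \<in> seg (leg1 t) \<Longrightarrow> Im (tile_coord t z) = 0"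
    "z \<in> seg (leg2 t) \<Longrightarrow> Re (tile_coord t z) = 0"
    "z \<in> seg (hyp t) \<Longrightarrow> Re (tile_coord t z) + Im (tile_coord t z) = 1"
proof -
  have segs: "seg (leg1 t) = closed_segment (apex t) (end1 t)" "seg (leg2 t) = closed_segment (apex t) (end2 t)"
    "seg (hyp t) = closed_segment (end1 t) (end2 t)"
    using t by (auto simp: triangle_tile_def joins_def closed_segment_commute)
  show "z \<in> seg (leg1 t) \<Longrightarrow> Im (tile_coord t z) = 0"
  proof -
    assume "z \<in> seg (leg1 t)"
    then obtain k where "z = (1 - k) *\<^sub>R apex t + k *\<^sub>R end1 t"
      unfolding segs in_segment by blast
    then have "z = apex t + complex_of_real k * (end1 t - apex t)"
      by (simp add: scaleR_conv_of_real algebra_simps)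
    then show ?thesis
      using tile_coord_add[OF t] by simp
  qed
  show "z \<in> seg (leg2 t) \<Longrightarrow> Re (tile_coord t z) = 0"
  proof -
    assume "z \<in> seg (leg2 t)"
    then obtain k where "z = (1 - k) *\<^sub>R apex t + k *\<^sub>R end2 t"
      unfolding segs in_segment by blast
    then have "z = apex t + (\<i> * complex_of_real k) * (end1 t - apex t)"
      unfolding end2_eq[OF t] by (simp add: scaleR_conv_of_real algebra_simps)
    then show ?thesis
      using tile_coord_add[OF t] by simp
  qed
  show "z \<in> seg (hyp t) \<Longrightarrow> Re (tile_coord t z) + Im (tile_coord t z) = 1"
  proof -
    assume "z \<in> seg (hyp t)"
    then obtain k where "z = (1 - k) *\<^sub>R end1 t + k *\<^sub>R end2 t"
      unfolding segs in_segment by blast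
    then have "z = apex t + (complex_of_real (1 - k) + \<i> * complex_of_real k) * (end1 t - apex t)"
      unfolding end2_eq[OF t] by (simp add: scaleR_conv_of_real algebra_simps)
    then show ?thesis
      using tile_coord_add[OF t] by simp
  qed
qed

lemma seg_subset_triangle:
  assumes t: "triangle_tile s t" and "e \<in> sides t"
  shows "seg e \<subseteq> triangle t"
proof -
  have "src e \<in> vertices t" "tgt e \<in> vertices t"
    using assms by (auto simp: sides_def triangle_tile_def joins_def vertices_def)
  then show ?thesis
    unfolding triangle_def by (intro closed_segment_subset) (auto simp: hull_inc)
qed

lemma strictly_inside_not_side:
  assumes t: "triangle_tile s t" and "e \<in> sides t" "z \<in> seg e"
  shows "\<not> strictly_inside (tile_coord t z)"
  using seg_coord[OF t, of z] assms by (auto simp: sides_def strictly_inside_def)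

locale geometric_tiling =
  fixes s :: real and T :: "tile set"
  assumes correct: "correct_tiling s T"
begin

lemma tile: "t \<in> T \<Longrightarrow> triangle_tile s t"
  using correct by (simp add: correct_tiling_def tiles_plane_def)

lemma cover: "\<exists>t\<in>T. z \<in> triangle t"
proof -
  have "z \<in> (\<Union>t\<in>T. triangle t)"
    using correct by (simp add: correct_tiling_def tiles_plane_def)
  then show ?thesis
    by blast
qed

text \<open>Disjointness of interiors extends to the boundary of \<open>u\<close>: an open set that
  misses the interior of \<open>u\<close> also misses its closure, which contains all of
  \<open>u\<close> by convexity.\<close>

lemma strictly_inside_eq:
  assumes "t \<in> T" "u \<in> T" "strictly_inside (tile_coord t z)" "z \<in> triangle u"
  shows "t = u"
proof (rule ccontr)
  assume "t \<noteq> u"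
  then have "interior (triangle t) \<inter> interior (triangle u) = {}"
    using correct assms(1,2) by (simp add: correct_tiling_def tiles_plane_def)
  then have "interior (triangle t) \<inter> closure (interior (triangle u)) = {}"
    by (simp add: open_Int_closure_eq_empty)
  moreover have "closure (interior (triangle u)) = closure (triangle u)"
  proof (rule convex_closure_interior)
    show "convex (triangle u)"
      by (simp add: triangle_def)
    have "strictly_inside (tile_coord u (apex u + Complex (1/3) (1/3) * (end1 u - apex u)))"
      unfolding tile_coord_add[OF tile[OF assms(2)]] by (simp add: strictly_inside_def)
    then show "interior (triangle u) \<noteq> {}"
      using strictly_inside_interior[OF tile[OF assms(2)]] by blast
  qed
  moreover have "z \<in> closure (triangle u)"
    using assms(4) closure_subset by blast
  ultimately show False
    using strictly_inside_interior[OF tile[OF assms(1)] assms(3)] by blast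
qed

definition center :: "tile \<Rightarrow> complex" where
  "center t = apex t + Complex (1/3) (1/3) * (end1 t - apex t)"

lemma center_coord: "t \<in> T \<Longrightarrow> tile_coord t (center t) = Complex (1/3) (1/3)"
  unfolding center_def using tile_coord_add tile by blast

lemma center_inside: "t \<in> T \<Longrightarrow> strictly_inside (tile_coord t (center t))"
  "t \<in> T \<Longrightarrow> center t \<in> triangle t"
  by (auto simp: center_coord strictly_inside_def triangle_iff[OF tile])

lemma unique:
  assumes "t \<in> T" "u \<in> T" "apex t = apex u" "end1 t = end1 u"
  shows "t = u"
  using strictly_inside_eq[OF assms(1,2) center_inside(1)[OF assms(1)]] center_inside(2)[OF assms(2)] assms
  by (simp add: center_def)

text \<open>In tile coordinates a displacement shorter than 1/6 keeps the center inside: both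
  coordinates stay positive, and their sum stays below 2/3 + 2/6 = 1.\<close>

lemma center_separated:
  assumes "t \<in> T" "u \<in> T" "dist (center t) (center u) < s / 6"
  shows "t = u"
proof (rule strictly_inside_eq[OF assms(1,2) _ center_inside(2)[OF assms(2)]])
  define w where "w = (center u - center t) / (end1 t - apex t)"
  have s: "cmod (end1 t - apex t) = s" "s > 0"
    using tile[OF assms(1)] cmod_leg(3) by (auto simp: triangle_tile_def)
  have "cmod w < 1 / 6"
    using assms(3) s by (simp add: w_def norm_divide dist_norm norm_minus_commute field_simps)
  then have "\<bar>Re w\<bar> < 1 / 6" "\<bar>Im w\<bar> < 1 / 6"
    using abs_Re_le_cmod[of w] abs_Im_le_cmod[of w] by linarith+
  moreover have "tile_coord t (center u) = Complex (1/3) (1/3) + w"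
    unfolding center_coord[OF assms(1), symmetric] by (simp add: tile_coord_def w_def diff_divide_distrib)
  ultimately show "strictly_inside (tile_coord t (center u))"
    by (auto simp: strictly_inside_def)
qed

lemma center_near:
  assumes "t \<in> T" "z \<in> triangle t"
  shows "dist (center t) z \<le> 2 * s"
proof -
  define w where "w = tile_coord t z"
  have w: "0 \<le> Re w" "0 \<le> Im w" "Re w + Im w \<le> 1"
    using assms(2) triangle_iff[OF tile[OF assms(1)], of z] by (simp_all add: w_def)
  have s: "cmod (end1 t - apex t) = s" "s > 0"
    using tile[OF assms(1)] cmod_leg(3) by (auto simp: triangle_tile_def)
  have "center t - z = (Complex (1/3) (1/3) - w) * (end1 t - apex t)"
    using tile_coord_inverse[OF tile[OF assms(1)], of z] unfolding center_def w_def by (simp add: algebra_simps)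
  then have "dist (center t) z = cmod (Complex (1/3) (1/3) - w) * s"
    using s by (simp add: dist_norm norm_mult)
  also have "cmod (Complex (1/3) (1/3) - w) \<le> 2"
    using cmod_le[of "Complex (1/3) (1/3) - w"] w by (simp add: abs_le_iff)
  finally show ?thesis
    using s by simp
qed

text \<open>Different tiles have centers at least \<open>s / 6\<close> apart, and the centers in
  question lie in a disc. Infinitely many of them would accumulate, and two would lie within
  \<open>s / 12\<close> of a limit point.\<close>

lemma locally_finite: "finite {t \<in> T. triangle t \<inter> cball x 1 \<noteq> {}}"
proof (rule ccontr)
  let ?N = "{t \<in> T. triangle t \<inter> cball x 1 \<noteq> {}}"
  assume inf: "infinite ?N"
  then obtain t0 where "t0 \<in> T"
    using not_finite_existsD by blast
  then have s: "s > 0"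
    using cmod_leg(3) tile by blast
  have "inj_on center ?N"
    using center_separated s by (auto intro!: inj_onI)
  then have "infinite (center ` ?N)"
    using inf finite_imageD by blast
  moreover have "center ` ?N \<subseteq> cball x (1 + 2 * s)"
  proof
    fix c assume "c \<in> center ` ?N"
    then obtain t where t: "t \<in> ?N" "c = center t"
      by blast
    then obtain z where "z \<in> triangle t \<inter> cball x 1"
      by blast
    with t show "c \<in> cball x (1 + 2 * s)"
      using center_near[of t z] dist_triangle[of x c z] by (simp add: dist_commute)
  qed
  ultimately obtain l where "l islimpt center ` ?N"
    using bounded_infinite_imp_islimpt[of "center ` ?N" "center ` ?N"] bounded_subset[OF bounded_cball] by blast
  then have inf': "infinite (center ` ?N \<inter> ball l (s / 12))"
    using s unfolding islimpt_eq_infinite_ball by simp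
  obtain a where a: "a \<in> center ` ?N \<inter> ball l (s / 12)"
    using infinite_imp_nonempty[OF inf'] by blast
  obtain b where b: "b \<in> center ` ?N \<inter> ball l (s / 12) - {a}"
    using infinite_imp_nonempty[OF infinite_remove[OF inf', of a]] by blast
  obtain t u where tu: "t \<in> T" "u \<in> T" "a = center t" "b = center u"
    using a b by blast
  have near: "dist l (center t) < s / 12" "dist l (center u) < s / 12" "center t \<noteq> center u"
    using a b unfolding tu(3,4) by (simp_all add: eq_commute)
  then have "dist (center t) (center u) < s / 6"
    using dist_triangle2[of "center t" "center u" l] by (simp add: dist_commute)
  then show False
    using center_separated tu near(3) by blast
qed

end

lemma closed_triangle: "closed (triangle t)"
proof -
  have "compact (convex hull {apex t, end1 t, end2 t})"
    by (intro compact_convex_hull finite_imp_compact) simp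
  then show ?thesis
    unfolding triangle_def vertices_def by (rule compact_imp_closed)
qed

context geometric_tiling
begin

text \<open>The points on the ray beyond the boundary of \<open>t\<close> belong to other tiles.
  Near the limit point these are finitely many closed sets, so their union contains the limit
  point.\<close>

lemma boundary_point_shared:
  assumes t: "t \<in> T" and out: "\<And>r. (0::real) < r \<Longrightarrow>
    apex t + (m + complex_of_real r * w) * (end1 t - apex t) \<notin> triangle t"
  shows "\<exists>u\<in>T. u \<noteq> t \<and> apex t + m * (end1 t - apex t) \<in> triangle u"
proof (rule ccontr)
  define x where "x = apex t + m * (end1 t - apex t)"
  assume "\<not> ?thesis"
  then have no: "x \<notin> triangle u" if "u \<in> T" "u \<noteq> t" for u
    using that by (auto simp: x_def)
  let ?N = "{u \<in> T. triangle u \<inter> cball x 1 \<noteq> {}} - {t}"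
  have "closed (\<Union>u\<in>?N. triangle u)"
    by (intro closed_UN ballI finite_Diff locally_finite closed_triangle)
  then have "open (- (\<Union>u\<in>?N. triangle u))"
    by (rule open_Compl)
  moreover have "x \<in> - (\<Union>u\<in>?N. triangle u)"
    using no by blast
  ultimately obtain e where e: "e > 0" "ball x e \<subseteq> - (\<Union>u\<in>?N. triangle u)"
    by (rule openE)
  define k where "k = cmod (w * (end1 t - apex t))"
  define r where "r = min e 1 / (2 * (k + 1))"
  have k: "k \<ge> 0"
    by (simp add: k_def)
  have r: "r > 0"
    using e k by (simp add: r_def)
  define z where "z = apex t + (m + complex_of_real r * w) * (end1 t - apex t)"
  have "z = x + complex_of_real r * (w * (end1 t - apex t))"
    by (simp add: z_def x_def algebra_simps)
  then have "dist x z = r * k"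
    using r by (simp add: dist_norm norm_mult k_def)
  also have "r * k < r * (2 * (k + 1))"
    using r k by simp
  also have "r * (2 * (k + 1)) = min e 1"
    using k by (simp add: r_def)
  finally have d: "dist x z < e" "dist x z \<le> 1"
    by auto
  obtain u where u: "u \<in> T" "z \<in> triangle u"
    using cover by blast
  have "z \<notin> triangle t"
    using out[OF r] by (simp add: z_def)
  then have "u \<noteq> t" "z \<in> triangle u \<inter> cball x 1"
    using u d by auto
  then have "u \<in> ?N"
    using u(1) by blast
  moreover have "z \<notin> (\<Union>u\<in>?N. triangle u)"
    using subsetD[OF e(2), of z] d(1) by simp
  ultimately show False
    using u by blast
qed

lemma shared_side:
  assumes t: "t \<in> T" and u: "u \<in> T" "u \<noteq> t" and z: "z \<in> triangle t"
    "z \<in> triangle u" "z \<notin> vertices t"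
  shows "\<exists>e\<in>sides t. e \<in> sides u \<and> z \<in> seg e"
proof -
  have "meet_side_to_side t u"
    using correct t u by (simp add: correct_tiling_def)
  moreover have zz: "z \<in> triangle t \<inter> triangle u"
    using z by blast
  then have "triangle t \<inter> triangle u \<noteq> {}"
    by blast
  moreover have "triangle t \<inter> triangle u \<noteq> {v}" if "v \<in> vertices t \<inter> vertices u" for v
    using zz z(3) that by (metis IntD1 singletonD)
  ultimately have "\<exists>e\<in>sides t. \<exists>f\<in>sides u. seg e = seg f \<and>
    triangle t \<inter> triangle u = seg e"
    unfolding meet_side_to_side_def by metis
  then obtain e f where ef: "e \<in> sides t" "f \<in> sides u" "seg e = seg f"
    "triangle t \<inter> triangle u = seg e"
    by blast
  have "\<forall>t\<in>T. \<forall>u\<in>T. \<forall>e\<in>sides t. \<forall>f\<in>sides u. seg e = seg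
    f \<longrightarrow> e = f"
    using correct unfolding correct_tiling_def by (elim conjE)
  then have "e = f"
    using t u(1) ef(1-3) by blast
  then show ?thesis
    using z(1,2) ef by blast
qed

lemma colors_differ:
  assumes "t \<in> T" "u \<in> T" "u \<noteq> t" "e \<in> sides t" "e \<in> sides u"
  shows "tile_color u \<noteq> tile_color t"
proof -
  have "sides u \<inter> sides t \<noteq> {}"
    using assms by blast
  then show ?thesis
    using correct assms(1-3) by (simp add: correct_tiling_def)
qed

text \<open>The midpoint of \<open>e\<close> is approached from outside. It is not a vertex and lies
  on no other side of \<open>t\<close>, so the other tile found there shares exactly
  \<open>e\<close>.\<close>

lemma neighbour_across:
  assumes t: "t \<in> T" and e: "e \<in> sides t"
  shows "\<exists>u\<in>T. u \<noteq> t \<and> e \<in> sides u"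
proof -
  note tt = tile[OF t]
  have gen: "\<exists>u\<in>T. u \<noteq> t \<and> e \<in> sides u"
    if m: "0 \<le> Re m" "0 \<le> Im m" "Re m + Im m \<le> 1" "m \<notin> {0, 1, \<i>}"
      and out: "\<And>r. (0::real) < r \<Longrightarrow> \<not> (0 \<le> Re (m + complex_of_real r * w)
        \<and> 0 \<le> Im (m + complex_of_real r * w) \<and>
          Re (m + complex_of_real r * w) + Im (m + complex_of_real r * w) \<le> 1)"
      and only: "\<And>e'. e' \<in> sides t \<Longrightarrow> apex t + m * (end1 t - apex t) \<in> seg
        e' \<Longrightarrow> e' = e" for m w
  proof -
    let ?x = "apex t + m * (end1 t - apex t)"
    have "\<exists>u\<in>T. u \<noteq> t \<and> ?x \<in> triangle u"
    proof (rule boundary_point_shared[OF t, of m w])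
      fix r :: real assume "r > 0"
      then show "apex t + (m + complex_of_real r * w) * (end1 t - apex t) \<notin> triangle t"
        using out unfolding triangle_iff[OF tt] tile_coord_add[OF tt] by blast
    qed
    then obtain u where u: "u \<in> T" "u \<noteq> t" "?x \<in> triangle u"
      by blast
    have "?x \<in> triangle t"
      unfolding triangle_iff[OF tt] tile_coord_add[OF tt] using m by blast
    moreover have "?x \<notin> vertices t"
    proof
      assume "?x \<in> vertices t"
      then have "?x \<in> {apex t + 0 * (end1 t - apex t), apex t + 1 * (end1 t - apex t), apex t +
        \<i> * (end1 t - apex t)}"
        using end2_eq[OF tt] by (auto simp: vertices_def)
      then show False
        using m(4) tile_coord_add[OF tt] by (metis insertE insertI1 insertI2 empty_iff)
    qed
    ultimately obtain e' where "e' \<in> sides t" "e' \<in> sides u" "?x \<in> seg e'"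
      using shared_side[OF t u(1,2) _ u(3)] by blast
    then show ?thesis
      using only u by blast
  qed
  consider "e = leg1 t" | "e = leg2 t" | "e = hyp t"
    using e by (auto simp: sides_def)
  then show ?thesis
  proof cases
    case 1
    have "e' = e" if "e' \<in> sides t" "apex t + (1/2) * (end1 t - apex t) \<in> seg e'" for e'
      using that seg_coord[OF tt, of "apex t + (1/2) * (end1 t - apex t)"] 1
      unfolding tile_coord_add[OF tt] by (auto simp: sides_def)
    then show ?thesis
      by (intro gen[of "1/2" "- \<i>"]) (auto simp: complex_eq_iff)
  next
    case 2
    have "e' = e" if "e' \<in> sides t" "apex t + (\<i>/2) * (end1 t - apex t) \<in> seg e'" for e'
      using that seg_coord[OF tt, of "apex t + (\<i>/2) * (end1 t - apex t)"] 2
      unfolding tile_coord_add[OF tt] by (auto simp: sides_def)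
    then show ?thesis
      by (intro gen[of "\<i>/2" "- 1"]) (auto simp: complex_eq_iff)
  next
    case 3
    have "e' = e" if "e' \<in> sides t" "apex t + (1/2 + \<i>/2) * (end1 t - apex t) \<in> seg e'" for e'
      using that seg_coord[OF tt, of "apex t + (1/2 + \<i>/2) * (end1 t - apex t)"] 3
      unfolding tile_coord_add[OF tt] by (auto simp: sides_def)
    then show ?thesis
      by (intro gen[of "1/2 + \<i>/2" "1"]) (auto simp: complex_eq_iff)
  qed
qed

end

section \<open>Crossings\<close>

lemma entering_ray:
  assumes "entering v d e" "d \<noteq> 0"
  shows "e = ray v (src e) (False, arrow_color e)" "sgn (src e - v) = sgn d"
  using assms by (auto simp: entering_def ray_def sgn_mult sgn_of_real intro!: arrow.equality)

lemma leaving_ray: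
  assumes "leaving v d e" "d \<noteq> 0"
  shows "e = ray v (tgt e) (True, arrow_color e)" "sgn (tgt e - v) = sgn d"
  using assms by (auto simp: leaving_def ray_def sgn_mult sgn_of_real intro!: arrow.equality)

text \<open>A C4 crossing is the restriction of \<open>pattern\<close> to the four quarter turns,
  which lets both crossing types be treated alike. \<open>Y r\<close> is the far endpoint of the
  arrow in relative direction \<open>r\<close>.\<close>

lemma C4_rays:
  assumes "C4_perpendiculars v K P Q"
  shows "\<exists>u c p Y. cmod u = 1 \<and> (\<forall>r\<in>quarter_turns 1. sgn (Y r - v) = r * u) \<and>
     K = (\<lambda>r. ray v (Y r) (pattern c p r)) ` quarter_turns 1 \<and>
     P = ray v (Y \<i>) (pattern c p \<i>) \<and> Q = ray v (Y (- \<i>)) (pattern c p (- \<i>))"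
proof -
  obtain d a b where ax: "d \<noteq> 0" "entering v (- d) a" "leaving v d b" "arrow_color a = arrow_color b"
     "entering v (\<i> * d) P" "entering v (- \<i> * d) Q"
       "arrow_color P \<noteq> arrow_color Q" and K: "K = {a, b, P, Q}"
    using assms by (auto simp: C4_perpendiculars_def axis_with_perpendiculars_def)
  define Y where "Y r = (if r = 1 then tgt b else if r = -1 then src a else
    if r = \<i> then src P else src Q)" for r
  define u c p where "u = sgn d" and "c = arrow_color b" and "p = arrow_color P"
  have Q: "arrow_color Q = opp p"
    using ax(7) by (simp add: p_def color_neq_iff)
  have nz: "- d \<noteq> 0" "\<i> * d \<noteq> 0" "- \<i> * d \<noteq> 0"
    using ax(1) by auto
  note rays = entering_ray[OF ax(2) nz(1)] leaving_ray[OF ax(3,1)] entering_ray[OF ax(5) nz(2)]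
    entering_ray[OF ax(6) nz(3)]
  have "cmod u = 1"
    using ax(1) by (simp add: u_def norm_sgn)
  moreover have "\<forall>r\<in>quarter_turns 1. sgn (Y r - v) = r * u"
    using rays(2,4,6,8) by (auto simp: quarter_turns_def Y_def u_def sgn_mult sgn_minus sgn_eq[of "\<i>"])
  moreover have eqs: "a = ray v (Y (-1)) (pattern c p (-1))" "b = ray v (Y 1) (pattern c p 1)"
    "P = ray v (Y \<i>) (pattern c p \<i>)" "Q = ray v (Y (- \<i>)) (pattern c p (- \<i>))"
    using rays(1,3,5,7) ax(4) Q by (simp_all add: Y_def c_def p_def)
  moreover have "K = (\<lambda>r. ray v (Y r) (pattern c p r)) ` quarter_turns 1"
    unfolding K quarter_turns_def image_insert image_empty mult_1_right eqs(1,2)[symmetric]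
      eqs(3,4)[symmetric] by auto
  ultimately show ?thesis
    by blast
qed

lemma cis_eighth: "cis (pi / 4) = eighth" "cis (- pi / 4) = - \<i> * eighth"
  by (auto simp: complex_eq_iff eighth_def cos_45 sin_45 real_div_sqrt field_simps)

lemma C8_rays:
  assumes "type_C8 v K"
  shows "\<exists>u c p Y. cmod u = 1 \<and> (\<forall>r\<in>quarter_turns 1 \<union> quarter_turns
    eighth. sgn (Y r - v) = r * u) \<and>
     K = (\<lambda>r. ray v (Y r) (pattern c p r)) ` (quarter_turns 1 \<union> quarter_turns eighth)"
proof -
  obtain d a b P Q l r l' r' where ax: "d \<noteq> 0" "entering v (- d) a" "leaving v d b"
    "arrow_color a = arrow_color b"
     "entering v (\<i> * d) P" "entering v (- \<i> * d) Q" "arrow_color P \<noteq> arrow_color Q"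
     "leaving v (cis (- pi / 4) * (\<i> * d)) l" "arrow_color l = Red"
     "leaving v (cis (pi / 4) * (\<i> * d)) r" "arrow_color r = Green"
     "leaving v (cis (- pi / 4) * (- \<i> * d)) l'" "arrow_color l' = Red"
     "leaving v (cis (pi / 4) * (- \<i> * d)) r'" "arrow_color r' = Green"
    and K: "K = {a, b, P, Q, l, r, l', r'}"
    using assms unfolding type_C8_def axis_with_perpendiculars_def by blast
  define Y where "Y x = (if x = 1 then tgt b else if x = -1 then src a else
    if x = \<i> then src P else if x = - \<i> then src Q
    else if x = eighth then tgt l else if x = \<i> * eighth then tgt r else
      if x = - eighth then tgt l' else tgt r')" for x
  define u c p where "u = sgn d" and "c = arrow_color b" and "p = arrow_color P"
  have Q: "arrow_color Q = opp p"
    using ax(7) by (simp add: p_def color_neq_iff)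
  have cis: "cis (- pi / 4) * (\<i> * d) = eighth * d" "cis (pi / 4) * (\<i> * d) = \<i> * eighth * d"
    "cis (- pi / 4) * (- \<i> * d) = - eighth * d" "cis (pi / 4) * (- \<i> * d) = - \<i> * eighth * d"
    unfolding cis_eighth by (simp_all add: mult_ac)
  have nz: "- d \<noteq> 0" "\<i> * d \<noteq> 0" "- \<i> * d \<noteq> 0" "eighth * d \<noteq> 0"
    "\<i> * eighth * d \<noteq> 0" "- eighth * d \<noteq> 0" "- \<i> * eighth * d \<noteq> 0"
    using ax(1) by auto
  note rays = entering_ray[OF ax(2) nz(1)] leaving_ray[OF ax(3,1)] entering_ray[OF ax(5) nz(2)]
    entering_ray[OF ax(6) nz(3)]
    leaving_ray[OF ax(8)[unfolded cis] nz(4)] leaving_ray[OF ax(10)[unfolded cis] nz(5)]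
    leaving_ray[OF ax(12)[unfolded cis] nz(6)] leaving_ray[OF ax(14)[unfolded cis] nz(7)]
  have ne: "- (\<i> * eighth) \<noteq> 1" "- (\<i> * eighth) \<noteq> -1"
    "- (\<i> * eighth) \<noteq> \<i>" "- (\<i> * eighth) \<noteq> - \<i>"
    "- (\<i> * eighth) \<noteq> eighth" "- (\<i> * eighth) \<noteq> - eighth"
      "- (\<i> * eighth) \<noteq> \<i> * eighth"
    "- eighth \<noteq> \<i> * eighth"
    by (auto simp: eighth_def complex_eq_iff)
  have Ys: "Y 1 = tgt b" "Y (-1) = src a" "Y \<i> = src P" "Y (- \<i>) = src Q" "Y eighth = tgt l"
    "Y (\<i> * eighth) = tgt r"
    "Y (- eighth) = tgt l'" "Y (- (\<i> * eighth)) = tgt r'"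
    by (simp_all add: Y_def ne)
  have "cmod u = 1"
    using ax(1) by (simp add: u_def norm_sgn)
  moreover have "\<forall>r\<in>quarter_turns 1 \<union> quarter_turns eighth. sgn (Y r - v) = r * u"
    unfolding quarter_turns_def using rays(2,4,6,8,10,12,14,16)
    by (simp add: Ys u_def sgn_mult sgn_minus sgn_eq[of "\<i>"] sgn_eq[of eighth])
  moreover have eqs: "a = ray v (Y (-1)) (pattern c p (-1))" "b = ray v (Y 1) (pattern c p 1)"
    "P = ray v (Y \<i>) (pattern c p \<i>)" "Q = ray v (Y (- \<i>)) (pattern c p (- \<i>))"
    "l = ray v (Y eighth) (pattern c p eighth)" "r = ray v (Y (\<i> * eighth)) (pattern c p (\<i> * eighth))"
    "l' = ray v (Y (- eighth)) (pattern c p (- eighth))"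
      "r' = ray v (Y (- (\<i> * eighth))) (pattern c p (- (\<i> * eighth)))"
    using rays(1,3,5,7,9,11,13,15) ax(4,9,11,13,15) Q by (simp_all add: Ys c_def p_def)
  moreover have "K = (\<lambda>r. ray v (Y r) (pattern c p r)) ` (quarter_turns 1 \<union>
    quarter_turns eighth)"
    unfolding K quarter_turns_def image_Un image_insert image_empty mult_1_right eqs[symmetric] by auto
  ultimately show ?thesis
    by blast
qed

text \<open>The crossing has one arrow in each direction, so the direction determines the far
  endpoint, the orientation and the color.\<close>

lemma ray_in_image:
  assumes "ray v y g \<in> (\<lambda>r. ray v (Y r) (pattern c p r)) ` D" "y \<noteq> v"
    "\<forall>r\<in>D. sgn (Y r - v) = r * u" "cmod u = 1" "0 \<notin> D"
  shows "sgn (y - v) / u \<in> D" "y = Y (sgn (y - v) / u)" "g = pattern c p (sgn (y - v) / u)"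
proof -
  obtain r where r: "r \<in> D" "ray v y g = ray v (Y r) (pattern c p r)"
    using assms(1) by blast
  have nz: "u \<noteq> 0" "r \<noteq> 0"
    using assms(4,5) r(1) by auto
  have sr: "sgn (Y r - v) = r * u"
    using assms(3) r(1) by blast
  then have "Y r \<noteq> v"
    using nz by auto
  then have eq: "y = Y r" "g = pattern c p r"
    using ray_inject[OF r(2) assms(2)] by auto
  have "sgn (y - v) / u = r"
    using sr nz by (simp add: eq)
  then show "sgn (y - v) / u \<in> D" "y = Y (sgn (y - v) / u)" "g = pattern c p (sgn (y - v) / u)"
    using eq r(1) by simp_all
qed

lemma zero_notin_quarter_turns: "w \<noteq> 0 \<Longrightarrow> 0 \<notin> quarter_turns w"
  by (auto simp: quarter_turns_def)

lemma zero_notin_directions: "0 \<notin> quarter_turns 1"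
  "0 \<notin> quarter_turns 1 \<union> quarter_turns eighth"
  by (simp_all add: zero_notin_quarter_turns)

lemma quarter_turns_disjoint: "x \<in> quarter_turns 1 \<Longrightarrow> x \<notin> quarter_turns eighth"
  by (auto simp: quarter_turns_def eighth_def complex_eq_iff)

lemma eighth_mult_directions:
  assumes "r \<in> quarter_turns 1 \<union> quarter_turns eighth"
  shows "eighth * r \<in> quarter_turns 1 \<union> quarter_turns eighth"
proof -
  have "r \<in> quarter_turns 1 \<Longrightarrow> eighth * r \<in> quarter_turns eighth"
    using quarter_turns_mult[of r 1 eighth] by simp
  moreover have "\<i> \<in> quarter_turns 1"
    by (simp add: quarter_turns_def)
  then have "r \<in> quarter_turns eighth \<Longrightarrow> eighth * r \<in> quarter_turns 1"
    using quarter_turns_mult[of r eighth eighth] quarter_turns_trans unfolding eighth_mult_self by blast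
  ultimately show ?thesis
    using assms by blast
qed

section \<open>Vertices and neighbours in the given tiling\<close>

context geometric_tiling
begin

lemma side_in_crossing: "t \<in> T \<Longrightarrow> e \<in> sides t \<Longrightarrow> src e = v \<or>
  tgt e = v \<Longrightarrow> e \<in> crossing T v"
  by (auto simp: crossing_def)

lemma vertex_type:
  assumes "t \<in> T" "v \<in> vertices t"
  shows "type_C4 v (crossing T v) \<or> type_C8 v (crossing T v)"
proof -
  have "\<forall>t\<in>T. \<forall>v\<in>vertices t. type_C4 v (crossing T v) \<or> type_C8 v (crossing T v)"
    using correct unfolding correct_tiling_def by (elim conjE)
  then show ?thesis
    using assms by blast
qed

lemma tile_rays:
  assumes "t \<in> T"
  shows "\<exists>g. leg1 t = ray (apex t) (end1 t) g \<and> ray (apex t) (end1 t) g \<in> crossing T (apex t)"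
    "\<exists>g. leg2 t = ray (apex t) (end2 t) g \<and> ray (apex t) (end2 t) g \<in> crossing T (apex t)"
    "\<exists>g. leg1 t = ray (end1 t) (apex t) g \<and> ray (end1 t) (apex t) g \<in> crossing T (end1 t)"
    "\<exists>g. hyp t = ray (end1 t) (end2 t) g \<and> ray (end1 t) (end2 t) g \<in> crossing T (end1 t)"
    "\<exists>g. leg2 t = ray (end2 t) (apex t) g \<and> ray (end2 t) (apex t) g \<in> crossing T (end2 t)"
    "\<exists>g. hyp t = ray (end2 t) (end1 t) g \<and> ray (end2 t) (end1 t) g \<in> crossing T (end2 t)"
proof -
  have j: "joins (leg1 t) (apex t) (end1 t)" "joins (leg2 t) (apex t) (end2 t)"
    "joins (hyp t) (end1 t) (end2 t)"
    "joins (leg1 t) (end1 t) (apex t)" "joins (leg2 t) (end2 t) (apex t)" "joins (hyp t) (end2 t) (end1 t)"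
    using tile[OF assms] by (auto simp: triangle_tile_def joins_def)
  have gen: "\<exists>g. e = ray x y g \<and> ray x y g \<in> crossing T x" if "joins e x y"
    "e \<in> sides t" for e x y
  proof -
    have "e \<in> crossing T x"
      using side_in_crossing[OF assms that(2)] that(1) by (auto simp: joins_def)
    then show ?thesis
      using that(1) unfolding joins_ray by blast
  qed
  show "\<exists>g. leg1 t = ray (apex t) (end1 t) g \<and> ray (apex t) (end1 t) g \<in> crossing T (apex t)"
    "\<exists>g. leg2 t = ray (apex t) (end2 t) g \<and> ray (apex t) (end2 t) g \<in> crossing T (apex t)"
    "\<exists>g. leg1 t = ray (end1 t) (apex t) g \<and> ray (end1 t) (apex t) g \<in> crossing T (end1 t)"
    "\<exists>g. hyp t = ray (end1 t) (end2 t) g \<and> ray (end1 t) (end2 t) g \<in> crossing T (end1 t)"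
    "\<exists>g. leg2 t = ray (end2 t) (apex t) g \<and> ray (end2 t) (apex t) g \<in> crossing T (end2 t)"
    "\<exists>g. hyp t = ray (end2 t) (end1 t) g \<and> ray (end2 t) (end1 t) g \<in> crossing T (end2 t)"
    by (rule gen[OF j(1)] gen[OF j(2)] gen[OF j(3)] gen[OF j(4)] gen[OF j(5)] gen[OF j(6)], simp add:
      sides_def)+
qed

text \<open>The eight directions are closed under turning by 45 degrees, so some arrow would start
  along the bisector of the right angle and run into the interior of \<open>t\<close>.\<close>

lemma apex_not_C8:
  assumes t: "t \<in> T"
  shows "\<not> type_C8 (apex t) (crossing T (apex t))"
proof
  note tt = tile[OF t]
  let ?v = "apex t" and ?d = "end1 t - apex t" and ?D = "quarter_turns 1 \<union> quarter_turns eighth"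
  assume C8: "type_C8 ?v (crossing T ?v)"
  obtain u c p Y where u: "cmod u = 1" "\<forall>r\<in>?D. sgn (Y r - ?v) = r * u"
    and K: "crossing T ?v = (\<lambda>r. ray ?v (Y r) (pattern c p r)) ` ?D"
    using C8_rays[OF C8] by (elim exE conjE) (rule that)
  obtain g where g: "ray ?v (end1 t) g \<in> crossing T ?v"
    using tile_rays(1)[OF t] by blast
  define r where "r = sgn ?d / u"
  have "r \<in> ?D"
    using ray_in_image(1)[OF g[unfolded K] _ u(2,1) zero_notin_directions(2)] tile_distinct(1)[OF tt]
      by (simp add: r_def)
  then have r: "eighth * r \<in> ?D"
    by (rule eighth_mult_directions)
  define y where "y = Y (eighth * r)"
  have "ray ?v y (pattern c p (eighth * r)) \<in> crossing T ?v"
    unfolding K y_def using r by (rule imageI)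
  then obtain x where x: "x \<in> T" "ray ?v y (pattern c p (eighth * r)) \<in> sides x"
    unfolding crossing_def by blast
  have sy: "sgn (y - ?v) = eighth * sgn ?d"
    using u r by (auto simp: y_def r_def)
  then have ny: "y \<noteq> ?v"
    using tile_distinct(1)[OF tt] by (auto simp: sgn_zero_iff)
  define q where "q = cmod (y - ?v) / cmod ?d"
  have q: "q > 0"
    using ny tile_distinct(1)[OF tt] by (simp add: q_def)
  have "y - ?v = complex_of_real (cmod (y - ?v)) * (eighth * sgn ?d)"
    using sy ny by (simp add: sgn_eq[of "y - ?v"] field_simps)
  then have yq: "y - ?v = (complex_of_real q * eighth) * ?d"
    using tile_distinct(1)[OF tt] by (simp add: sgn_eq q_def mult.assoc)
  \<comment> \<open>\<open>q\<close> is the length of the arrow relative to the leg of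
    \<open>t\<close>. The point \<open>z\<close> at the fraction \<open>k\<close> of the arrow has
    both coordinates \<open>k * q / sqrt 2\<close>, and \<open>k * q <= 1 / 2\<close> keeps their
    sum below 1.\<close>
  define k where "k = min 1 (1 / (2 * q))"
  have k: "0 \<le> k" "k \<le> 1" "0 < k * q" "k * q \<le> 1 / 2"
  proof -
    show "0 \<le> k" "k \<le> 1" "0 < k * q"
      using q by (auto simp: k_def)
    have "k * q \<le> 1 / (2 * q) * q"
      using q by (intro mult_right_mono) (auto simp: k_def)
    then show "k * q \<le> 1 / 2"
      using q by simp
  qed
  define z where "z = ?v + (complex_of_real (k * q) * eighth) * ?d"
  have z: "z = (1 - k) *\<^sub>R ?v + k *\<^sub>R y"
  proof -
    have "z = ?v + complex_of_real k * (y - ?v)"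
      unfolding z_def yq by simp
    then show ?thesis
      by (simp add: scaleR_conv_of_real algebra_simps)
  qed
  have "z \<in> closed_segment ?v y"
    unfolding in_segment using z k by blast
  then have zs: "z \<in> seg (ray ?v y (pattern c p (eighth * r)))"
    by (simp add: closed_segment_commute)
  have "1 < sqrt 2"
    by simp
  then have "2 * (k * q) < sqrt 2"
    using k(4) by linarith
  then have ins: "strictly_inside (tile_coord t z)"
    unfolding z_def tile_coord_add[OF tt] strictly_inside_def using k(3)
    by (simp add: eighth_def divide_simps)
  have "x = t"
    using strictly_inside_eq[OF t x(1) ins] seg_subset_triangle[OF tile[OF x(1)] x(2)] zs by blast
  then show False
    using strictly_inside_not_side[OF tt] x(2) zs ins by blast
qed

text \<open>Leg and hypotenuse enclose 45 degrees at an acute vertex, but the arrows of a C4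
  crossing are quarter turns of each other.\<close>

lemma end_not_C4:
  assumes t: "t \<in> T" and v: "v \<in> {end1 t, end2 t}"
  shows "\<not> type_C4 v (crossing T v)"
proof
  note tt = tile[OF t]
  assume "type_C4 v (crossing T v)"
  then obtain P Q where C4: "C4_perpendiculars v (crossing T v) P Q"
    unfolding type_C4_def by blast
  obtain u c p Y where u: "cmod u = 1" "\<forall>r\<in>quarter_turns 1. sgn (Y r - v) = r * u"
    and K: "crossing T v = (\<lambda>r. ray v (Y r) (pattern c p r)) ` quarter_turns 1"
    using C4_rays[OF C4] by (elim exE conjE) (rule that)
  have dir: "sgn (y - v) / u \<in> quarter_turns 1" if "ray v y g \<in> crossing T v" "y \<noteq> v" for y g
    using ray_in_image(1)[OF that(1)[unfolded K] that(2) u(2,1) zero_notin_directions(1)] .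
  obtain x where "sgn (apex t - v) / u \<in> quarter_turns 1" "sgn (x - v) / u \<in> quarter_turns 1"
    "x - v = (1 - \<i>) * (apex t - v) \<or> x - v = (1 + \<i>) * (apex t - v)"
  proof (cases "v = end1 t")
    case True
    then show ?thesis
      using that[of "end2 t"] dir tile_rays(3,4)[OF t] end2_from_end1[OF tt] tile_distinct[OF tt] by metis
  next
    case False
    then have "v = end2 t"
      using v by simp
    then show ?thesis
      using that[of "end1 t"] dir tile_rays(5,6)[OF t] end1_from_end2[OF tt] tile_distinct[OF tt] by metis
  qed
  then have a: "sgn (apex t - v) / u \<in> quarter_turns 1" and x: "sgn (x - v) / u \<in> quarter_turns 1"
    "sgn (x - v) = - \<i> * (eighth * sgn (apex t - v)) \<or> sgn (x - v) = eighth * sgn (apex t - v)"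
    by (auto simp: sgn_mult sgn_one_plus_i sgn_one_minus_i)
  have "eighth * (sgn (apex t - v) / u) \<in> quarter_turns (eighth * 1)"
    using quarter_turns_mult[OF a] .
  then have "eighth * (sgn (apex t - v) / u) \<in> quarter_turns eighth"
    by simp
  moreover from this have "- (\<i> * (eighth * (sgn (apex t - v) / u))) \<in> quarter_turns eighth"
    by (simp only: quarter_turns_i)
  ultimately have "sgn (x - v) / u \<in> quarter_turns eighth"
    using x(2) by (elim disjE) simp_all
  then show False
    using quarter_turns_disjoint x(1) by blast
qed

text \<open>Right angles occur only at C4 crossings and acute angles only at C8 crossings, so no
  point is the vertex of both.\<close>

lemma neighbour_apex:
  assumes "t \<in> T" "u \<in> T" "apex t \<in> vertices u"
  shows "apex t = apex u"
  using assms end_not_C4[OF assms(2)] apex_not_C8[OF assms(1)] vertex_type[of t "apex t"]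
  by (auto simp: vertices_def)

lemma neighbour_end:
  assumes "t \<in> T" "u \<in> T" "v \<in> {end1 t, end2 t}" "v \<in> vertices u"
  shows "v \<in> {end1 u, end2 u}"
proof (rule ccontr)
  assume "v \<notin> {end1 u, end2 u}"
  then have "v = apex u"
    using assms(4) by (auto simp: vertices_def)
  then show False
    using assms end_not_C4[OF assms(1,3)] apex_not_C8[OF assms(2)] vertex_type[of u v] by simp
qed

text \<open>Tiles with a common side agree about which of its ends is a right angle, so legs meet
  legs and hypotenuses meet hypotenuses. The counterclockwise order then leaves one position
  different from \<open>t\<close> across each side.\<close>

sublocale matched_tiles s T
proof
  show "triangle_tile s t" if "t \<in> T" for t
    using tile that .
  show "t = u" if "t \<in> T" "u \<in> T" "apex t = apex u" "end1 t = end1 u" for t u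
    using unique that .
  fix t assume t: "t \<in> T"
  note tt = tile[OF t]
  have side: "\<exists>u\<in>T. u \<noteq> t \<and> e \<in> sides u \<and>
    tile_color u \<noteq> tile_color t \<and> src e \<in> vertices u \<and> tgt e \<in> vertices u"
    if e: "e \<in> sides t" for e
  proof -
    obtain u where u: "u \<in> T" "u \<noteq> t" "e \<in> sides u"
      using neighbour_across[OF t e] by blast
    moreover have "src e \<in> vertices u" "tgt e \<in> vertices u"
      using tile[OF u(1)] u(3) by (auto simp: sides_def triangle_tile_def joins_def vertices_def)
    ultimately show ?thesis
      using colors_differ[OF t u(1,2) e u(3)] by blast
  qed
  show "\<exists>u\<in>T. apex u = apex t \<and> end1 u = end2 t \<and> leg1 u = leg2 t \<and>
    tile_color u \<noteq> tile_color t"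
  proof -
    have j: "joins (leg2 t) (apex t) (end2 t)"
      using tt by (simp add: triangle_tile_def)
    have "leg2 t \<in> sides t"
      by (simp add: sides_def)
    then obtain u where u: "u \<in> T" "u \<noteq> t" "leg2 t \<in> sides u"
      "tile_color u \<noteq> tile_color t"
      "src (leg2 t) \<in> vertices u" "tgt (leg2 t) \<in> vertices u"
      using side by blast
    have vu: "apex t \<in> vertices u" "end2 t \<in> vertices u"
      using j u(5,6) by (auto simp: joins_def)
    have a: "apex t = apex u"
      using neighbour_apex[OF t u(1) vu(1)] .
    have "end2 t \<in> {end1 u, end2 u}"
      using neighbour_end[OF t u(1) _ vu(2)] by simp
    moreover have "end2 t \<noteq> end2 u"
    proof
      assume "end2 t = end2 u"
      then have "end1 t = end1 u"
        using a end1_eq[OF tt] end1_eq[OF tile[OF u(1)]] by simp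
      then show False
        using unique[OF t u(1) a] u(2) by simp
    qed
    ultimately have e: "end1 u = end2 t"
      by simp
    have "leg1 u = leg2 t"
      using u(3) j a e tile[OF u(1)] tile_distinct[OF tile[OF u(1)]]
      by (auto simp: sides_def triangle_tile_def joins_def)
    then show ?thesis
      using u a e by auto
  qed
  show "\<exists>u\<in>T. end1 u = end2 t \<and> end2 u = end1 t \<and> hyp u = hyp t \<and>
    tile_color u \<noteq> tile_color t"
  proof -
    have j: "joins (hyp t) (end1 t) (end2 t)"
      using tt by (simp add: triangle_tile_def)
    have "hyp t \<in> sides t"
      by (simp add: sides_def)
    then obtain u where u: "u \<in> T" "u \<noteq> t" "hyp t \<in> sides u" "tile_color u \<noteq> tile_color t"
      "src (hyp t) \<in> vertices u" "tgt (hyp t) \<in> vertices u"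
      using side by blast
    have "end1 t \<in> vertices u" "end2 t \<in> vertices u"
      using j u(5,6) by (auto simp: joins_def)
    then have e: "end1 t \<in> {end1 u, end2 u}" "end2 t \<in> {end1 u, end2 u}"
      using neighbour_end[OF t u(1)] by auto
    have "end1 t \<noteq> end1 u"
    proof
      assume eq: "end1 t = end1 u"
      then have "end2 t = end2 u"
        using e tile_distinct(3)[OF tt] by auto
      then have "apex t = apex u"
        using eq by (simp only: apex_eq[OF tt] apex_eq[OF tile[OF u(1)]])
      then show False
        using unique[OF t u(1)] eq u(2) by simp
    qed
    then have e: "end1 u = end2 t" "end2 u = end1 t"
      using e tile_distinct(3)[OF tt] by auto
    have "hyp u = hyp t"
      using u(3) j e tile[OF u(1)] tile_distinct[OF tile[OF u(1)]]
      by (auto simp: sides_def triangle_tile_def joins_def)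
    then show ?thesis
      using u e by auto
  qed
qed

end

context geometric_tiling
begin

text \<open>By the counterclockwise order the tile is to the left of \<open>leg1\<close> directed
  away from the apex, hence to the right of \<open>leg1\<close> entering the apex, where condition
  (4) demands green.\<close>

lemma red_leg1_not_perpendicular:
  assumes t: "t \<in> T" "tile_color t = Red"
    and PQ: "C4_perpendiculars (apex t) (crossing T (apex t)) P Q"
    and leg: "leg1 t \<in> {P, Q}" "leg1 t = ray (apex t) (end1 t) (False, c)"
  shows False
proof -
  note tt = tile[OF t(1)]
  have "Im (cnj (tgt (leg1 t) - src (leg1 t)) * (z - src (leg1 t))) \<le> 0" if "z \<in> triangle t" for z
  proof -
    define w where "w = tile_coord t z"
    define d where "d = end1 t - apex t"
    have z: "z = apex t + w * d"
      using tile_coord_inverse[OF tt, of z] by (simp add: w_def d_def)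
    have "tgt (leg1 t) - src (leg1 t) = - d" "z - src (leg1 t) = (w - 1) * d"
      using leg(2) z by (simp_all add: d_def algebra_simps)
    then have "cnj (tgt (leg1 t) - src (leg1 t)) * (z - src (leg1 t)) = - ((w - 1) * (d * cnj d))"
      by (simp add: mult_ac)
    also have "\<dots> = - ((w - 1) * complex_of_real ((cmod d)\<^sup>2))"
      unfolding complex_norm_square ..
    finally have "Im (cnj (tgt (leg1 t) - src (leg1 t)) * (z - src (leg1 t))) = - (Im w * (cmod d)\<^sup>2)"
      by simp
    moreover have "0 \<le> Im w"
      using that triangle_iff[OF tt, of z] by (simp add: w_def)
    ultimately show ?thesis
      by simp
  qed
  then have "lies_right (leg1 t) t"
    by (simp add: lies_right_def sides_def)
  moreover have "\<forall>v p q. C4_perpendiculars v (crossing T v) p q \<longrightarrow>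
        (\<forall>e\<in>{p, q}. \<forall>t\<in>T. (lies_left e t \<longrightarrow> tile_color t = Red)
          \<and> (lies_right e t \<longrightarrow> tile_color t = Green))"
    using correct unfolding correct_tiling_def by (elim conjE)
  then have "\<forall>e\<in>{P, Q}. \<forall>t\<in>T. lies_right e t \<longrightarrow> tile_color t = Green"
    using PQ by blast
  ultimately have "tile_color t = Green"
    using t(1) leg(1) by blast
  then show False
    using t(2) by simp
qed

text \<open>\<open>square\<close> is the C4 rule, with condition (4) putting \<open>leg1\<close> of
  a red tile on the axis. The arrows in \<open>star\<close> come from the C8 rule; that all legs at
  the vertex are quarter turns of each other rests on the congruence of the tiles.\<close>

lemma coherent: "coherent_tiles s T"
proof unfold_locales
  fix t u assume t: "t \<in> T" and u: "u \<in> T" and red: "tile_color t = Red"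
    and a: "apex u = apex t" and opp: "end1 u = 2 * apex t - end1 t"
  note tt = tile[OF t] note ut = tile[OF u]
  let ?v = "apex t"
  have "type_C4 ?v (crossing T ?v)"
    using vertex_type[OF t, of ?v] apex_not_C8[OF t] by (simp add: vertices_def)
  then obtain P Q where C4: "C4_perpendiculars ?v (crossing T ?v) P Q"
    unfolding type_C4_def by blast
  obtain e c p Y where e: "cmod e = 1" "\<forall>r\<in>quarter_turns 1. sgn (Y r - ?v) = r * e"
    and K: "crossing T ?v = (\<lambda>r. ray ?v (Y r) (pattern c p r)) ` quarter_turns 1"
    and PQ: "P = ray ?v (Y \<i>) (pattern c p \<i>)" "Q = ray ?v (Y (- \<i>)) (pattern c p (- \<i>))"
    using C4_rays[OF C4] by (elim exE conjE) (rule that)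
  have ray: "sgn (y - ?v) / e \<in> quarter_turns 1 \<and> y = Y (sgn (y - ?v) / e) \<and>
    g = pattern c p (sgn (y - ?v) / e)"
    if "ray ?v y g \<in> crossing T ?v" "y \<noteq> ?v" for y g
    using ray_in_image[OF that(1)[unfolded K] that(2) e(2,1) zero_notin_directions(1)] by blast
  define r where "r = sgn (end1 t - ?v) / e"
  have diffs: "end2 t - ?v = \<i> * (end1 t - ?v)" "end1 u - ?v = - (end1 t - ?v)"
    "end2 u - ?v = - \<i> * (end1 t - ?v)"
    unfolding end2_eq[OF tt] end2_eq[OF ut] a opp by (simp_all add: algebra_simps)
  have dirs: "sgn (end2 t - ?v) / e = \<i> * r" "sgn (end1 u - ?v) / e = - r"
    "sgn (end2 u - ?v) / e = - (\<i> * r)"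
    unfolding diffs sgn_mult sgn_minus r_def by (simp_all add: sgn_eq[of "\<i>"])
  have leg: "leg1 t = ray ?v (end1 t) (pattern c p r)" "r \<in> quarter_turns 1" "end1 t = Y r"
    using tile_rays(1)[OF t] ray tile_distinct[OF tt] unfolding r_def by metis+
  have leg2: "leg2 t = ray ?v (end2 t) (pattern c p (\<i> * r))"
    using tile_rays(2)[OF t] ray tile_distinct[OF tt] dirs(1) by metis
  have leg3: "leg1 u = ray ?v (end1 u) (pattern c p (- r))"
    using tile_rays(1)[OF u] ray tile_distinct[OF ut] dirs(2) a by metis
  have leg4: "leg2 u = ray ?v (end2 u) (pattern c p (- (\<i> * r)))"
    using tile_rays(2)[OF u] ray tile_distinct[OF ut] dirs(3) a by metis
  consider "r = 1" | "r = -1" | "r = \<i>" | "r = - \<i>"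
    using leg(2) by (auto simp: quarter_turns_def)
  then show "\<exists>b c p. leg1 t = ray ?v (end1 t) (b, c) \<and>
    leg1 u = ray ?v (end1 u) (\<not> b, c) \<and>
             leg2 t = ray ?v (end2 t) (False, p) \<and> leg2 u = ray ?v (end2 u) (False, opp p)"
  proof cases
    case 1
    then show ?thesis
      using leg(1) leg2 leg3 leg4 by (intro exI[of _ True] exI[of _ c] exI[of _ p]) simp
  next
    \<comment> \<open>Here \<open>leg2 t\<close> lies in direction \<open>- i\<close>, where the
      pattern has the color \<open>opp p\<close>.\<close>
    case 2
    moreover have "p = opp (opp p)"
      by (cases p) auto
    ultimately show ?thesis
      using leg(1) leg2 leg3 leg4 by (intro exI[of _ False] exI[of _ c] exI[of _ "opp p"]) auto
  next
    case 3
    then have "leg1 t \<in> {P, Q}" "leg1 t = ray ?v (end1 t) (False, p)"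
      using leg(1,3) PQ by simp_all
    then show ?thesis
      using red_leg1_not_perpendicular[OF t red C4] by blast
  next
    case 4
    then have "leg1 t \<in> {P, Q}" "leg1 t = ray ?v (end1 t) (False, opp p)"
      using leg(1,3) PQ by simp_all
    then show ?thesis
      using red_leg1_not_perpendicular[OF t red C4] by blast
  qed
next
  fix t v assume t: "t \<in> T" and v: "v \<in> {end1 t, end2 t}"
  let ?D = "quarter_turns 1 \<union> quarter_turns eighth"
  have C8: "type_C8 v (crossing T v)"
    using vertex_type[OF t, of v] end_not_C4[OF t v] v by (auto simp: vertices_def)
  obtain e c p Y where e: "cmod e = 1" "\<forall>r\<in>?D. sgn (Y r - v) = r * e"
    and K: "crossing T v = (\<lambda>r. ray v (Y r) (pattern c p r)) ` ?D"
    using C8_rays[OF C8] by (elim exE conjE) (rule that)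
  have e0: "e \<noteq> 0"
    using e(1) by auto
  have ray: "sgn (y - v) / e \<in> ?D \<and> y = Y (sgn (y - v) / e) \<and> g = pattern c p (sgn (y - v) / e)"
    if "ray v y g \<in> crossing T v" "y \<noteq> v" for y g
    using ray_in_image[OF that(1)[unfolded K] that(2) e(2,1) zero_notin_directions(2)] by blast
  have star: "star_tile v e c p m" if m: "m \<in> T" for m
  proof -
    note mt = tile_distinct[OF tile[OF m]]
    have "leg1 m = ray v (apex m) (pattern c p (sgn (apex m - v) / e))" if "end1 m = v"
      using tile_rays(3)[OF m] ray mt that by metis
    moreover have "hyp m = ray v (end2 m) (pattern c p (sgn (end2 m - v) / e))" if "end1 m = v"
      using tile_rays(4)[OF m] ray mt that by metis
    moreover have "leg2 m = ray v (apex m) (pattern c p (sgn (apex m - v) / e))" if "end2 m = v"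
      using tile_rays(5)[OF m] ray mt that by metis
    moreover have "hyp m = ray v (end1 m) (pattern c p (sgn (end1 m - v) / e))" if "end2 m = v"
      using tile_rays(6)[OF m] ray mt that by metis
    ultimately show ?thesis
      unfolding star_tile_def Let_def by blast
  qed
  have dir: "sgn (apex m - v) / e \<in> ?D" "apex m = Y (sgn (apex m - v) / e)" if m: "m \<in> T"
    "v \<in> {end1 m, end2 m}" for m
  proof -
    have "\<exists>g. ray v (apex m) g \<in> crossing T v"
      using tile_rays(3,5)[OF m(1)] m(2) by blast
    moreover have "apex m \<noteq> v"
      using tile_distinct[OF tile[OF m(1)]] m(2) by auto
    ultimately show "sgn (apex m - v) / e \<in> ?D" "apex m = Y (sgn (apex m - v) / e)"
      using ray by blast+
  qed
  obtain y where y: "y \<in> T" "end1 y = v"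
    using t v leg_neighbour[OF t] by auto
  define ry where "ry = sgn (apex y - v) / e"
  have s: "s > 0"
    using cmod_leg(3)[OF tile[OF t]] .
  (* A leg half a right angle off would point along the hypotenuse of a tile obtained by turning y. *)
  have aligned: "sgn (apex m - v) / e \<in> quarter_turns ry" if m: "m \<in> T" "v \<in> {end1 m, end2 m}" for m
  proof (rule ccontr)
    define rm where "rm = sgn (apex m - v) / e"
    assume "sgn (apex m - v) / e \<notin> quarter_turns ry"
    then have no: "rm \<notin> quarter_turns ry"
      by (simp add: rm_def)
    have D: "rm \<in> ?D" "ry \<in> ?D"
      using dir(1)[OF m] dir(1)[OF y(1)] y(2) by (auto simp: rm_def ry_def)
    have ei: "eighth * \<i> \<noteq> 0" "\<i> \<in> quarter_turns 1"
      by (auto simp: quarter_turns_def)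
    have "rm \<in> quarter_turns (eighth * ry)"
    proof (cases "ry \<in> quarter_turns 1")
      case True
      then have "rm \<in> quarter_turns eighth"
        using D no quarter_turns_sym quarter_turns_trans by blast
      moreover have "eighth \<in> quarter_turns (eighth * ry)"
        using quarter_turns_mult[OF quarter_turns_sym[OF True], of eighth] by simp
      ultimately show ?thesis
        by (rule quarter_turns_trans)
    next
      case False
      then have ry: "ry \<in> quarter_turns eighth"
        using D by blast
      then have "rm \<in> quarter_turns 1"
        using D no quarter_turns_sym quarter_turns_trans by blast
      moreover have "\<i> \<in> quarter_turns (eighth * ry)"
        using quarter_turns_mult[OF quarter_turns_sym[OF ry], of eighth] by (simp add: eighth_mult_self)
      ultimately show ?thesis
        using ei(2) quarter_turns_sym quarter_turns_trans by blast
    qed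
    then have "\<i> * rm \<in> quarter_turns (eighth * ry)"
      by (simp only: quarter_turns_i)
    then have "inverse eighth * (\<i> * rm) \<in> quarter_turns (inverse eighth * (eighth * ry))"
      by (rule quarter_turns_mult)
    \<comment> \<open>\<open>q\<close> is the leg direction at \<open>end1\<close> for which the
      hypotenuse points in direction \<open>rm\<close>: by \<open>end2_from_end1\<close> the
      hypotenuse is the leg times \<open>1 - i\<close>, whose direction is
      \<open>- i * eighth\<close>.\<close>
    moreover define q where "q = inverse eighth * (\<i> * rm)"
    ultimately have "q \<in> quarter_turns ry"
      by (simp add: mult.assoc[symmetric])
    then have "complex_of_real s * e * q \<in> quarter_turns (complex_of_real s * e * ry)"
      by (rule quarter_turns_mult)
    moreover have "complex_of_real s * e * ry = apex y - end1 y"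
      using cmod_leg(1)[OF tile[OF y(1)]] e0 y(2) s by (simp add: ry_def sgn_eq)
    ultimately obtain x where x: "x \<in> T" "end1 x = v" "apex x - v = complex_of_real s * e * q"
      using rotate_end1_quarter_turns[OF y(1)] y(2) by metis
    have q: "eighth * q = \<i> * rm"
      by (simp add: q_def mult.assoc[symmetric])
    have "sgn rm = rm" "sgn e = e"
      using D(1) e(1) by (auto simp: sgn_eq quarter_turns_def norm_mult)
    moreover have "sgn (complex_of_real s) = 1"
      using s by (simp add: sgn_of_real)
    moreover have "end2 x - v = (1 - \<i>) * (complex_of_real s * e * q)"
      using end2_from_end1[OF tile[OF x(1)]] x by simp
    then have "sgn (end2 x - v) = - \<i> * sgn (eighth * q) * (sgn (complex_of_real s) * sgn e)"
      by (simp only:) (simp add: sgn_mult sgn_one_minus_i sgn_eq[of eighth] mult_ac)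
    ultimately have "sgn (end2 x - v) / e = rm"
      unfolding q using e0 by (simp add: sgn_mult sgn_eq[of "\<i>"] mult.assoc[symmetric])
    \<comment> \<open>There is one arrow in direction \<open>rm\<close>, so the hypotenuse of
      \<open>x\<close> and the leg of \<open>m\<close> end at the same point, although their lengths
      are \<open>sqrt 2 * s\<close> and \<open>s\<close>.\<close>
    then have "end2 x = Y rm"
      using tile_rays(4)[OF x(1)] ray[of "end2 x"] tile_distinct(3)[OF tile[OF x(1)]] x(2) by metis
    then have "end2 x = apex m"
      using dir(2)[OF m] by (simp add: rm_def)
    then have "cmod (apex m - v) = sqrt 2 * s"
      using end2_from_end1[OF tile[OF x(1)]] x(2) cmod_leg(1)[OF tile[OF x(1)]]
      by (simp add: norm_mult cmod_one_plus_i)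
    moreover have "cmod (apex m - v) = s"
      using cmod_leg(1,2)[OF tile[OF m(1)]] m(2) by auto
    ultimately show False
      using s by simp
  qed
  have "ry \<in> ?D"
    using dir(1)[OF y(1)] y(2) by (simp add: ry_def)
  then obtain w0 where w0: "w0 \<in> {1, eighth}" "ry \<in> quarter_turns w0"
    by blast
  have "star_at T v e c p (w0 * e)"
    unfolding star_at_def
  proof (intro conjI ballI impI)
    show "cmod e = 1" "w0 * e \<in> {e, eighth * e}"
      using e(1) w0(1) by auto
    fix m assume m: "m \<in> T" "v \<in> {end1 m, end2 m}"
    show "star_tile v e c p m"
      using star m by blast
    have "sgn (apex m - v) / e \<in> quarter_turns w0"
      using aligned[OF m] w0(2) quarter_turns_trans by blast
    then show "sgn (apex m - v) \<in> quarter_turns (w0 * e)"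
      using quarter_turns_mult[of "sgn (apex m - v) / e" w0 e] e0 by (simp add: mult.commute)
  qed
  then show "\<exists>u c p w. star_at T v u c p w"
    by blast
qed

end

section \<open>Connectedness\<close>

lemma int_translates:
  fixes P :: "complex \<Rightarrow> bool"
  assumes "P a" "\<And>x. P x \<Longrightarrow> P (x + d)" "\<And>x. P x \<Longrightarrow> P (x - d)"
  shows "P (a + of_int n * d)"
proof (induction n rule: int_induct[where k = 0])
  case base
  then show ?case
    using assms(1) by simp
next
  case (step1 i)
  then show ?case
    using assms(2)[of "a + of_int i * d"] by (simp add: algebra_simps)
next
  case (step2 i)
  then show ?case
    using assms(3)[of "a + of_int i * d"] by (simp add: algebra_simps)
qed

context matched_tiles
begin

definition reachable :: "tile \<Rightarrow> tile set" where
  "reachable t = {u. (\<lambda>x y. y \<in> T \<and> adjacent x y)\<^sup>*\<^sup>* t u}"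

lemma reachable_step: "u \<in> reachable t \<Longrightarrow> x \<in> T \<Longrightarrow>
  adjacent u x \<Longrightarrow> x \<in> reachable t"
  unfolding reachable_def by (simp add: rtranclp.rtrancl_into_rtrancl)

lemma reachable_subset:
  assumes "t \<in> T" "u \<in> reachable t"
  shows "u \<in> T"
  using assms(2) unfolding reachable_def mem_Collect_eq
    by (induction rule: rtranclp_induct) (use assms(1) in auto)

lemma reachable_turn:
  assumes "t \<in> T" "u \<in> reachable t"
  shows "\<exists>x\<in>reachable t. apex x = apex u \<and> end1 x - apex u = \<i> * (end1 u - apex u)"
proof -
  have u: "u \<in> T"
    using reachable_subset assms by blast
  obtain x where x: "x \<in> T" "apex x = apex u" "end1 x = end2 u"
    using leg_neighbour[OF u] by blast
  then have "x \<in> reachable t"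
    using reachable_step[OF assms(2)] by (simp add: adjacent_def)
  then show ?thesis
    using x end2_eq[OF tile[OF u]] by (intro bexI[of _ x]) auto
qed

lemma reachable_turns:
  assumes "t \<in> T" "u \<in> reachable t" "w \<in> quarter_turns (end1 u - apex u)"
  shows "\<exists>x\<in>reachable t. apex x = apex u \<and> end1 x - apex u = w"
proof -
  obtain x where x: "x \<in> reachable t" "apex x = apex u" "end1 x - apex u = \<i> * (end1 u - apex u)"
    using reachable_turn[OF assms(1,2)] by blast
  obtain y where y: "y \<in> reachable t" "apex y = apex x" "end1 y - apex x = \<i> * (end1 x - apex x)"
    using reachable_turn[OF assms(1) x(1)] by blast
  obtain z where z: "z \<in> reachable t" "apex z = apex y" "end1 z - apex y = \<i> * (end1 y - apex y)"
    using reachable_turn[OF assms(1) y(1)] by blast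
  have y': "end1 y - apex u = - (end1 u - apex u)"
    using y(3) unfolding x(2,3) by simp
  have z': "end1 z - apex u = - (\<i> * (end1 u - apex u))"
    using z(3) unfolding y(2) x(2) y' by (simp only: mult_minus_right)
  show ?thesis
    using assms(2,3) x y(1,2) z(1,2) y' z' unfolding quarter_turns_def by (elim insertE) auto
qed

text \<open>Crossing the hypotenuse is a half turn of the tile; a half turn about the new right
  angle then restores the position up to translation.\<close>

lemma reachable_translate:
  assumes "t \<in> T" "u \<in> reachable t"
  shows "\<exists>x\<in>reachable t. apex x = apex u + (1 + \<i>) * (end1 u - apex u) \<and>
    end1 x - apex x = end1 u - apex u"
proof -
  have u: "u \<in> T"
    using reachable_subset assms by blast
  obtain x where x: "x \<in> T" "end1 x = end2 u" "end2 x = end1 u"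
    using hyp_neighbour[OF u] by blast
  have xr: "x \<in> reachable t"
    using reachable_step[OF assms(2) x(1)] x by (simp add: adjacent_def)
  have ax: "apex x = apex u + (1 + \<i>) * (end1 u - apex u)"
    unfolding apex_eq[OF tile[OF x(1)]] x(2,3) end2_eq[OF tile[OF u]] by (simp add: field_simps)
  have d: "end1 u - apex u = - (end1 x - apex x)"
    unfolding ax x(2) end2_eq[OF tile[OF u]] by (simp add: algebra_simps)
  have "end1 u - apex u \<in> quarter_turns (end1 x - apex x)"
    unfolding d by (simp add: quarter_turns_def)
  then obtain y where "y \<in> reachable t" "apex y = apex x" "end1 y - apex x = end1 u - apex u"
    using reachable_turns[OF assms(1) xr] by blast
  then show ?thesis
    using ax by (intro bexI[of _ y]) auto
qed

text \<open>Turning at the right angle before crossing a hypotenuse gives the translations by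
  \<open>(1 + i) * d\<close> times 1, \<open>i\<close>, -1 and \<open>- i\<close>. These generate
  the lattice of Gaussian integer multiples of \<open>(1 + i) * d\<close>.\<close>

lemma reachable_lattice:
  assumes t: "t \<in> T" and d: "d = end1 t - apex t" and w: "w \<in> quarter_turns d"
  shows "\<exists>u\<in>reachable t. apex u = apex t + (of_int m + of_int n * \<i>) * ((1 + \<i>) * d)
    \<and> end1 u - apex u = w"
proof -
  define P where "P a \<longleftrightarrow> (\<forall>w\<in>quarter_turns d. \<exists>u\<in>reachable
    t. apex u = a \<and> end1 u - apex u = w)" for a
  have PI: "P a" if "u \<in> reachable t" "apex u = a" "end1 u - apex u \<in> quarter_turns d" for u a
    unfolding P_def
  proof
    fix w assume "w \<in> quarter_turns d"
    then have "w \<in> quarter_turns (end1 u - apex u)"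
      using that(3) quarter_turns_sym quarter_turns_trans by blast
    then show "\<exists>u\<in>reachable t. apex u = a \<and> end1 u - apex u = w"
      using reachable_turns[OF t that(1)] that(2) by metis
  qed
  have step: "P (a + (1 + \<i>) * w)" if Pa: "P a" and w: "w \<in> quarter_turns d" for a w
  proof -
    obtain u where u: "u \<in> reachable t" "apex u = a" "end1 u - apex u = w"
      using Pa w unfolding P_def by blast
    obtain x where x: "x \<in> reachable t" "apex x = apex u + (1 + \<i>) * (end1 u - apex u)"
      "end1 x - apex x = end1 u - apex u"
      using reachable_translate[OF t u(1)] by blast
    have "apex x = a + (1 + \<i>) * w" "end1 x - apex x \<in> quarter_turns d"
      unfolding x(3) unfolding x(2) u(3) using u(2) w by simp_all
    then show ?thesis
      by (rule PI[OF x(1)])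
  qed
  have steps: "P a \<Longrightarrow> P (a + (1 + \<i>) * d)" "P a \<Longrightarrow> P (a - (1 + \<i>) * d)"
    "P a \<Longrightarrow> P (a + \<i> * ((1 + \<i>) * d))" "P a \<Longrightarrow>
      P (a - \<i> * ((1 + \<i>) * d))" for a
    using step[of a d] step[of a "- d"] step[of a "\<i> * d"] step[of a "- (\<i> * d)"]
    by (simp_all add: quarter_turns_def mult_ac)
  have "t \<in> reachable t"
    by (simp add: reachable_def)
  then have "P (apex t)"
    by (rule PI) (simp_all add: d)
  then have "P (apex t + of_int m * ((1 + \<i>) * d))"
    using int_translates[of P "apex t" "(1 + \<i>) * d" m] steps(1,2) by blast
  then have "P (apex t + of_int m * ((1 + \<i>) * d) + of_int n * (\<i> * ((1 + \<i>) * d)))"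
    using int_translates[of P _ "\<i> * ((1 + \<i>) * d)" n] steps(3,4) by blast
  then have "P (apex t + (of_int m + of_int n * \<i>) * ((1 + \<i>) * d))"
    by (simp add: algebra_simps)
  then show ?thesis
    using w unfolding P_def by blast
qed

text \<open>The four tiles at a lattice point form a square with this center, whose side is the
  lattice spacing, so these squares fill the plane. Rounding \<open>w\<close> selects the square,
  and the signs of \<open>x - y\<close> and \<open>x + y\<close> select the tile.\<close>

lemma reachable_cover:
  assumes t: "t \<in> T"
  shows "\<exists>u\<in>reachable t. z \<in> triangle u"
proof -
  define d where "d = end1 t - apex t"
  have nz: "d \<noteq> 0" "(1 + \<i>) * d \<noteq> 0"
    using tile_distinct(1)[OF tile[OF t]] by (auto simp: d_def complex_eq_iff[of "1 + \<i>"])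
  define w where "w = (z - apex t) / ((1 + \<i>) * d)"
  define m n where "m = round (Re w)" and "n = round (Im w)"
  define x y where "x = Re w - m" and "y = Im w - n"
  have xy: "\<bar>x\<bar> \<le> 1 / 2" "\<bar>y\<bar> \<le> 1 / 2"
    using of_int_round_abs_le[of "Re w"] of_int_round_abs_le[of "Im w"]
    by (simp_all add: x_def y_def m_def n_def abs_minus_commute)
  define a where "a = apex t + (of_int m + of_int n * \<i>) * ((1 + \<i>) * d)"
  have "w = of_int m + of_int n * \<i> + Complex x y"
    by (simp add: complex_eq_iff x_def y_def)
  moreover have "z = apex t + w * ((1 + \<i>) * d)"
    using nz(2) by (simp add: w_def)
  ultimately have "z = a + Complex x y * ((1 + \<i>) * d)"
    by (simp add: a_def algebra_simps)
  moreover have "Complex x y * (1 + \<i>) = Complex (x - y) (x + y)"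
    by (simp add: complex_eq_iff)
  ultimately have z: "z = a + Complex (x - y) (x + y) * d"
    by (simp add: mult.assoc[symmetric])
  have sum: "\<bar>x - y\<bar> + \<bar>x + y\<bar> \<le> 1"
    using xy by linarith
  have gen: "\<exists>u\<in>reachable t. z \<in> triangle u"
    if k: "k \<in> quarter_turns d" and zk: "z = a + Complex b c * k" and bc: "0 \<le> b" "0 \<le> c"
      "b + c \<le> 1" for k b c
  proof -
    obtain u where u: "u \<in> reachable t" "apex u = a" "end1 u - apex u = k"
      using reachable_lattice[OF t d_def k] unfolding a_def by blast
    have ut: "triangle_tile s u"
      using tile reachable_subset[OF t u(1)] .
    have "tile_coord u z = Complex b c"
      using tile_coord_add[OF ut, of "Complex b c"] unfolding u(2,3) zk using u(2,3) by simp
    then have "z \<in> triangle u"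
      using triangle_iff[OF ut, of z] bc by simp
    then show ?thesis
      using u(1) by blast
  qed
  let ?X = "x - y" and ?Y = "x + y"
  consider "0 \<le> ?X" "0 \<le> ?Y" | "?X \<le> 0" "0 \<le> ?Y" | "?X \<le> 0"
    "?Y \<le> 0" | "0 \<le> ?X" "?Y \<le> 0"
    by linarith
  then show ?thesis
  proof cases
    case 1
    then show ?thesis
      using z sum by (intro gen[of d ?X ?Y]) auto
  next
    case 2
    have "Complex ?X ?Y = Complex ?Y (- ?X) * \<i>"
      by (simp add: complex_eq_iff)
    then have "z = a + Complex ?Y (- ?X) * (\<i> * d)"
      using z by (simp add: mult.assoc)
    then show ?thesis
      using 2 sum by (intro gen[of "\<i> * d" ?Y "- ?X"]) (auto simp: quarter_turns_def)
  next
    case 3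
    have "Complex ?X ?Y = - Complex (- ?X) (- ?Y)"
      by (simp add: complex_eq_iff)
    then have "z = a + Complex (- ?X) (- ?Y) * (- d)"
      using z by simp
    then show ?thesis
      using 3 sum by (intro gen[of "- d" "- ?X" "- ?Y"]) (auto simp: quarter_turns_def)
  next
    case 4
    have "Complex ?X ?Y = - (Complex (- ?Y) ?X * \<i>)"
      by (simp add: complex_eq_iff)
    then have "z = a + Complex (- ?Y) ?X * (- (\<i> * d))"
      using z by (simp add: mult.assoc)
    then show ?thesis
      using 4 sum by (intro gen[of "- (\<i> * d)" "- ?Y" ?X]) (auto simp: quarter_turns_def)
  qed
qed

end

context geometric_tiling
begin

text \<open>The tiles reachable from \<open>t0\<close> already cover the plane. One of them contains
  the center of \<open>t\<close>, an interior point, and therefore is \<open>t\<close>.\<close>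

lemma connected:
  assumes "t0 \<in> T" "t \<in> T"
  shows "(\<lambda>x y. y \<in> T \<and> adjacent x y)\<^sup>*\<^sup>* t0 t"
proof -
  obtain u where u: "u \<in> reachable t0" "center t \<in> triangle u"
    using reachable_cover[OF assms(1)] by blast
  have "t = u"
    using strictly_inside_eq[OF assms(2) reachable_subset[OF assms(1) u(1)] center_inside(1)[OF
      assms(2)] u(2)] .
  then show ?thesis
    using u(1) by (simp add: reachable_def)
qed

end

theorem theorem4:
  fixes s :: real and T :: "tile set"
  assumes "correct_tiling s T"
  shows "substitution_tiling s T"
proof -
  interpret geometric_tiling s T
    by unfold_locales fact
  obtain t0 where t0: "t0 \<in> T"
    using cover by blast
  show ?thesis
    unfolding substitution_tiling_def
    using legal_supertile finite_connected_legal[OF coherent t0 connected[OF t0]] by blast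
qed

end
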